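(* There exist a constant $c>0$, independent of $\Delta t$, $N$ and $u$, and a $\Delta t_0>0$ such that, whenever $\Delta t=T/N\le\Delta t_0$, the solution $(u^n)_{n=1}^N$, $u^n\in H^1(\Omega^n)$, of the semi-discrete scheme $$\frac{1}{\Delta t}\left[\int_{\Omega^n}u^n v\,dx-\int_{\Omega^{n-1}}u^{n-1}\,\mathcal{E}v\,dx\right]+a^n(u^n,v)=f^n(v)\qquad\text{for all } v\in H^1(\Omega^n),\ n=1,\dots,N,$$ with given initial value $u^0\in H^1(\Omega^0)$, satisfies $$\|u^N\|_{\Omega^N}^2+\Delta t\sum_{n=1}^N\frac{\nu}{2}\|\nabla u^n\|_{\Omega^n}^2\;\le\;\exp(cT)\left[\|u^0\|_{\Omega^0}^2+\Delta t\sum_{n=1}^N\frac{2}{\nu}\|f^n\|_{H^{-1}(\Omega^n)}^2\right].$$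
   Context: Let $d\in\{2,3\}$, $T>0$, $\nu>0$ a constant. Let $\widetilde\Omega\subset\mathbb{R}^d$ be a fixed background domain and $\mathbf{w}:\widetilde\Omega\times(0,T)\to\mathbb{R}^d$ a smooth flow field. The time-dependent domain $\Omega(t)$, $t\in[0,T]$, evolves smoothly, is bounded, satisfies $\Omega(t)\subset\widetilde\Omega$, and is passively transported by $\mathbf{w}$: $\Omega(t)=\Psi(t,\Omega_0)$, where $\Psi(0,y)=y$, $\partial_t\Psi(t,y)=\mathbf{w}(t,\Psi(t,y))$, and $\Omega_0=\Omega(0)$ is piecewise smooth and Lipschitz. Let $f$ be a given source term. Let $\Delta t=T/N$, $N\in\mathbb{N}$, $t_n=n\Delta t$, $\Omega^n=\Omega(t_n)$, $\mathbf{w}^n=\mathbf{w}(t_n)$, $f^n=f(t_n)$. Define $$a^n(u,v)=\int_{\Omega^n}\nu\nabla u\cdot\nabla v-u\,(\mathbf{w}^n\cdot\nabla v)\,dx,\qquad f^n(v)=\int_{\Omega^n}f(t_n)\,v\,dx .$$ $\|\cdot\|_S$ denotes the $L^2(S)$ norm. $\|f^n\|_{H^{-1}(\Omega^n)}$ is the norm of the functional $v\mapsto f^n(v)$ in the dual of $H^1(\Omega^n)$. $\mathcal{E}:L^2(\Omega(t))\to L^2(\widetilde\Omega)$ is a linear extension operator (based on Stein's universal extension for Sobolev spaces) with $\mathcal{E}u=u$ in $\Omega(t)$, $\|\mathcal{E}u\|_{H^k(\widetilde\Omega)}\le C\|u\|_{H^k(\Omega(t))}$ and $\|\nabla\mathcal{E}u\|_{\widetilde\Omega}\le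 C\|\nabla u\|_{\Omega(t)}$, with $C$ independent of $\Delta t$; in the scheme $\mathcal{E}v$ is the extension of $v$ from $\Omega^n$. *)

theory Defs
  imports "HOL-Analysis.Analysis"
begin

section \<open>Smooth functions\<close>

text \<open>Meant for open \<open>U\<close>: the Frechet derivative in every fixed direction is again
  \<open>k\<close> times continuously differentiable.\<close>

primrec Ck_on :: "nat \<Rightarrow> 'a::euclidean_space set \<Rightarrow> ('a \<Rightarrow> 'b::real_normed_vector) \<Rightarrow> bool" where
  "Ck_on 0 U f \<longleftrightarrow> continuous_on U f"
| "Ck_on (Suc k) U f \<longleftrightarrow>
     f differentiable_on U \<and> (\<forall>h. Ck_on k U (\<lambda>x. frechet_derivative f (at x) h))"

definition smooth_fun_on :: "'a::euclidean_space set \<Rightarrow> ('a \<Rightarrow> 'b::real_normed_vector) \<Rightarrow> bool" where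
  "smooth_fun_on U f \<longleftrightarrow> (\<forall>k. Ck_on k U f)"

text \<open>Smoothness on a set that need not be open, including up to its boundary: \<open>f\<close> agrees on \<open>S\<close>
  with a function that is smooth on a neighbourhood of the closure of \<open>S\<close>.\<close>

definition smooth_up_to_boundary ::
    "'a::euclidean_space set \<Rightarrow> ('a \<Rightarrow> 'b::real_normed_vector) \<Rightarrow> bool" where
  "smooth_up_to_boundary S f \<longleftrightarrow>
     (\<exists>U g. open U \<and> closure S \<subseteq> U \<and> smooth_fun_on U g \<and> (\<forall>x\<in>S. g x = f x))"


section \<open>Domains\<close>

definition domain_set :: "'a::euclidean_space set \<Rightarrow> bool" where
  "domain_set S \<longleftrightarrow> open S \<and> connected S \<and> S \<noteq> {}"

text \<open>Near each boundary point \<open>p\<close>, in a cylinder with axis \<open>e\<close>, the set is the strict subgraph of a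
  Lipschitz function of the component orthogonal to \<open>e\<close>.\<close>

definition lipschitz_boundary :: "'a::euclidean_space set \<Rightarrow> bool" where
  "lipschitz_boundary S \<longleftrightarrow>
     (\<forall>p\<in>frontier S. \<exists>(e::'a) (r::real) (h::real) (L::real) (\<phi>::'a \<Rightarrow> real).
        norm e = 1 \<and> r > 0 \<and> h > 0 \<and> L-lipschitz_on UNIV \<phi> \<and>
        (\<forall>x. let s = (x - p) \<bullet> e; y = (x - p) - s *\<^sub>R e in
             norm y < r \<and> \<bar>s\<bar> < h \<longrightarrow> (x \<in> S \<longleftrightarrow> s < \<phi> y)))"

definition smooth_hypersurface :: "'a::euclidean_space set \<Rightarrow> bool" where
  "smooth_hypersurface M \<longleftrightarrow>
     (\<forall>p\<in>M. \<exists>U (g::'a \<Rightarrow> real). open U \<and> p \<in> U \<and> smooth_fun_on U g \<and>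
        (\<forall>x\<in>U. \<exists>h. frechet_derivative g (at x) h \<noteq> 0) \<and> M \<inter> U = {x\<in>U. g x = 0})"

text \<open>The boundary is the union of the closures of finitely many disjoint relatively open pieces,
  and each piece is smooth up to its own boundary (its closure lies in a smooth hypersurface).\<close>

definition piecewise_smooth_boundary :: "'a::euclidean_space set \<Rightarrow> bool" where
  "piecewise_smooth_boundary S \<longleftrightarrow>
     (\<exists>F. finite F \<and> disjoint F \<and> frontier S = (\<Union>P\<in>F. closure P) \<and>
        (\<forall>P\<in>F. openin (top_of_set (frontier S)) P \<and>
               (\<exists>M. smooth_hypersurface M \<and> closure P \<subseteq> M)))"

definition passively_transported ::
    "real \<Rightarrow> (real \<Rightarrow> 'a::euclidean_space \<Rightarrow> 'a) \<Rightarrow> (real \<Rightarrow> 'a \<Rightarrow> 'a) \<Rightarrow> (real \<Rightarrow> 'a set) \<Rightarrow> bool" where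
  "passively_transported T w \<Psi> \<Omega> \<longleftrightarrow>
     (\<forall>y\<in>\<Omega> 0. \<Psi> 0 y = y) \<and>
     (\<forall>y\<in>\<Omega> 0. \<forall>t\<in>{0..T}.
        ((\<lambda>s. \<Psi> s y) has_vector_derivative w t (\<Psi> t y)) (at t within {0..T})) \<and>
     (\<forall>t\<in>{0..T}. \<Omega> t = \<Psi> t ` \<Omega> 0)"


section \<open>Lebesgue and Sobolev spaces\<close>

text \<open>Elements are functions rather than classes; equality in these spaces is equality almost
  everywhere on \<open>S\<close>, and values outside \<open>S\<close> are irrelevant.\<close>

definition L2_space :: "'a::euclidean_space set \<Rightarrow> ('a \<Rightarrow> real) set" where
  "L2_space S = {u. u \<in> borel_measurable (lebesgue_on S) \<and>
                    integrable (lebesgue_on S) (\<lambda>x. (u x)\<^sup>2)}"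

definition L2_norm :: "'a::euclidean_space set \<Rightarrow> ('a \<Rightarrow> 'b::real_normed_vector) \<Rightarrow> real" where
  "L2_norm S g = sqrt (\<integral>x. (norm (g x))\<^sup>2 \<partial>lebesgue_on S)"

text \<open>Iterated partial derivatives along a list of coordinate indices.\<close>

primrec partials :: "'d::finite list \<Rightarrow> (real^'d \<Rightarrow> real) \<Rightarrow> (real^'d \<Rightarrow> real)" where
  "partials [] \<phi> = \<phi>"
| "partials (i # is) \<phi> = (\<lambda>x. frechet_derivative (partials is \<phi>) (at x) (axis i 1))"

definition test_functions :: "'a::euclidean_space set \<Rightarrow> ('a \<Rightarrow> real) set" where
  "test_functions S = {\<phi>. smooth_fun_on UNIV \<phi> \<and> compact (closure {x. \<phi> x \<noteq> 0}) \<and>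
                          closure {x. \<phi> x \<noteq> 0} \<subseteq> S}"

definition has_weak_partials ::
    "(real^'d::finite) set \<Rightarrow> 'd list \<Rightarrow> (real^'d \<Rightarrow> real) \<Rightarrow> (real^'d \<Rightarrow> real) \<Rightarrow> bool" where
  "has_weak_partials S is u g \<longleftrightarrow>
     (\<forall>\<phi>\<in>test_functions S.
        (\<integral>x. u x * partials is \<phi> x \<partial>lebesgue_on S)
          = (-1) ^ length is * (\<integral>x. g x * \<phi> x \<partial>lebesgue_on S))"

text \<open>A representative of the weak derivative, which is unique almost everywhere on open \<open>S\<close>.\<close>

definition weak_partials ::
    "(real^'d::finite) set \<Rightarrow> 'd list \<Rightarrow> (real^'d \<Rightarrow> real) \<Rightarrow> (real^'d \<Rightarrow> real)" where
  "weak_partials S is u =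
     (if is = [] then u else (SOME g. g \<in> L2_space S \<and> has_weak_partials S is u g))"

definition sobolev :: "nat \<Rightarrow> (real^'d::finite) set \<Rightarrow> (real^'d \<Rightarrow> real) set" where
  "sobolev k S = {u \<in> L2_space S.
     \<forall>is. length is \<le> k \<longrightarrow> (\<exists>g\<in>L2_space S. has_weak_partials S is u g)}"

text \<open>Summing over lists of indices gives the sum of the squared \<open>L2\<close> norms of the full derivative
  tensors of order at most \<open>k\<close>, with the Frobenius norm.\<close>

definition sobolev_norm :: "nat \<Rightarrow> (real^'d::finite) set \<Rightarrow> (real^'d \<Rightarrow> real) \<Rightarrow> real" where
  "sobolev_norm k S u = sqrt (\<Sum>is | length is \<le> k. (L2_norm S (weak_partials S is u))\<^sup>2)"

definition weak_grad :: "(real^'d::finite) set \<Rightarrow> (real^'d \<Rightarrow> real) \<Rightarrow> real^'d \<Rightarrow> real^'d" where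
  "weak_grad S u x = (\<chi> i. weak_partials S [i] u x)"

text \<open>Norm in the dual of \<open>H1(S)\<close>.\<close>

definition dual_H1_norm :: "(real^'d::finite) set \<Rightarrow> ((real^'d \<Rightarrow> real) \<Rightarrow> real) \<Rightarrow> real" where
  "dual_H1_norm S F = (SUP v\<in>{v \<in> sobolev 1 S. sobolev_norm 1 S v \<le> 1}. \<bar>F v\<bar>)"


section \<open>Extension operator\<close>

text \<open>\<open>E t\<close> extends functions from \<open>\<Omega> t\<close> to \<open>B\<close>. The constants do not depend on \<open>t\<close>, so that
  they serve all time grids at once.\<close>

definition extension_operator ::
    "real \<Rightarrow> (real^'d::finite) set \<Rightarrow> (real \<Rightarrow> (real^'d) set)
      \<Rightarrow> (real \<Rightarrow> (real^'d \<Rightarrow> real) \<Rightarrow> (real^'d \<Rightarrow> real)) \<Rightarrow> bool" where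
  "extension_operator T B \<Omega> E \<longleftrightarrow>
     (\<forall>t\<in>{0..T}. \<forall>u\<in>L2_space (\<Omega> t).
        E t u \<in> L2_space B \<and> (AE x in lebesgue_on (\<Omega> t). E t u x = u x)) \<and>
     (\<forall>t\<in>{0..T}. \<forall>u\<in>L2_space (\<Omega> t). \<forall>v\<in>L2_space (\<Omega> t). \<forall>a b.
        AE x in lebesgue_on B. E t (\<lambda>y. a * u y + b * v y) x = a * E t u x + b * E t v x) \<and>
     (\<forall>k. \<exists>C. \<forall>t\<in>{0..T}. \<forall>u\<in>sobolev k (\<Omega> t).
        E t u \<in> sobolev k B \<and> sobolev_norm k B (E t u) \<le> C * sobolev_norm k (\<Omega> t) u) \<and>
     (\<exists>C. \<forall>t\<in>{0..T}. \<forall>u\<in>sobolev 1 (\<Omega> t).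
        L2_norm B (weak_grad B (E t u)) \<le> C * L2_norm (\<Omega> t) (weak_grad (\<Omega> t) u))"


section \<open>The semi-discrete scheme\<close>

definition bilin_form ::
    "real \<Rightarrow> (real^'d::finite) set \<Rightarrow> (real^'d \<Rightarrow> real^'d) \<Rightarrow> (real^'d \<Rightarrow> real) \<Rightarrow> (real^'d \<Rightarrow> real) \<Rightarrow> real" where
  "bilin_form \<nu> S b u v =
     (\<integral>x. \<nu> * (weak_grad S u x \<bullet> weak_grad S v x) - u x * (b x \<bullet> weak_grad S v x) \<partial>lebesgue_on S)"

definition load_functional :: "'a::euclidean_space set \<Rightarrow> ('a \<Rightarrow> real) \<Rightarrow> ('a \<Rightarrow> real) \<Rightarrow> real" where
  "load_functional S g v = (\<integral>x. g x * v x \<partial>lebesgue_on S)"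

text \<open>At each time the source term induces a well-defined bounded functional on \<open>H1\<close>; this covers
  square integrable sources.\<close>

definition source_term ::
    "real \<Rightarrow> (real \<Rightarrow> (real^'d::finite) set) \<Rightarrow> (real \<Rightarrow> real^'d \<Rightarrow> real) \<Rightarrow> bool" where
  "source_term T \<Omega> f \<longleftrightarrow>
     (\<forall>t\<in>{0..T}.
        (\<forall>v\<in>sobolev 1 (\<Omega> t). integrable (lebesgue_on (\<Omega> t)) (\<lambda>x. f t x * v x)) \<and>
        (\<exists>K. \<forall>v\<in>sobolev 1 (\<Omega> t).
           \<bar>load_functional (\<Omega> t) (f t) v\<bar> \<le> K * sobolev_norm 1 (\<Omega> t) v))"

definition grid_time :: "real \<Rightarrow> nat \<Rightarrow> nat \<Rightarrow> real" where
  "grid_time T N n = real n * (T / real N)"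

definition scheme_solution ::
    "real \<Rightarrow> real \<Rightarrow> (real \<Rightarrow> real^'d::finite \<Rightarrow> real^'d) \<Rightarrow> (real \<Rightarrow> (real^'d) set)
      \<Rightarrow> (real \<Rightarrow> (real^'d \<Rightarrow> real) \<Rightarrow> (real^'d \<Rightarrow> real)) \<Rightarrow> (real \<Rightarrow> real^'d \<Rightarrow> real)
      \<Rightarrow> nat \<Rightarrow> (nat \<Rightarrow> real^'d \<Rightarrow> real) \<Rightarrow> bool" where
  "scheme_solution T \<nu> w \<Omega> E f N u \<longleftrightarrow>
     (let \<Delta>t = T / real N; t = grid_time T N in
        (\<forall>n\<in>{0..N}. u n \<in> sobolev 1 (\<Omega> (t n))) \<and>
        (\<forall>n\<in>{1..N}. \<forall>v\<in>sobolev 1 (\<Omega> (t n)).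
           1 / \<Delta>t * ((\<integral>x. u n x * v x \<partial>lebesgue_on (\<Omega> (t n)))
                     - (\<integral>x. u (n - 1) x * E (t n) v x \<partial>lebesgue_on (\<Omega> (t (n - 1)))))
             + bilin_form \<nu> (\<Omega> (t n)) (w (t n)) (u n) v
           = load_functional (\<Omega> (t n)) (f (t n)) v))"

end

theory Submission
  imports Defs
begin

text \<open>Testing the scheme with \<open>v = u\<^sup>n\<close> reduces the estimate, through Young's inequality and a
  discrete Gronwall argument, to
  \<open>\<parallel>U\<parallel>\<^sup>2 on \<Omega> s \<le> \<parallel>U\<parallel>\<^sup>2 on \<Omega> t + A \<bar>s - t\<bar> (\<parallel>U\<parallel>\<^sup>2 + \<parallel>U\<parallel> \<parallel>\<nabla>U\<parallel>) on B\<close> for \<open>U \<in> H\<^sup>1(B)\<close>, applied to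
  \<open>U = E t u\<^sup>n\<close>. Gronwall's inequality for trajectories shows that the flow map \<open>\<Phi>\<close> from \<open>\<Omega> t\<close> to
  \<open>\<Omega> s\<close> is Lipschitz with constant \<open>exp (L \<bar>s - t\<bar>)\<close>. A Lipschitz map with constant \<open>K\<close> enlarges
  Lebesgue measure at most by the factor \<open>K ^ d\<close>, so no Jacobians are needed to compare integrals
  over \<open>\<Omega> s\<close> and \<open>\<Omega> t\<close>. Finally \<open>\<parallel>U \<circ> \<Phi> - U\<parallel> \<le> C \<bar>s - t\<bar> \<parallel>\<nabla>U\<parallel>\<close> follows by differentiating along
  trajectories after mollification, on compact subsets of \<open>\<Omega> t\<close>: their images stay away from
  the boundary of \<open>B\<close>, which \<open>\<Omega> t\<close> itself may touch.\<close>

section \<open>Continuously differentiable functions\<close>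

text \<open>The scheme pairs \<open>u (n - 1)\<close> on the previous domain with an extension from
  the new one, so each step compares \<open>L2\<close> norms of one function on two domains. Over
  \<open>N\<close> steps the factor lost must be 1 + O(dt); a fixed factor per step would grow like
  its N-th power. It matters as well that the comparison error contains the gradient only in a
  product with the norm of the function: by Young's inequality such a product, with any coefficient,
  is absorbed by the viscous term at the price of a squared norm, whereas a squared gradient with a
  large coefficient could not be. After doubling the tested identity the viscous budget is
  \<open>2 * \<nu>\<close>: \<open>\<nu> / 2\<close> pays for the source, \<open>\<nu>\<close> for
  all products of function and gradient, and the \<open>\<nu> / 2\<close> of the claim remains. The
  squared norms collected on the way form \<open>c\<close>; treating them implicitly requires c dt
  <= 1/2, the origin of the step bound \<open>1 / (2 * c)\<close> and of \<open>2 * c\<close> in the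
  exponent. Since \<open>B\<close> may be unbounded, the constants of the velocity come from the
  closure of the space-time region swept by the domain, which is compact.\<close>

lemma Ck_on_has_derivative:
  assumes "open U" "Ck_on (Suc k) U f" "x \<in> U"
  shows "(f has_derivative frechet_derivative f (at x)) (at x)"
proof -
  have "f differentiable (at x within U)" using assms(2,3) by (simp add: differentiable_on_def)
  then have "f differentiable (at x)" using at_within_open[OF assms(3,1)] by simp
  then show ?thesis using frechet_derivative_works by blast
qed

lemma Ck_on_cong:
  assumes "open U" "\<And>x. x \<in> U \<Longrightarrow> f x = g x" "Ck_on k U f"
  shows "Ck_on k U g"
  using assms
proof (induction k arbitrary: f g)
  case 0
  then show ?case using continuous_on_eq[of U f g] by simp
next
  case (Suc k)
  have D: "(f has_derivative frechet_derivative f (at x)) (at x)" if "x \<in> U" for x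
    by (rule Ck_on_has_derivative[OF Suc.prems(1,3) that])
  have D': "(g has_derivative frechet_derivative f (at x)) (at x)" if "x \<in> U" for x
    using has_derivative_transform_within_open[OF D[OF that] Suc.prems(1) that] Suc.prems(2) by blast
  have eq: "frechet_derivative g (at x) = frechet_derivative f (at x)" if "x \<in> U" for x
    using frechet_derivative_at[OF D'[OF that]] by simp
  have "g differentiable_on U"
    using D' by (auto simp: differentiable_on_def differentiable_def intro: has_derivative_at_withinI)
  moreover have "Ck_on k U (\<lambda>x. frechet_derivative g (at x) h)" for h
    by (rule Suc.IH[of "\<lambda>x. frechet_derivative f (at x) h"]) (use Suc.prems(1,3) eq in simp_all)
  ultimately show ?case by simp
qed

text \<open>The recursion of \<open>Ck_on\<close> speaks of \<open>frechet_derivative\<close>; this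
  rule lets any explicit derivative take its place, since the two agree on the open set
  \<open>U\<close> by uniqueness.\<close>

lemma Ck_on_Suc_intro:
  assumes "open U" "\<And>x. x \<in> U \<Longrightarrow> (f has_derivative f' x) (at x)"
    and "\<And>h. Ck_on k U (\<lambda>x. f' x h)"
  shows "Ck_on (Suc k) U f"
proof -
  have "frechet_derivative f (at x) = f' x" if "x \<in> U" for x
    using frechet_derivative_at[OF assms(2)[OF that]] by simp
  moreover have "f differentiable_on U"
    using assms(2) by (auto simp: differentiable_on_def differentiable_def intro: has_derivative_at_withinI)
  ultimately show ?thesis
    using Ck_on_cong[OF assms(1) _ assms(3)] by auto
qed

lemma Ck_on_pred: "Ck_on (Suc k) U f \<Longrightarrow> Ck_on k U f"
proof (induction k arbitrary: f)
  case 0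
  then show ?case by (simp add: differentiable_imp_continuous_on)
next
  case (Suc k)
  have "Ck_on k U (\<lambda>x. frechet_derivative f (at x) h)" for h
    by (rule Suc.IH) (use Suc.prems in \<open>simp only: Ck_on.simps, blast\<close>)
  then show ?case using Suc.prems by simp
qed

lemma Ck_on_const: "Ck_on k U (\<lambda>x. c)"
  by (induction k arbitrary: c) auto

lemma Ck_on_add:
  assumes "open U" "Ck_on k U f" "Ck_on k U g"
  shows "Ck_on k U (\<lambda>x. f x + g x)"
  using assms
proof (induction k arbitrary: f g)
  case (Suc k)
  show ?case
    by (rule Ck_on_Suc_intro[where f' = "\<lambda>x h. frechet_derivative f (at x) h + frechet_derivative g (at x) h"])
       (use Suc.prems in \<open>auto intro!: has_derivative_add Ck_on_has_derivative Suc.IH simp del: Ck_on.simps(2)\<close>,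
        use Suc.prems Suc.IH in auto)
qed (auto intro: continuous_intros)

lemma Ck_on_mult:
  fixes f g :: "'a::euclidean_space \<Rightarrow> real"
  assumes "open U" "Ck_on k U f" "Ck_on k U g"
  shows "Ck_on k U (\<lambda>x. f x * g x)"
  using assms
proof (induction k arbitrary: f g)
  case (Suc k)
  show ?case
  proof (rule Ck_on_Suc_intro[where f' = "\<lambda>x h. f x * frechet_derivative g (at x) h + frechet_derivative f (at x) h * g x"])
    show "Ck_on k U (\<lambda>x. f x * frechet_derivative g (at x) h + frechet_derivative f (at x) h * g x)" for h
      \<comment> \<open>The product rule leaves one factor undifferentiated, which therefore enters
        the induction hypothesis at the lower order \<open>k\<close>.\<close>
      using Suc.prems Ck_on_pred[OF Suc.prems(2)] Ck_on_pred[OF Suc.prems(3)]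
      by (intro Ck_on_add Suc.IH) auto
  qed (use Suc.prems in \<open>auto intro!: has_derivative_mult Ck_on_has_derivative simp del: Ck_on.simps(2)\<close>)
qed (auto intro: continuous_intros)

text \<open>The functions \<open>s\<^sup>-\<^sup>m exp (-1/s)\<close>, extended by zero: their span is closed under differentiation.\<close>

definition flat_exp :: "nat \<Rightarrow> real \<Rightarrow> real" where
  "flat_exp m s = (if s \<le> 0 then 0 else exp (- inverse s) * inverse s ^ m)"

lemma flat_exp_nonneg: "flat_exp m s \<ge> 0"
  by (auto simp: flat_exp_def)

text \<open>One term of the exponential series at \<open>inverse s\<close> already dominates the
  power; the term of order \<open>m + 2\<close> leaves a factor \<open>s\<^sup>2\<close>, which
  makes the difference quotient at zero vanish in the limit.\<close>

lemma flat_exp_le: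
  assumes "s > 0"
  shows "flat_exp m s \<le> fact (m + 2) * s\<^sup>2"
proof -
  have "inverse s ^ (m + 2) / fact (m + 2) \<le> exp (inverse s)"
    using sum_le_suminf[OF summable_exp[of "inverse s"], of "{m + 2}"] assms
    by (simp add: exp_def divide_inverse mult.commute scaleR_conv_of_real)
  then have "inverse s ^ (m + 2) \<le> fact (m + 2) * exp (inverse s)"
    by (simp add: divide_le_eq mult.commute)
  then have "exp (- inverse s) * s\<^sup>2 * inverse s ^ (m + 2)
      \<le> exp (- inverse s) * s\<^sup>2 * (fact (m + 2) * exp (inverse s))"
    by (intro mult_left_mono) auto
  also have "\<dots> = fact (m + 2) * s\<^sup>2"
    by (simp add: exp_minus)
  also have "exp (- inverse s) * s\<^sup>2 * inverse s ^ (m + 2) = flat_exp m s"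
    using assms by (simp add: flat_exp_def power_add power2_eq_square field_simps)
  finally show ?thesis .
qed

text \<open>Only the origin needs an argument: there \<open>flat_exp_le\<close> bounds the
  difference quotient by a multiple of \<open>\<bar>h\<bar>\<close>. Elsewhere this is the
  derivative of zero, or of exp(-1/s) s^(-m), on an open half line.\<close>

lemma flat_exp_has_derivative:
  "(flat_exp m has_real_derivative (flat_exp (m + 2) s - real m * flat_exp (m + 1) s)) (at s)"
proof (cases s "0 :: real" rule: linorder_cases)
  case less
  have "((\<lambda>s. 0) has_real_derivative 0) (at s)" by simp
  then have "(flat_exp m has_real_derivative 0) (at s)"
    by (rule has_field_derivative_transform_within_open[of _ _ _ "{..<0}"]) (use less in \<open>auto simp: flat_exp_def\<close>)
  then show ?thesis using less by (simp add: flat_exp_def)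
next
  case greater
  have "((\<lambda>s. exp (- inverse s) * inverse s ^ m) has_real_derivative
      (flat_exp (m + 2) s - real m * flat_exp (m + 1) s)) (at s)"
  proof -
    have 1: "(inverse has_real_derivative - (inverse s * inverse s)) (at s)"
      using DERIV_inverse[of s UNIV] greater by (simp add: power2_eq_square)
    have "((\<lambda>s. exp (- inverse s) * inverse s ^ m) has_real_derivative
        (exp (- inverse s) * - (- (inverse s * inverse s))) * inverse s ^ m +
        (real m * (- (inverse s * inverse s) * inverse s ^ (m - Suc 0))) * exp (- inverse s)) (at s)"
      by (intro DERIV_mult DERIV_fun_exp DERIV_minus DERIV_power 1)
    also have "(exp (- inverse s) * - (- (inverse s * inverse s))) * inverse s ^ m +
        (real m * (- (inverse s * inverse s) * inverse s ^ (m - Suc 0))) * exp (- inverse s)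
        = flat_exp (m + 2) s - real m * flat_exp (m + 1) s"
      using greater by (cases m) (simp_all add: flat_exp_def algebra_simps)
    finally show ?thesis .
  qed
  then show ?thesis
    by (rule has_field_derivative_transform_within_open[of _ _ _ "{0<..}"]) (use greater in \<open>auto simp: flat_exp_def\<close>)
next
  case equal
  have "((\<lambda>h. flat_exp m h / h) \<longlongrightarrow> 0) (at 0)"
  proof (rule Lim_null_comparison)
    have "norm (flat_exp m h / h) \<le> fact (m + 2) * \<bar>h\<bar>" if "h \<noteq> 0" for h
    proof (cases "h > 0")
      case True
      then show ?thesis using flat_exp_le[OF True, of m] flat_exp_nonneg[of m h]
        by (auto simp: field_simps power2_eq_square)
    next
      case False
      then have "flat_exp m h = 0" by (simp add: flat_exp_def)
      then show ?thesis by simp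
    qed
    then show "\<forall>\<^sub>F h in at 0. norm (flat_exp m h / h) \<le> fact (m + 2) * \<bar>h\<bar>"
      by (auto simp: eventually_at_filter)
    show "((\<lambda>h::real. fact (m + 2) * \<bar>h\<bar>) \<longlongrightarrow> 0) (at 0)"
      by (auto intro!: tendsto_eq_intros)
  qed
  then show ?thesis using equal by (simp add: has_field_derivative_iff flat_exp_def)
qed

lemma Ck_on_inner_diff:
  fixes x h :: "'a::euclidean_space"
  shows "Ck_on k UNIV (\<lambda>z. (x - z) \<bullet> h)"
proof (cases k)
  case (Suc j)
  show ?thesis unfolding Suc
    by (rule Ck_on_Suc_intro[where f' = "\<lambda>z v. - (v \<bullet> h)"])
       (auto intro!: derivative_eq_intros Ck_on_const)
qed (auto intro!: continuous_intros)

text \<open>The induction over \<open>k\<close> keeps \<open>m\<close> arbitrary because each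
  derivative raises it. The argument \<open>x - z\<close> appears since the test functions will be
  reflected translates of the bump.\<close>

lemma Ck_on_flat_exp:
  fixes x :: "'a::euclidean_space"
  shows "Ck_on k UNIV (\<lambda>z. flat_exp m (c - (x - z) \<bullet> (x - z)))"
proof (induction k arbitrary: m)
  case 0
  have "continuous_on UNIV (flat_exp m)"
    using flat_exp_has_derivative DERIV_isCont continuous_at_imp_continuous_on by blast
  then have "continuous_on UNIV (\<lambda>z. flat_exp m (c - (x - z) \<bullet> (x - z)))"
    by (rule continuous_on_compose2) (auto intro!: continuous_intros)
  then show ?case by simp
next
  case (Suc k)
  let ?q = "\<lambda>z. c - (x - z) \<bullet> (x - z)"
  show ?case
  proof (rule Ck_on_Suc_intro)
    fix z
    have q: "(?q has_derivative (\<lambda>h. 2 * ((x - z) \<bullet> h))) (at z)"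
      by (rule derivative_eq_intros refl)+ (simp add: inner_commute)
    show "((\<lambda>z. flat_exp m (?q z)) has_derivative (\<lambda>h. (2 * ((x - z) \<bullet> h)) *
        (flat_exp (m + 2) (?q z) - real m * flat_exp (m + 1) (?q z)))) (at z)"
      by (rule DERIV_compose_FDERIV[OF flat_exp_has_derivative q])
  next
    fix h
    have "Ck_on k UNIV (\<lambda>z. (2 * ((x - z) \<bullet> h)) *
        (flat_exp (m + 2) (?q z) + (- real m) * flat_exp (m + 1) (?q z)))"
      by (intro Ck_on_mult Ck_on_add Suc.IH Ck_on_const Ck_on_inner_diff open_UNIV)
    then show "Ck_on k UNIV (\<lambda>z. (2 * ((x - z) \<bullet> h)) *
        (flat_exp (m + 2) (?q z) - real m * flat_exp (m + 1) (?q z)))" by simp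
  qed simp
qed

text \<open>\<open>Ck_on\<close> gives continuity of the derivative in each fixed direction only; a
  bound uniform in the direction comes from summing the bounds over the basis.\<close>

lemma C1_derivative_bounded_on_compact:
  fixes f :: "'a::euclidean_space \<Rightarrow> 'b::real_normed_vector"
  assumes U: "open U" and f: "Ck_on (Suc 0) U f" and P: "compact P" "P \<subseteq> U"
  obtains N where "N \<ge> 0" "\<And>x h. x \<in> P \<Longrightarrow> norm (frechet_derivative f (at x) h) \<le> N * norm h"
proof -
  have "\<exists>M. \<forall>x\<in>P. norm (frechet_derivative f (at x) b) \<le> M" for b
  proof -
    have "continuous_on P (\<lambda>x. frechet_derivative f (at x) b)"
      by (rule continuous_on_subset[OF _ P(2)]) (use f in simp)
    from continuous_on_compact_bound[OF P(1) this] show ?thesis by metis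
  qed
  then obtain M where M: "\<And>x b. x \<in> P \<Longrightarrow> norm (frechet_derivative f (at x) b) \<le> M b" by metis
  define N where "N = (\<Sum>b\<in>Basis. \<bar>M b\<bar>)"
  have "norm (frechet_derivative f (at x) h) \<le> N * norm h" if x: "x \<in> P" for x h
  proof -
    have lin: "linear (frechet_derivative f (at x))"
      using Ck_on_has_derivative[OF U f] x P has_derivative_linear by blast
    have "norm (frechet_derivative f (at x) h) = norm (\<Sum>b\<in>Basis. (h \<bullet> b) *\<^sub>R frechet_derivative f (at x) b)"
      using linear_sum[OF lin, of "\<lambda>b. (h \<bullet> b) *\<^sub>R b" Basis] linear_cmul[OF lin]
      by (simp add: euclidean_representation)
    also have "\<dots> \<le> (\<Sum>b\<in>Basis. \<bar>M b\<bar> * norm h)"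
    proof (rule sum_norm_le)
      fix b :: 'a assume b: "b \<in> Basis"
      have "\<bar>h \<bullet> b\<bar> * norm (frechet_derivative f (at x) b) \<le> norm h * \<bar>M b\<bar>"
        using Basis_le_norm[OF b, of h] M[OF x, of b] by (intro mult_mono) auto
      then show "norm ((h \<bullet> b) *\<^sub>R frechet_derivative f (at x) b) \<le> \<bar>M b\<bar> * norm h"
        by (simp add: mult.commute)
    qed
    finally show ?thesis by (simp add: N_def sum_distrib_right)
  qed
  moreover have "N \<ge> 0" by (simp add: N_def sum_nonneg)
  ultimately show ?thesis using that by blast
qed

text \<open>\<open>Q\<close> is not assumed convex, so the mean value inequality is applied only
  within a ball of radius \<open>e\<close> around a point of \<open>Q\<close>. Pairs farther apart
  than \<open>e\<close> are covered by the boundedness of \<open>f\<close>.\<close>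

lemma C1_lipschitz_on_compact:
  fixes f :: "'a::euclidean_space \<Rightarrow> 'b::real_normed_vector"
  assumes U: "open U" and f: "Ck_on 1 U f" and Q: "compact Q" "Q \<subseteq> U"
  obtains L where "L > 0" "L-lipschitz_on Q f"
proof -
  have f': "Ck_on (Suc 0) U f" using f by simp
  obtain e where e: "e > 0" "(\<Union>x\<in>Q. cball x e) \<subseteq> U"
    using compact_subset_open_imp_cball_epsilon_subset[OF Q(1) U Q(2)] by blast
  define P where "P = (\<Union>x\<in>Q. cball x e)"
  have cP: "compact P" unfolding P_def using Q(1) e(1) by (intro compact_minkowski_sum_cball)
  have PU: "P \<subseteq> U" using e(2) unfolding P_def .
  obtain N where N: "\<And>x h. x \<in> P \<Longrightarrow> norm (frechet_derivative f (at x) h) \<le> N * norm h"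
    using C1_derivative_bounded_on_compact[OF U f' cP PU] by metis
  have "continuous_on Q f"
    by (rule continuous_on_subset[OF differentiable_imp_continuous_on Q(2)]) (use f' in simp)
  from continuous_on_compact_bound[OF Q(1) this]
  obtain R where R: "\<And>x. x \<in> Q \<Longrightarrow> norm (f x) \<le> R" by metis
  \<comment> \<open>\<open>N\<close> is the slope for near pairs,
    \<open>2 * \<bar>R\<bar> / e\<close> that for far ones, and 1 makes \<open>L\<close>
    positive.\<close>
  define L where "L = \<bar>N\<bar> + 2 * \<bar>R\<bar> / e + 1"
  have Lpos: "L > 0" using e by (simp add: L_def add_nonneg_pos)
  have "dist (f x) (f y) \<le> L * dist x y" if xy: "x \<in> Q" "y \<in> Q" for x y
  proof (cases "dist x y \<le> e")
    case True
    have sub: "cball x e \<subseteq> P" using xy by (auto simp: P_def)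
    have "norm (f y - f x) \<le> N * norm (y - x)"
    proof (rule differentiable_bound[of "cball x e"])
      show "(f has_derivative frechet_derivative f (at z)) (at z within cball x e)" if "z \<in> cball x e" for z
        using Ck_on_has_derivative[OF U f'] that sub PU by (blast intro: has_derivative_at_withinI)
      show "onorm (frechet_derivative f (at z)) \<le> N" if "z \<in> cball x e" for z
        using N that sub by (intro onorm_le) blast
    qed (use True e in auto)
    also have "\<dots> \<le> L * norm (y - x)"
    proof (rule mult_right_mono)
      have "0 \<le> 2 * \<bar>R\<bar> / e" using e by simp
      then show "N \<le> L" unfolding L_def by linarith
    qed simp
    finally show ?thesis by (simp add: dist_norm norm_minus_commute)
  next
    case False
    have "dist (f x) (f y) \<le> 2 * \<bar>R\<bar>"
      using R[OF xy(1)] R[OF xy(2)] norm_triangle_ineq4[of "f x" "f y"] by (simp add: dist_norm)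
    also have "\<dots> = 2 * \<bar>R\<bar> / e * e" using e by simp
    also have "\<dots> \<le> 2 * \<bar>R\<bar> / e * dist x y" using False e by (intro mult_left_mono) auto
    also have "\<dots> \<le> L * dist x y" by (intro mult_right_mono) (auto simp: L_def)
    finally show ?thesis .
  qed
  then show ?thesis using Lpos by (intro that[of L] lipschitz_onI) auto
qed

section \<open>Mollification\<close>

lemma lborel_distr_reflect:
  fixes t :: "'a::euclidean_space"
  shows "distr lborel borel (\<lambda>x. t - x) = lborel"
  using lborel_affine[of "-1" t] by (simp add: density_1)

lemma nn_integral_lborel_translate:
  fixes t :: "'a::euclidean_space"
  assumes "f \<in> borel_measurable borel"
  shows "(\<integral>\<^sup>+x. f (x - t) \<partial>lborel) = (\<integral>\<^sup>+x. f x \<partial>lborel)"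
  using assms nn_integral_distr[of "(+) (- t)" lborel borel f] lborel_distr_plus[of "- t"] by simp

lemma nn_integral_lborel_reflect:
  fixes t :: "'a::euclidean_space"
  assumes "f \<in> borel_measurable borel"
  shows "(\<integral>\<^sup>+x. f (t - x) \<partial>lborel) = (\<integral>\<^sup>+x. f x \<partial>lborel)"
  using assms nn_integral_distr[of "\<lambda>x. t - x" lborel borel f] lborel_distr_reflect[of t] by simp

lemma integral_lborel_reflect:
  fixes t :: "'a::euclidean_space" and f :: "'a \<Rightarrow> real"
  assumes "f \<in> borel_measurable borel"
  shows "(\<integral>x. f (t - x) \<partial>lborel) = (\<integral>x. f x \<partial>lborel)"
  using assms integral_distr[of "\<lambda>x. t - x" lborel borel f] lborel_distr_reflect[of t] by simp

text \<open>Smoothness is required both of \<open>\<rho>\<close>, which is differentiated in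
  convolutions, and of its reflected translates, which serve as test functions.\<close>

definition mollifier :: "real \<Rightarrow> ('a::euclidean_space \<Rightarrow> real) \<Rightarrow> bool" where
  "mollifier e \<rho> \<longleftrightarrow> smooth_fun_on UNIV \<rho> \<and> (\<forall>x. smooth_fun_on UNIV (\<lambda>z. \<rho> (x - z))) \<and>
     (\<forall>x. 0 \<le> \<rho> x) \<and> (\<forall>x. e \<le> norm x \<longrightarrow> \<rho> x = 0) \<and> integral\<^sup>L lborel \<rho> = 1"

lemma mollifier_exists:
  assumes e: "e > 0"
  obtains \<rho> :: "'a::euclidean_space \<Rightarrow> real" where "mollifier e \<rho>"
proof -
  define b where "b x = flat_exp 0 (e\<^sup>2 - x \<bullet> x)" for x :: 'a
  have b0: "b x = 0" if "e \<le> norm x" for x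
  proof -
    have "e\<^sup>2 \<le> (norm x)\<^sup>2" using that e by (intro power_mono) auto
    then show ?thesis by (simp add: b_def flat_exp_def power2_norm_eq_inner)
  qed
  have b_nonneg: "b x \<ge> 0" for x by (simp add: b_def flat_exp_nonneg)
  have bx: "smooth_fun_on UNIV (\<lambda>z. b (x - z))" for x
    unfolding smooth_fun_on_def b_def using Ck_on_flat_exp by blast
  have bs: "smooth_fun_on UNIV b"
    using bx[of 0] by (simp add: b_def[abs_def])
  have cont: "continuous_on UNIV b"
    using bs unfolding smooth_fun_on_def by (metis Ck_on.simps(1))
  then have [measurable]: "b \<in> borel_measurable borel" by (rule borel_measurable_continuous_onI)
  have int: "integrable lborel b"
  proof -
    have "integrable lborel (\<lambda>x. indicator (cball 0 e) x *\<^sub>R b x)"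
      by (rule borel_integrable_compact) (auto intro: continuous_on_subset[OF cont])
    also have "(\<lambda>x. indicator (cball 0 e) x *\<^sub>R b x) = b"
      using b0 by (auto simp: fun_eq_iff indicator_def)
    finally show ?thesis .
  qed
  define c where "c = integral\<^sup>L lborel b"
  \<comment> \<open>\<open>m\<close> is the value of the bump at distance \<open>e / 2\<close> from
    the origin. On the half ball \<open>b\<close> is at least \<open>m\<close>, so its integral is
    positive and can be normalised.\<close>
  define m where "m = exp (- inverse (3 / 4 * e\<^sup>2))"
  have "0 < m * measure lborel (ball (0::'a) (e / 2))"
    using e content_ball_pos[of "e / 2" "0::'a"] by (simp add: m_def)
  also have "\<dots> = (\<integral>x. m * indicator (ball (0::'a) (e / 2)) x \<partial>lborel)" by simp
  also have "\<dots> \<le> c" unfolding c_def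
  proof (rule integral_mono)
    show "integrable lborel (\<lambda>x. m * indicator (ball (0::'a) (e / 2)) x)"
      using emeasure_lborel_ball_finite[of "0::'a" "e / 2"] by (intro integrable_mult_right integrable_real_indicator) auto
    show "m * indicator (ball 0 (e / 2)) x \<le> b x" for x :: 'a
    proof (cases "x \<in> ball 0 (e / 2)")
      case True
      then have "(norm x)\<^sup>2 \<le> (e / 2)\<^sup>2" by (intro power_mono) auto
      then have 1: "3 / 4 * e\<^sup>2 \<le> e\<^sup>2 - x \<bullet> x" by (simp add: power2_norm_eq_inner power_divide)
      moreover have 2: "0 < 3 / 4 * e\<^sup>2" using e by simp
      ultimately have 3: "m \<le> exp (- inverse (e\<^sup>2 - x \<bullet> x))"
        unfolding m_def using le_imp_inverse_le[OF 1 2] by simp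
      have "0 < e\<^sup>2 - x \<bullet> x" using 1 2 by linarith
      then show ?thesis using True 3 by (simp add: b_def flat_exp_def)
    qed (simp add: b_def flat_exp_nonneg)
  qed (use int in auto)
  finally have c: "c > 0" .
  have "smooth_fun_on UNIV (\<lambda>z. b z / c)" "smooth_fun_on UNIV (\<lambda>z. b (x - z) / c)" for x
    using bx[of x] bs Ck_on_mult[OF open_UNIV _ Ck_on_const[of _ _ "inverse c"]]
    unfolding smooth_fun_on_def by (auto simp: divide_inverse)
  then have "mollifier e (\<lambda>x. b x / c)"
    using b0 c b_nonneg by (auto simp: mollifier_def c_def[symmetric])
  then show ?thesis using that by blast
qed

context
  fixes e :: real and \<rho> :: "'a::euclidean_space \<Rightarrow> real"
  assumes m: "mollifier e \<rho>"
begin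

lemma mollifier_Ck: "Ck_on k UNIV \<rho>"
  using m by (simp add: mollifier_def smooth_fun_on_def)

lemma mollifier_nonneg: "0 \<le> \<rho> x"
  using m by (simp add: mollifier_def)

lemma mollifier_eq_0: "e \<le> norm x \<Longrightarrow> \<rho> x = 0"
  using m by (simp add: mollifier_def)

lemma mollifier_has_derivative: "(\<rho> has_derivative frechet_derivative \<rho> (at x)) (at x)"
  using Ck_on_has_derivative[OF open_UNIV mollifier_Ck] by simp

lemma mollifier_continuous: "continuous_on UNIV \<rho>"
  using mollifier_Ck[of 0] by simp

lemma mollifier_measurable [measurable]: "\<rho> \<in> borel_measurable borel"
  by (rule borel_measurable_continuous_onI[OF mollifier_continuous])

lemma mollifier_derivative_measurable: "(\<lambda>x. frechet_derivative \<rho> (at x) h) \<in> borel_measurable borel"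
  by (rule borel_measurable_continuous_onI) (use mollifier_Ck[of "Suc 0"] in simp)

lemma mollifier_integral: "integral\<^sup>L lborel \<rho> = 1"
  using m by (simp add: mollifier_def)

lemma mollifier_integrable: "integrable lborel \<rho>"
  using mollifier_integral not_integrable_integral_eq by fastforce

lemma mollifier_nn_integral: "(\<integral>\<^sup>+x. ennreal (\<rho> x) \<partial>lborel) = 1"
  using nn_integral_eq_integral[OF mollifier_integrable] mollifier_nonneg mollifier_integral by simp

text \<open>The derivative is bounded on the ball of radius \<open>e\<close> by compactness and
  vanishes outside, where \<open>\<rho>\<close> is zero on an open set. One constant serves the
  derivative and the increments, as domination requires.\<close>

lemma mollifier_derivative_bounded:
  obtains M where "M \<ge> 0" "\<And>x h. \<bar>frechet_derivative \<rho> (at x) h\<bar> \<le> M * norm h"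
    "M-lipschitz_on UNIV \<rho>"
proof -
  obtain M where M: "M \<ge> 0" "\<And>x h. x \<in> cball 0 e \<Longrightarrow> norm (frechet_derivative \<rho> (at x) h) \<le> M * norm h"
    using C1_derivative_bounded_on_compact[OF open_UNIV mollifier_Ck[of "Suc 0"] compact_cball[of 0 e]]
    by auto
  have bd: "\<bar>frechet_derivative \<rho> (at x) h\<bar> \<le> M * norm h" for x h
  proof (cases "x \<in> cball 0 e")
    case False
    have "(\<rho> has_derivative (\<lambda>h. 0)) (at x)"
      by (rule has_derivative_transform_within_open[of "\<lambda>x. 0" _ _ _ "- cball 0 e"])
         (use False mollifier_eq_0 in auto)
    then have "frechet_derivative \<rho> (at x) = (\<lambda>h. 0)"
      using frechet_derivative_at by metis
    then show ?thesis using M(1) by simp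
  qed (use M in auto)
  have "M-lipschitz_on UNIV \<rho>"
  proof (rule bounded_derivative_imp_lipschitz[where f' = "\<lambda>x. frechet_derivative \<rho> (at x)"])
    show "onorm (frechet_derivative \<rho> (at x)) \<le> M" for x
      using bd by (intro onorm_le) auto
  qed (use mollifier_has_derivative M(1) in auto)
  then show ?thesis using that M(1) bd by blast
qed

lemma mollifier_test_function:
  assumes "cball x e \<subseteq> S"
  shows "(\<lambda>z. \<rho> (x - z)) \<in> test_functions S"
proof -
  have sub: "{z. \<rho> (x - z) \<noteq> 0} \<subseteq> cball x e"
  proof
    fix z assume "z \<in> {z. \<rho> (x - z) \<noteq> 0}"
    then have "\<not> e \<le> norm (x - z)" using mollifier_eq_0[of "x - z"] by auto
    then show "z \<in> cball x e" by (simp add: dist_norm)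
  qed
  then have "closure {z. \<rho> (x - z) \<noteq> 0} \<subseteq> cball x e"
    by (simp add: closure_minimal)
  moreover have "bounded {z. \<rho> (x - z) \<noteq> 0}" by (rule bounded_subset[OF bounded_cball sub])
  ultimately show ?thesis
    using m assms by (auto simp: test_functions_def mollifier_def)
qed

end

text \<open>Dominated convergence of the difference quotients along sequences. The derivative is
  taken within a set because the parameter will be a point of space for convolutions and a time in a
  closed interval for trajectories.\<close>

lemma has_derivative_integral_dominated:
  fixes F :: "'p::real_normed_vector \<Rightarrow> 'z \<Rightarrow> real"
  assumes p: "p \<in> A" and int: "\<And>q. q \<in> A \<Longrightarrow> integrable M (F q)"
    and der: "\<And>z. z \<in> space M \<Longrightarrow> ((\<lambda>q. F q z) has_derivative F' z) (at p within A)"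
    and meas[measurable]: "\<And>h. (\<lambda>z. F' z h) \<in> borel_measurable M"
    and bd: "\<And>q z. q \<in> A \<Longrightarrow> z \<in> space M \<Longrightarrow> \<bar>F q z - F p z\<bar> \<le> G z * norm (q - p)"
    and bd': "\<And>h z. z \<in> space M \<Longrightarrow> \<bar>F' z h\<bar> \<le> G z * norm h"
    and G: "integrable M G"
  shows "((\<lambda>q. \<integral>z. F q z \<partial>M) has_derivative (\<lambda>h. \<integral>z. F' z h \<partial>M)) (at p within A)"
proof -
  have lin: "linear (F' z)" if "z \<in> space M" for z
    using der[OF that] has_derivative_linear by blast
  have intF': "integrable M (\<lambda>z. F' z h)" for h
    by (rule Bochner_Integration.integrable_bound[OF integrable_mult_left[OF G, of "norm h"] meas])
       (use order_trans[OF bd' abs_ge_self] in \<open>auto intro!: AE_I2\<close>)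
  have bl: "bounded_linear (\<lambda>h. \<integral>z. F' z h \<partial>M)"
  proof (rule bounded_linear_intro[where K = "integral\<^sup>L M G"])
    fix x y :: 'p and r :: real
    show "(\<integral>z. F' z (x + y) \<partial>M) = (\<integral>z. F' z x \<partial>M) + (\<integral>z. F' z y \<partial>M)"
      by (subst Bochner_Integration.integral_add[OF intF' intF', symmetric])
         (auto intro!: Bochner_Integration.integral_cong simp: linear_add[OF lin])
    have "(\<integral>z. F' z (r *\<^sub>R x) \<partial>M) = (\<integral>z. r * F' z x \<partial>M)"
      by (intro Bochner_Integration.integral_cong) (auto simp: linear_cmul[OF lin])
    then show "(\<integral>z. F' z (r *\<^sub>R x) \<partial>M) = r *\<^sub>R (\<integral>z. F' z x \<partial>M)"
      by simp
    have "norm (\<integral>z. F' z x \<partial>M) \<le> (\<integral>z. G z * norm x \<partial>M)"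
    proof (rule order_trans[OF integral_norm_bound])
      show "(\<integral>z. norm (F' z x) \<partial>M) \<le> (\<integral>z. G z * norm x \<partial>M)"
        by (rule integral_mono) (use intF' G bd' in auto)
    qed
    then show "norm (\<integral>z. F' z x \<partial>M) \<le> norm x * integral\<^sup>L M G"
      by (simp add: mult.commute)
  qed
  have "((\<lambda>q. (1 / norm (q - p)) *\<^sub>R ((\<integral>z. F q z \<partial>M) - ((\<integral>z. F p z \<partial>M) + (\<integral>z. F' z (q - p) \<partial>M)))) \<longlongrightarrow> 0) (at p within A)"
    unfolding tendsto_at_iff_sequentially
  proof (intro allI impI)
    fix X :: "nat \<Rightarrow> 'p" assume X: "\<forall>i. X i \<in> A - {p}" "X \<longlonglongrightarrow> p"
    define R where "R i z = (1 / norm (X i - p)) *\<^sub>R (F (X i) z - (F p z + F' z (X i - p)))" for i z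
    have "(\<lambda>i. \<integral>z. R i z \<partial>M) \<longlonglongrightarrow> (\<integral>z. 0 \<partial>M)"
    \<comment> \<open>One \<open>G\<close> bounds the increment and one the linear part.\<close>
    proof (rule integral_dominated_convergence[where w = "\<lambda>z. 2 * G z"])
      show "AE z in M. (\<lambda>i. R i z) \<longlonglongrightarrow> 0"
      proof (rule AE_I2)
        fix z assume z: "z \<in> space M"
        have "((\<lambda>q. (1 / norm (q - p)) *\<^sub>R (F q z - (F p z + F' z (q - p)))) \<longlongrightarrow> 0) (at p within A)"
          using der[OF z] by (simp add: has_derivative_within)
        then show "(\<lambda>i. R i z) \<longlonglongrightarrow> 0"
          using X unfolding tendsto_at_iff_sequentially R_def by (auto simp: o_def)
      qed
      show "AE z in M. norm (R i z) \<le> 2 * G z" for i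
      proof (rule AE_I2)
        fix z assume z: "z \<in> space M"
        have ne: "norm (X i - p) > 0" using X by auto
        have "\<bar>F (X i) z - (F p z + F' z (X i - p))\<bar> \<le> 2 * G z * norm (X i - p)"
          using bd[of "X i" z] bd'[of z "X i - p"] X z by fastforce
        then show "norm (R i z) \<le> 2 * G z"
          using ne by (simp add: R_def abs_mult field_simps)
      qed
      show "R i \<in> borel_measurable M" for i
        unfolding R_def using int[of "X i"] int[OF p] X by (intro borel_measurable_scaleR) auto
    qed (use G in auto)
    moreover have "(\<integral>z. R i z \<partial>M) = (1 / norm (X i - p)) *\<^sub>R
        ((\<integral>z. F (X i) z \<partial>M) - ((\<integral>z. F p z \<partial>M) + (\<integral>z. F' z (X i - p) \<partial>M)))" for i
      unfolding R_def using int[of "X i"] int[OF p] X intF' by simp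
    ultimately show "((\<lambda>q. (1 / norm (q - p)) *\<^sub>R ((\<integral>z. F q z \<partial>M) - ((\<integral>z. F p z \<partial>M) + (\<integral>z. F' z (q - p) \<partial>M)))) \<circ> X) \<longlonglongrightarrow> 0"
      by (simp add: o_def)
  qed
  then show ?thesis using bl by (simp add: has_derivative_within)
qed

text \<open>Integration is over \<open>lborel\<close>, where Fubini's theorem for products applies;
  Sobolev functions enter through Borel representatives.\<close>

definition convol :: "('a::euclidean_space \<Rightarrow> real) \<Rightarrow> ('a \<Rightarrow> real) \<Rightarrow> 'a \<Rightarrow> real" where
  "convol f \<rho> x = (\<integral>z. f z * \<rho> (x - z) \<partial>lborel)"

context
  fixes e :: real and \<rho> f :: "'a::euclidean_space \<Rightarrow> real"
  assumes m: "mollifier e \<rho>" and f: "integrable lborel f"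
begin

lemma mollifier_bounded: obtains M where "\<And>x. \<bar>\<rho> x\<bar> \<le> M"
proof -
  obtain M where M: "\<And>x. x \<in> cball 0 e \<Longrightarrow> norm (\<rho> x) \<le> M"
    using continuous_on_compact_bound[OF compact_cball continuous_on_subset[OF mollifier_continuous[OF m]]]
    by (metis subset_UNIV)
  have "\<bar>\<rho> x\<bar> \<le> \<bar>M\<bar>" for x
    using M[of x] mollifier_eq_0[OF m, of x] by (cases "x \<in> cball 0 e") auto
  then show ?thesis using that by blast
qed

lemma convol_integrable: "integrable lborel (\<lambda>z. f z * \<rho> (x - z))"
proof -
  note mollifier_measurable[OF m, measurable]
  have [measurable]: "f \<in> borel_measurable borel" using f by auto
  obtain M where M: "\<And>x. \<bar>\<rho> x\<bar> \<le> M" using mollifier_bounded by blast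
  show ?thesis
    by (rule Bochner_Integration.integrable_bound[OF integrable_mult_left[OF f, of M]])
       (use M order_trans[OF abs_ge_zero M] in \<open>auto simp: abs_mult intro!: mult_left_mono\<close>)
qed

lemma convol_has_derivative:
  "(convol f \<rho> has_derivative (\<lambda>h. \<integral>z. f z * frechet_derivative \<rho> (at (x - z)) h \<partial>lborel)) (at x)"
proof -
  note mollifier_measurable[OF m, measurable] mollifier_derivative_measurable[OF m, measurable]
  have fm[measurable]: "f \<in> borel_measurable borel" using f by auto
  obtain M where M: "M \<ge> 0" "\<And>x h. \<bar>frechet_derivative \<rho> (at x) h\<bar> \<le> M * norm h" "M-lipschitz_on UNIV \<rho>"
    by (rule mollifier_derivative_bounded[OF m]) blast
  show ?thesis
    unfolding convol_def
  proof (rule has_derivative_integral_dominated[where G = "\<lambda>z. \<bar>f z\<bar> * M"])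
    show "((\<lambda>q. f z * \<rho> (q - z)) has_derivative (\<lambda>h. f z * frechet_derivative \<rho> (at (x - z)) h)) (at x)" for z
    proof -
      have "((\<lambda>q. \<rho> (q - z)) has_derivative (\<lambda>h. frechet_derivative \<rho> (at (x - z)) h)) (at x)"
        by (rule has_derivative_compose[of "\<lambda>q. q - z" "\<lambda>h. h", OF _ mollifier_has_derivative[OF m], unfolded o_def])
           (auto intro!: derivative_eq_intros)
      then show ?thesis by (rule has_derivative_mult_right)
    qed
    show "\<bar>f z * \<rho> (q - z) - f z * \<rho> (x - z)\<bar> \<le> \<bar>f z\<bar> * M * norm (q - x)" for q z
    proof -
      have "\<bar>\<rho> (q - z) - \<rho> (x - z)\<bar> \<le> M * norm (q - x)"
        using lipschitz_on_normD[OF M(3), of "q - z" "x - z"] by simp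
      then show ?thesis
        by (simp add: abs_mult mult.assoc mult_left_mono flip: right_diff_distrib)
    qed
    show "\<bar>f z * frechet_derivative \<rho> (at (x - z)) h\<bar> \<le> \<bar>f z\<bar> * M * norm h" for h z
      using M(2)[of "x - z" h] by (simp add: abs_mult mult.assoc mult_left_mono)
    show "(\<lambda>z. f z * frechet_derivative \<rho> (at (x - z)) h) \<in> borel_measurable lborel" for h
      using measurable_compose[OF _ mollifier_derivative_measurable[OF m], of "\<lambda>z. x - z" lborel h]
      by simp
  qed (use f convol_integrable in auto)
qed

lemma convol_continuous: "continuous_on UNIV (convol f \<rho>)"
  using convol_has_derivative has_derivative_continuous continuous_at_imp_continuous_on by blast

lemma convol_measurable: "convol f \<rho> \<in> borel_measurable borel"
  by (rule borel_measurable_continuous_onI[OF convol_continuous])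

text \<open>Young's inequality for a kernel of mass one: with the kernel written as the product of
  its square roots, Cauchy-Schwarz bounds the square of the convolution by the convolution of the
  square, and Fubini integrates the kernel out.\<close>

lemma nn_integral_convol_square_le:
  "(\<integral>\<^sup>+x. ennreal ((convol f \<rho> x)\<^sup>2) \<partial>lborel) \<le> (\<integral>\<^sup>+x. ennreal ((f x)\<^sup>2) \<partial>lborel)"
proof -
  note mollifier_measurable[OF m, measurable]
  have fm[measurable]: "f \<in> borel_measurable borel" using f by auto
  have pt: "ennreal ((convol f \<rho> x)\<^sup>2) \<le> (\<integral>\<^sup>+z. ennreal ((f z)\<^sup>2 * \<rho> (x - z)) \<partial>lborel)" for x
  proof -
    have "ennreal \<bar>convol f \<rho> x\<bar> \<le> (\<integral>\<^sup>+z. ennreal (norm (f z * \<rho> (x - z))) \<partial>lborel)"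
      unfolding convol_def using integral_norm_bound_ennreal[OF convol_integrable] by simp
    also have "\<dots> = (\<integral>\<^sup>+z. ennreal (\<bar>f z\<bar> * sqrt (\<rho> (x - z))) * ennreal (sqrt (\<rho> (x - z))) \<partial>lborel)"
      using mollifier_nonneg[OF m] by (intro nn_integral_cong) (simp add: abs_mult mult.assoc flip: ennreal_mult')
    finally have "(ennreal \<bar>convol f \<rho> x\<bar>)\<^sup>2 \<le> \<dots>\<^sup>2"
      by (intro power_mono) auto
    also have "\<dots> \<le> (\<integral>\<^sup>+z. (ennreal (\<bar>f z\<bar> * sqrt (\<rho> (x - z))))\<^sup>2 \<partial>lborel) * (\<integral>\<^sup>+z. (ennreal (sqrt (\<rho> (x - z))))\<^sup>2 \<partial>lborel)"
      by (rule Cauchy_Schwarz_nn_integral) auto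
    also have "(\<integral>\<^sup>+z. (ennreal (sqrt (\<rho> (x - z))))\<^sup>2 \<partial>lborel) = (\<integral>\<^sup>+z. ennreal (\<rho> (x - z)) \<partial>lborel)"
      using mollifier_nonneg[OF m] by (intro nn_integral_cong) (simp add: ennreal_power)
    also have "\<dots> = 1"
      using nn_integral_lborel_reflect[of "\<lambda>z. ennreal (\<rho> z)" x] mollifier_nn_integral[OF m] by simp
    also have "(\<integral>\<^sup>+z. (ennreal (\<bar>f z\<bar> * sqrt (\<rho> (x - z))))\<^sup>2 \<partial>lborel) = (\<integral>\<^sup>+z. ennreal ((f z)\<^sup>2 * \<rho> (x - z)) \<partial>lborel)"
      using mollifier_nonneg[OF m] by (intro nn_integral_cong) (simp add: ennreal_power power_mult_distrib)
    finally show ?thesis by (simp add: ennreal_power)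
  qed
  have "(\<integral>\<^sup>+x. ennreal ((convol f \<rho> x)\<^sup>2) \<partial>lborel) \<le> (\<integral>\<^sup>+x. (\<integral>\<^sup>+z. ennreal ((f z)\<^sup>2 * \<rho> (x - z)) \<partial>lborel) \<partial>lborel)"
    by (intro nn_integral_mono pt)
  also have "\<dots> = (\<integral>\<^sup>+z. (\<integral>\<^sup>+x. ennreal ((f z)\<^sup>2 * \<rho> (x - z)) \<partial>lborel) \<partial>lborel)"
    by (rule lborel_pair.Fubini') measurable
  also have "\<dots> = (\<integral>\<^sup>+z. ennreal ((f z)\<^sup>2) \<partial>lborel)"
  proof (rule nn_integral_cong)
    fix z
    have "(\<integral>\<^sup>+x. ennreal ((f z)\<^sup>2 * \<rho> (x - z)) \<partial>lborel) = ennreal ((f z)\<^sup>2) * (\<integral>\<^sup>+x. ennreal (\<rho> (x - z)) \<partial>lborel)"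
      by (subst nn_integral_cmult[symmetric]) (auto simp: ennreal_mult')
    then show "(\<integral>\<^sup>+x. ennreal ((f z)\<^sup>2 * \<rho> (x - z)) \<partial>lborel) = ennreal ((f z)\<^sup>2)"
      using nn_integral_lborel_translate[of "\<lambda>z. ennreal (\<rho> z)" z] mollifier_nn_integral[OF m] by simp
  qed
  finally show ?thesis .
qed

end

text \<open>A closed subset exhausts \<open>A\<close> up to small measure, and intersecting it with
  a large ball makes it compact. Finite measure of \<open>A\<close> is what makes the part outside
  large balls small.\<close>

lemma emeasure_inner_compact:
  fixes A :: "'a::euclidean_space set"
  assumes A: "A \<in> sets borel" "emeasure lborel A < \<infinity>" and d: "d > 0"
  obtains K where "compact K" "K \<subseteq> A" "emeasure lborel (A - K) < ennreal d"
proof -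
  obtain C where C: "closed C" "C \<subseteq> A" "emeasure lebesgue (A - C) < ennreal (d / 4)"
  proof (rule sets_lebesgue_inner_closed)
    show "A \<in> sets lebesgue" using A(1) by simp
    show "d / 4 > 0" using d by simp
  qed
  have "A - C \<in> sets lborel" using A(1) C(1) by auto
  then have C3: "emeasure lborel (A - C) < ennreal (d / 4)"
    using C(3) by simp
  have "(\<lambda>n. emeasure lborel (A - cball 0 (real n))) \<longlonglongrightarrow> emeasure lborel (\<Inter>n. A - cball 0 (real n))"
  proof (rule Lim_emeasure_decseq)
    show "emeasure lborel (A - cball 0 (real n)) \<noteq> \<infinity>" for n
      using A emeasure_mono[of "A - cball 0 (real n)" A lborel] by (auto simp: top_unique)
  qed (use A in \<open>auto simp: decseq_def\<close>)
  also have "(\<Inter>n. A - cball 0 (real n)) = {}"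
    using real_arch_simple by (auto simp: not_le)
  finally have "(\<lambda>n. emeasure lborel (A - cball 0 (real n))) \<longlonglongrightarrow> 0" by simp
  then have "\<forall>\<^sub>F n in sequentially. emeasure lborel (A - cball 0 (real n)) < ennreal (d / 4)"
    by (rule order_tendstoD) (use d in auto)
  then obtain n where n: "emeasure lborel (A - cball 0 (real n)) < ennreal (d / 4)"
    by (auto simp: eventually_sequentially)
  have "emeasure lborel (A - C \<inter> cball 0 (real n)) \<le> emeasure lborel ((A - C) \<union> (A - cball 0 (real n)))"
    by (rule emeasure_mono) (use A C in auto)
  also have "\<dots> \<le> emeasure lborel (A - C) + emeasure lborel (A - cball 0 (real n))"
    by (rule emeasure_subadditive) (use A C in auto)
  also have "\<dots> \<le> ennreal (d / 4) + ennreal (d / 4)"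
    using C3 n by (intro add_mono) auto
  also have "\<dots> < ennreal d" using d by (simp add: ennreal_lessI flip: ennreal_plus)
  finally show ?thesis
    using C by (intro that[of "C \<inter> cball 0 (real n)"]) (auto intro: closed_Int_compact)
qed

abbreviation L1_dist :: "('a::euclidean_space \<Rightarrow> real) \<Rightarrow> ('a \<Rightarrow> real) \<Rightarrow> ennreal" where
  "L1_dist f g \<equiv> \<integral>\<^sup>+x. ennreal \<bar>f x - g x\<bar> \<partial>lborel"

text \<open>Induction over integrable functions: indicators, sums and dominated limits. An indicator
  is enclosed between a compact \<open>K\<close> and an open \<open>U\<close>; a shift so short that
  it keeps \<open>K\<close> inside \<open>U\<close> changes the indicator only where the point or
  its translate lies in \<open>U - K\<close>.\<close>

lemma L1_continuous_translation:
  fixes f :: "'a::euclidean_space \<Rightarrow> real"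
  assumes "integrable lborel f"
  shows "\<forall>d>0. \<exists>e>0. \<forall>z. norm z \<le> e \<longrightarrow> L1_dist (\<lambda>x. f (x - z)) f \<le> ennreal d"
  using assms
proof (induction rule: integrable_induct)
  case (base A c)
  show ?case
  proof (intro allI impI)
    fix d :: real assume d: "d > 0"
    \<comment> \<open>\<open>U - K\<close> will have measure at most \<open>2 * d'\<close> and is
      counted at the point and at its translate, hence the factor 4; adding 1 covers
      \<open>c = 0\<close>.\<close>
    define d' where "d' = d / (4 * (\<bar>c\<bar> + 1))"
    have d': "d' > 0" "4 * \<bar>c\<bar> * d' \<le> d" using d by (auto simp: d'_def field_simps)
    obtain K where K: "compact K" "K \<subseteq> A" "emeasure lborel (A - K) < ennreal d'"
      using emeasure_inner_compact[of A d'] base d' by auto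
    obtain U where U: "open U" "A \<subseteq> U" "emeasure lebesgue (U - A) < ennreal d'"
    proof (rule sets_lebesgue_outer_open)
      show "A \<in> sets lebesgue" using base by simp
    qed (use d' in auto)
    have [measurable]: "A \<in> sets borel" "U \<in> sets borel" "K \<in> sets borel"
      using base U K by (auto intro: borel_compact)
    have U3: "emeasure lborel (U - A) < ennreal d'"
    proof -
      have "U - A \<in> sets lborel" by simp
      then show ?thesis using U(3) by simp
    qed
    have "emeasure lborel (U - K) \<le> emeasure lborel ((U - A) \<union> (A - K))"
      by (rule emeasure_mono) auto
    also have "\<dots> \<le> emeasure lborel (U - A) + emeasure lborel (A - K)"
      by (rule emeasure_subadditive) auto
    also have "\<dots> \<le> ennreal d' + ennreal d'"
      using U3 K by (intro add_mono) auto
    finally have UK: "emeasure lborel (U - K) \<le> ennreal (2 * d')"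
      using d' by (simp flip: ennreal_plus)
    obtain e where e: "e > 0" "(\<Union>x\<in>K. cball x e) \<subseteq> U"
      using compact_subset_open_imp_cball_epsilon_subset[OF K(1) U(1)] K(2) U(2) by blast
    have "(\<integral>\<^sup>+x. ennreal \<bar>indicator A (x - z) *\<^sub>R c - indicator A x *\<^sub>R c\<bar> \<partial>lborel) \<le> ennreal d"
      if z: "norm z \<le> e" for z
    proof -
      have KU: "x + z \<in> U" "x - z \<in> U" if "x \<in> K" for x
      proof -
        have "x + z \<in> cball x e" "x - z \<in> cball x e" using z by (auto simp: dist_norm)
        then show "x + z \<in> U" "x - z \<in> U" using e(2) that by blast+
      qed
      have pt: "ennreal \<bar>indicator A (x - z) *\<^sub>R c - indicator A x *\<^sub>R c\<bar>
          \<le> ennreal \<bar>c\<bar> * (indicator (U - K) x + indicator (U - K) (x - z))" for x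
      proof -
        have "x \<in> U - K \<or> x - z \<in> U - K" if "(x \<in> A) \<noteq> (x - z \<in> A)"
          using that KU[of x] KU(1)[of "x - z"] K(2) U(2) by auto
        then show ?thesis
          by (auto simp: indicator_def distrib_left)
      qed
      have "(\<integral>\<^sup>+x. ennreal \<bar>indicator A (x - z) *\<^sub>R c - indicator A x *\<^sub>R c\<bar> \<partial>lborel)
        \<le> (\<integral>\<^sup>+x. ennreal \<bar>c\<bar> * (indicator (U - K) x + indicator (U - K) (x - z)) \<partial>lborel)"
        by (intro nn_integral_mono pt)
      also have "\<dots> = ennreal \<bar>c\<bar> * ((\<integral>\<^sup>+x. indicator (U - K) x \<partial>lborel) + (\<integral>\<^sup>+x. indicator (U - K) (x - z) \<partial>lborel))"
        by (simp add: nn_integral_cmult nn_integral_add)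
      also have "\<dots> = ennreal \<bar>c\<bar> * (2 * emeasure lborel (U - K))"
        by (simp add: nn_integral_lborel_translate mult_2)
      also have "\<dots> \<le> ennreal \<bar>c\<bar> * (2 * ennreal (2 * d'))"
        using UK by (intro mult_left_mono) auto
      also have "2 * ennreal (2 * d') = ennreal (2 * d' + 2 * d')"
        unfolding mult_2 using d' by (intro ennreal_plus[symmetric]) auto
      also have "ennreal \<bar>c\<bar> * \<dots> = ennreal (\<bar>c\<bar> * (2 * d' + 2 * d'))"
        by (rule ennreal_mult'[symmetric]) simp
      also have "\<bar>c\<bar> * (2 * d' + 2 * d') = 4 * \<bar>c\<bar> * d'" by simp
      also have "\<dots> \<le> ennreal d" using d' by (intro ennreal_leI)
      finally show ?thesis .
    qed
    then show "\<exists>e>0. \<forall>z. norm z \<le> e \<longrightarrow>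
        (\<integral>\<^sup>+x. ennreal \<bar>indicator A (x - z) *\<^sub>R c - indicator A x *\<^sub>R c\<bar> \<partial>lborel) \<le> ennreal d"
      using e(1) by blast
  qed
next
  case (add f g)
  have [measurable]: "f \<in> borel_measurable borel" "g \<in> borel_measurable borel" using add by auto
  show ?case
  proof (intro allI impI)
    fix d :: real assume d: "d > 0"
    then have d2: "d / 2 > 0" by simp
    obtain e1 e2 where e: "e1 > 0" "e2 > 0"
      "\<And>z. norm z \<le> e1 \<Longrightarrow> L1_dist (\<lambda>x. f (x - z)) f \<le> ennreal (d / 2)"
      "\<And>z. norm z \<le> e2 \<Longrightarrow> L1_dist (\<lambda>x. g (x - z)) g \<le> ennreal (d / 2)"
      using add.IH(1)[rule_format, OF d2] add.IH(2)[rule_format, OF d2] by auto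
    have "(\<integral>\<^sup>+x. ennreal \<bar>(f (x - z) + g (x - z)) - (f x + g x)\<bar> \<partial>lborel) \<le> ennreal d"
      if z: "norm z \<le> min e1 e2" for z
    proof -
      have "(\<integral>\<^sup>+x. ennreal \<bar>(f (x - z) + g (x - z)) - (f x + g x)\<bar> \<partial>lborel)
        \<le> (\<integral>\<^sup>+x. ennreal \<bar>f (x - z) - f x\<bar> + ennreal \<bar>g (x - z) - g x\<bar> \<partial>lborel)"
        by (intro nn_integral_mono) (auto simp flip: ennreal_plus)
      also have "\<dots> = L1_dist (\<lambda>x. f (x - z)) f + L1_dist (\<lambda>x. g (x - z)) g"
        by (rule nn_integral_add) auto
      also have "\<dots> \<le> ennreal (d / 2) + ennreal (d / 2)"
        using e z by (intro add_mono) auto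
      also have "\<dots> = ennreal d" using d by (simp flip: ennreal_plus)
      finally show ?thesis .
    qed
    then show "\<exists>e>0. \<forall>z. norm z \<le> e \<longrightarrow>
        (\<integral>\<^sup>+x. ennreal \<bar>(f (x - z) + g (x - z)) - (f x + g x)\<bar> \<partial>lborel) \<le> ennreal d"
      using e(1,2) by (intro exI[of _ "min e1 e2"]) auto
  qed
next
  case (lim f s)
  have [measurable]: "f \<in> borel_measurable borel" "\<And>i. s i \<in> borel_measurable borel" using lim by auto
  show ?case
  proof (intro allI impI)
    fix d :: real assume d: "d > 0"
    have "integrable lborel (\<lambda>x. 2 * \<bar>f x\<bar>)" using lim by auto
    then have fin: "(\<integral>\<^sup>+x. ennreal (2 * \<bar>f x\<bar>) \<partial>lborel) < \<infinity>"
      unfolding integrable_iff_bounded by (simp add: abs_mult)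
    have "(\<lambda>i. \<integral>\<^sup>+x. norm (f x - s i x) \<partial>lborel) \<longlonglongrightarrow> 0"
      by (rule nn_integral_dominated_convergence_norm[where w = "\<lambda>x. 2 * \<bar>f x\<bar>"])
         (use lim fin in \<open>auto intro!: AE_I2\<close>)
    then have "\<forall>\<^sub>F i in sequentially. (\<integral>\<^sup>+x. norm (f x - s i x) \<partial>lborel) < ennreal (d / 3)"
      by (rule order_tendstoD) (use d in auto)
    then obtain i where i: "(\<integral>\<^sup>+x. ennreal \<bar>s i x - f x\<bar> \<partial>lborel) < ennreal (d / 3)"
      by (auto simp: eventually_sequentially abs_minus_commute)
    have d3: "d / 3 > 0" using d by simp
    obtain e where e: "e > 0" "\<And>z. norm z \<le> e \<Longrightarrow> L1_dist (\<lambda>x. s i (x - z)) (s i) \<le> ennreal (d / 3)"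
      using lim.IH[rule_format, OF d3, of i] by auto
    have "L1_dist (\<lambda>x. f (x - z)) f \<le> ennreal d"
      if z: "norm z \<le> e" for z
    proof -
      have "L1_dist (\<lambda>x. f (x - z)) f
        \<le> (\<integral>\<^sup>+x. (ennreal \<bar>s i (x - z) - f (x - z)\<bar> + ennreal \<bar>s i (x - z) - s i x\<bar>) + ennreal \<bar>s i x - f x\<bar> \<partial>lborel)"
        by (intro nn_integral_mono) (auto simp flip: ennreal_plus)
      also have "\<dots> = (\<integral>\<^sup>+x. ennreal \<bar>s i (x - z) - f (x - z)\<bar> \<partial>lborel) + L1_dist (\<lambda>x. s i (x - z)) (s i)
          + (\<integral>\<^sup>+x. ennreal \<bar>s i x - f x\<bar> \<partial>lborel)"
        by (subst nn_integral_add, simp, simp, subst nn_integral_add) auto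
      also have "(\<integral>\<^sup>+x. ennreal \<bar>s i (x - z) - f (x - z)\<bar> \<partial>lborel) = (\<integral>\<^sup>+x. ennreal \<bar>s i x - f x\<bar> \<partial>lborel)"
        by (rule nn_integral_lborel_translate) auto
      also have "\<dots> + L1_dist (\<lambda>x. s i (x - z)) (s i) + (\<integral>\<^sup>+x. ennreal \<bar>s i x - f x\<bar> \<partial>lborel)
          \<le> ennreal (d / 3) + ennreal (d / 3) + ennreal (d / 3)"
        using e z i by (intro add_mono) auto
      also have "\<dots> = ennreal d" using d by (simp flip: ennreal_plus)
      finally show ?thesis .
    qed
    then show "\<exists>e>0. \<forall>z. norm z \<le> e \<longrightarrow> L1_dist (\<lambda>x. f (x - z)) f \<le> ennreal d"
      using e(1) by blast
  qed
qed

text \<open>The kernel has mass one, so the difference is an average of differences between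
  \<open>f\<close> and its translates. The threshold \<open>e0\<close> works for every mollifier of
  smaller radius, so it can be combined with further restrictions on the radius.\<close>

lemma convol_L1_close:
  fixes f :: "'a::euclidean_space \<Rightarrow> real"
  assumes f: "integrable lborel f" and d: "d > 0"
  obtains e0 where "e0 > 0"
    "\<And>e \<rho>. e \<le> e0 \<Longrightarrow> mollifier e \<rho> \<Longrightarrow> L1_dist (convol f \<rho>) f \<le> ennreal d"
proof -
  have [measurable]: "f \<in> borel_measurable borel" using f by auto
  obtain e0 where e0: "e0 > 0" "\<And>z. norm z \<le> e0 \<Longrightarrow> L1_dist (\<lambda>x. f (x - z)) f \<le> ennreal d"
    using L1_continuous_translation[OF f] d by blast
  have "L1_dist (convol f \<rho>) f \<le> ennreal d" if "e \<le> e0" and m: "mollifier e \<rho>" for e \<rho>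
  proof -
    note [measurable] = mollifier_measurable[OF m]
    have pt: "ennreal \<bar>convol f \<rho> x - f x\<bar> \<le> (\<integral>\<^sup>+z. ennreal (\<bar>f (x - z) - f x\<bar> * \<rho> z) \<partial>lborel)" for x
    proof -
      have eq: "convol f \<rho> x = (\<integral>z. f (x - z) * \<rho> z \<partial>lborel)"
        using integral_lborel_reflect[of "\<lambda>z. f z * \<rho> (x - z)" x] by (simp add: convol_def)
      have int1: "integrable lborel (\<lambda>z. f (x - z) * \<rho> z)"
        using convol_integrable[OF m f, of x]
          integrable_distr_eq[of "\<lambda>z. x - z" lborel borel "\<lambda>z. f z * \<rho> (x - z)"]
        by (simp add: lborel_distr_reflect)
      have int2: "integrable lborel (\<lambda>z. f x * \<rho> z)"
        using mollifier_integrable[OF m] by auto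
      have "convol f \<rho> x - f x = (\<integral>z. f (x - z) * \<rho> z \<partial>lborel) - (\<integral>z. f x * \<rho> z \<partial>lborel)"
        using mollifier_integral[OF m] by (simp add: eq)
      also have "\<dots> = (\<integral>z. (f (x - z) - f x) * \<rho> z \<partial>lborel)"
        using int1 int2 by (simp add: left_diff_distrib)
      finally have "ennreal \<bar>convol f \<rho> x - f x\<bar> \<le> (\<integral>\<^sup>+z. ennreal (norm ((f (x - z) - f x) * \<rho> z)) \<partial>lborel)"
        using integral_norm_bound_ennreal[of lborel "\<lambda>z. (f (x - z) - f x) * \<rho> z"] int1 int2
        by (simp add: left_diff_distrib)
      then show ?thesis using mollifier_nonneg[OF m] by (simp add: abs_mult)
    qed
    have "L1_dist (convol f \<rho>) f
      \<le> (\<integral>\<^sup>+x. (\<integral>\<^sup>+z. ennreal (\<bar>f (x - z) - f x\<bar> * \<rho> z) \<partial>lborel) \<partial>lborel)"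
      by (intro nn_integral_mono pt)
    also have "\<dots> = (\<integral>\<^sup>+z. (\<integral>\<^sup>+x. ennreal (\<bar>f (x - z) - f x\<bar> * \<rho> z) \<partial>lborel) \<partial>lborel)"
      by (rule lborel_pair.Fubini') measurable
    also have "\<dots> \<le> (\<integral>\<^sup>+z. ennreal d * ennreal (\<rho> z) \<partial>lborel)"
    proof (rule nn_integral_mono)
      fix z
      have eq: "(\<integral>\<^sup>+x. ennreal (\<bar>f (x - z) - f x\<bar> * \<rho> z) \<partial>lborel) = L1_dist (\<lambda>x. f (x - z)) f * ennreal (\<rho> z)"
        using mollifier_nonneg[OF m] by (subst nn_integral_multc[symmetric]) (auto simp: ennreal_mult)
      show "(\<integral>\<^sup>+x. ennreal (\<bar>f (x - z) - f x\<bar> * \<rho> z) \<partial>lborel) \<le> ennreal d * ennreal (\<rho> z)"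
      proof (cases "norm z \<le> e0")
        case True
        then show ?thesis unfolding eq using e0 by (intro mult_right_mono) auto
      next
        case False
        then have "\<rho> z = 0" using mollifier_eq_0[OF m, of z] \<open>e \<le> e0\<close> by simp
        then show ?thesis unfolding eq by simp
      qed
    qed
    also have "\<dots> = ennreal d"
      using mollifier_nn_integral[OF m] by (simp add: nn_integral_cmult)
    finally show ?thesis .
  qed
  then show ?thesis using e0(1) that by blast
qed

section \<open>Weak derivatives\<close>

text \<open>The integral of the square of \<open>s * u + t * v\<close> is a nonnegative quadratic
  form in \<open>s\<close> and \<open>t\<close>; suitable values give the discriminant
  inequality.\<close>

lemma Cauchy_Schwarz_integral:
  fixes u v :: "'z \<Rightarrow> real"
  assumes [measurable]: "u \<in> borel_measurable M" "v \<in> borel_measurable M"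
    and u: "integrable M (\<lambda>x. (u x)\<^sup>2)" and v: "integrable M (\<lambda>x. (v x)\<^sup>2)"
  shows "integrable M (\<lambda>x. u x * v x)"
    and "\<bar>\<integral>x. u x * v x \<partial>M\<bar> \<le> sqrt (\<integral>x. (u x)\<^sup>2 \<partial>M) * sqrt (\<integral>x. (v x)\<^sup>2 \<partial>M)"
proof -
  show uv: "integrable M (\<lambda>x. u x * v x)"
  proof (rule Bochner_Integration.integrable_bound)
    show "integrable M (\<lambda>x. (u x)\<^sup>2 + (v x)\<^sup>2)" using u v by simp
    have "\<bar>u x * v x\<bar> \<le> (u x)\<^sup>2 + (v x)\<^sup>2" for x
    proof -
      have "2 * (\<bar>u x\<bar> * \<bar>v x\<bar>) \<le> \<bar>u x\<bar>\<^sup>2 + \<bar>v x\<bar>\<^sup>2"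
        using sum_squares_bound[of "\<bar>u x\<bar>" "\<bar>v x\<bar>"] by simp
      moreover have "0 \<le> \<bar>u x\<bar> * \<bar>v x\<bar>" by simp
      ultimately show ?thesis unfolding abs_mult power2_abs by linarith
    qed
    then show "AE x in M. norm (u x * v x) \<le> norm ((u x)\<^sup>2 + (v x)\<^sup>2)" by simp
  qed simp
  define A where "A = (\<integral>x. (u x)\<^sup>2 \<partial>M)"
  define C where "C = (\<integral>x. (v x)\<^sup>2 \<partial>M)"
  define B where "B = (\<integral>x. u x * v x \<partial>M)"
  have AC: "A \<ge> 0" "C \<ge> 0" by (auto simp: A_def C_def)
  have quad: "0 \<le> s\<^sup>2 * A + 2 * s * t * B + t\<^sup>2 * C" for s t
  proof -
    have "0 \<le> (\<integral>x. (s * u x + t * v x)\<^sup>2 \<partial>M)" by simp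
    also have "\<dots> = (\<integral>x. s\<^sup>2 * (u x)\<^sup>2 + 2 * s * t * (u x * v x) + t\<^sup>2 * (v x)\<^sup>2 \<partial>M)"
      by (intro Bochner_Integration.integral_cong) (auto simp: power2_eq_square algebra_simps)
    also have "\<dots> = s\<^sup>2 * A + 2 * s * t * B + t\<^sup>2 * C"
      using u v uv by (simp add: A_def B_def C_def)
    finally show ?thesis .
  qed
  have "B\<^sup>2 \<le> A * C"
  proof (cases "C = 0")
    case True
    have "B = 0"
    proof (rule ccontr)
      assume "B \<noteq> 0"
      \<comment> \<open>With \<open>C = 0\<close> the form is affine in \<open>t\<close>, and this
        value makes it equal to -1.\<close>
      then show False using quad[of 1 "- (A + 1) / (2 * B)"] True by (simp add: field_simps)
    qed
    then show ?thesis using True by simp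
  next
    case False
    then have C: "C > 0" using AC by simp
    \<comment> \<open>At \<open>s = C\<close> and \<open>t = - B\<close> the quadratic form takes
      exactly this value.\<close>
    have "C * (A * C - B\<^sup>2) \<ge> 0"
      using quad[of C "- B"] by (simp add: power2_eq_square algebra_simps)
    then show ?thesis using C by (simp add: zero_le_mult_iff)
  qed
  then have "\<bar>B\<bar> \<le> sqrt (A * C)" by (metis real_sqrt_abs real_sqrt_le_mono)
  then show "\<bar>\<integral>x. u x * v x \<partial>M\<bar> \<le> sqrt (\<integral>x. (u x)\<^sup>2 \<partial>M) * sqrt (\<integral>x. (v x)\<^sup>2 \<partial>M)"
    by (simp add: A_def B_def C_def real_sqrt_mult)
qed

section \<open>Norms and Borel representatives of square integrable functions\<close>

lemma L2_norm_square: "(L2_norm S u)\<^sup>2 = (\<integral>x. (norm (u x))\<^sup>2 \<partial>lebesgue_on S)"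
  by (simp add: L2_norm_def)

lemma L2_norm_nonneg: "L2_norm S u \<ge> 0"
  by (simp add: L2_norm_def)

lemma L2_Cauchy_Schwarz:
  assumes "u \<in> L2_space S" "v \<in> L2_space S"
  shows "integrable (lebesgue_on S) (\<lambda>x. u x * v x)"
    and "\<bar>\<integral>x. u x * v x \<partial>lebesgue_on S\<bar> \<le> L2_norm S u * L2_norm S v"
  using Cauchy_Schwarz_integral[of u "lebesgue_on S" v] assms
  unfolding L2_space_def L2_norm_def mem_Collect_eq real_norm_def power2_abs by blast+

lemma L2_space_subset:
  assumes "u \<in> L2_space S" "S \<in> sets lebesgue" "R \<in> sets lebesgue" "R \<subseteq> S"
  shows "u \<in> L2_space R" and "L2_norm R u \<le> L2_norm S u"
proof -
  have m: "u \<in> borel_measurable (lebesgue_on R)"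
    by (rule measurable_restrict_mono[OF _ assms(4)]) (use assms(1) in \<open>simp add: L2_space_def\<close>)
  have 1: "integrable lebesgue (\<lambda>x. indicator S x *\<^sub>R (u x)\<^sup>2)"
    using assms by (simp add: L2_space_def integrable_restrict_space)
  have "integrable lebesgue (\<lambda>x. indicator R x *\<^sub>R (indicator S x *\<^sub>R (u x)\<^sup>2))"
    by (rule integrable_mult_indicator[OF assms(3) 1])
  also have "(\<lambda>x. indicator R x *\<^sub>R (indicator S x *\<^sub>R (u x)\<^sup>2)) = (\<lambda>x. indicator R x *\<^sub>R (u x)\<^sup>2)"
    using assms(4) by (auto simp: fun_eq_iff indicator_def)
  finally have 2: "integrable lebesgue (\<lambda>x. indicator R x *\<^sub>R (u x)\<^sup>2)" .
  then have "integrable (lebesgue_on R) (\<lambda>x. (u x)\<^sup>2)"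
    using assms by (simp add: integrable_restrict_space)
  then show "u \<in> L2_space R" using m by (simp add: L2_space_def)
  have "(\<integral>x. indicator R x *\<^sub>R (u x)\<^sup>2 \<partial>lebesgue) \<le> (\<integral>x. indicator S x *\<^sub>R (u x)\<^sup>2 \<partial>lebesgue)"
    by (rule integral_mono[OF 2 1]) (use assms(4) in \<open>auto simp: indicator_def\<close>)
  then show "L2_norm R u \<le> L2_norm S u"
    using assms by (simp add: L2_norm_def integral_restrict_space)
qed

text \<open>Bridge between \<open>lebesgue_on S\<close>, in which the norms are stated, and
  \<open>lborel\<close>, in which convolutions and image measures are computed.\<close>

lemma integral_lebesgue_on_eq_lborel:
  fixes h h' :: "'a::euclidean_space \<Rightarrow> real"
  assumes S: "S \<in> sets borel" and h: "h \<in> borel_measurable (lebesgue_on S)"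
    and h': "h' \<in> borel_measurable borel"
    and ae: "AE x in lborel. (if x \<in> S then h x else 0) = h' x"
  shows "(\<integral>x. h x \<partial>lebesgue_on S) = (\<integral>x. h' x \<partial>lborel)"
    and "integrable (lebesgue_on S) h \<longleftrightarrow> integrable lborel h'"
proof -
  have S': "S \<in> sets lebesgue" using S by simp
  have m: "(\<lambda>x. indicator S x *\<^sub>R h x) \<in> borel_measurable lebesgue"
    using h borel_measurable_restrict_space_iff[of S lebesgue h] S' by simp
  have m': "h' \<in> borel_measurable lebesgue"
    using h' by (simp add: measurable_completion)
  have ae': "AE x in lebesgue. indicator S x *\<^sub>R h x = h' x"
    using AE_completion[OF ae] by eventually_elim (auto simp: indicator_def split: if_splits)
  have "(\<integral>x. h x \<partial>lebesgue_on S) = (\<integral>x. indicator S x *\<^sub>R h x \<partial>lebesgue)"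
    using S' by (subst integral_restrict_space) auto
  also have "\<dots> = (\<integral>x. h' x \<partial>lebesgue)" by (rule integral_cong_AE[OF m m' ae'])
  also have "\<dots> = (\<integral>x. h' x \<partial>lborel)" using h' by (subst integral_completion) auto
  finally show "(\<integral>x. h x \<partial>lebesgue_on S) = (\<integral>x. h' x \<partial>lborel)" .
  have "integrable (lebesgue_on S) h \<longleftrightarrow> integrable lebesgue (\<lambda>x. indicator S x *\<^sub>R h x)"
    using S' by (subst integrable_restrict_space) auto
  also have "\<dots> \<longleftrightarrow> integrable lebesgue h'" by (rule integrable_cong_AE[OF m m' ae'])
  also have "\<dots> \<longleftrightarrow> integrable lborel h'" using h' by (subst integrable_completion) auto
  finally show "integrable (lebesgue_on S) h \<longleftrightarrow> integrable lborel h'" .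
qed

lemma borel_representative:
  fixes u :: "'a::euclidean_space \<Rightarrow> real"
  assumes S: "S \<in> sets borel" and u: "u \<in> borel_measurable (lebesgue_on S)"
  obtains f where "f \<in> borel_measurable borel" "\<And>x. x \<notin> S \<Longrightarrow> f x = 0"
    "AE x in lborel. (if x \<in> S then u x else 0) = f x"
proof -
  have "(\<lambda>x. if x \<in> S then u x else 0) \<in> borel_measurable lebesgue"
    using borel_measurable_if_lebesgue_on[of S UNIV u] S u by (simp add: lebesgue_on_UNIV_eq)
  then obtain g where g: "g \<in> borel_measurable lborel" "AE x in lborel. (if x \<in> S then u x else 0) = g x"
    using completion_ex_borel_measurable_real by blast
  show ?thesis
  proof
    show "(\<lambda>x. indicator S x * g x) \<in> borel_measurable borel" using g(1) S by measurable
    show "AE x in lborel. (if x \<in> S then u x else 0) = indicator S x * g x"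
      using g(2) by eventually_elim (auto simp: indicator_def split: if_splits)
  qed auto
qed

lemma L2_representative:
  assumes S: "S \<in> sets borel" and u: "u \<in> L2_space S"
  obtains f where "f \<in> borel_measurable borel" "\<And>x. x \<notin> S \<Longrightarrow> f x = 0"
    "AE x in lborel. (if x \<in> S then u x else 0) = f x" "integrable lborel (\<lambda>x. (f x)\<^sup>2)"
    "(\<integral>\<^sup>+x. ennreal ((f x)\<^sup>2) \<partial>lborel) = ennreal ((L2_norm S u)\<^sup>2)"
proof -
  obtain f where f: "f \<in> borel_measurable borel" "\<And>x. x \<notin> S \<Longrightarrow> f x = 0"
    "AE x in lborel. (if x \<in> S then u x else 0) = f x"
    using borel_representative[OF S, of u] u unfolding L2_space_def by blast
  have ae2: "AE x in lborel. (if x \<in> S then (u x)\<^sup>2 else 0) = (f x)\<^sup>2"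
    using f(3) by eventually_elim auto
  have m2: "(\<lambda>x. (u x)\<^sup>2) \<in> borel_measurable (lebesgue_on S)" "(\<lambda>x. (f x)\<^sup>2) \<in> borel_measurable borel"
    using u f(1) by (auto simp: L2_space_def)
  note * = integral_lebesgue_on_eq_lborel[OF S m2 ae2]
  have i: "integrable lborel (\<lambda>x. (f x)\<^sup>2)" using * u by (simp add: L2_space_def)
  then have "(\<integral>\<^sup>+x. ennreal ((f x)\<^sup>2) \<partial>lborel) = ennreal (\<integral>x. (f x)\<^sup>2 \<partial>lborel)"
    by (rule nn_integral_eq_integral) simp
  also have "(\<integral>x. (f x)\<^sup>2 \<partial>lborel) = (L2_norm S u)\<^sup>2" using * by (simp add: L2_norm_square)
  finally show ?thesis using f i that by blast
qed

text \<open>Convolution needs an integrable function while the data are only square integrable; on a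
  bounded set Cauchy-Schwarz against the indicator of a ball closes the gap.\<close>

lemma integrable_of_square_integrable:
  fixes f :: "'a::euclidean_space \<Rightarrow> real"
  assumes "f \<in> borel_measurable borel" "integrable lborel (\<lambda>x. (f x)\<^sup>2)"
    and "bounded A" "\<And>x. x \<notin> A \<Longrightarrow> f x = 0"
  shows "integrable lborel f"
proof -
  obtain R where "\<forall>x\<in>A. norm x \<le> R" using assms(3) by (auto simp: bounded_iff)
  then have R: "A \<subseteq> cball 0 R" by auto
  have "integrable lborel (indicator (cball (0::'a) R) :: 'a \<Rightarrow> real)"
    using emeasure_lborel_cball_finite[of "0::'a" R] by (intro integrable_real_indicator) auto
  moreover have "(\<lambda>x. (indicator (cball (0::'a) R) x :: real)\<^sup>2) = indicator (cball 0 R)"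
    by (auto simp: fun_eq_iff indicator_def)
  ultimately have "integrable lborel (\<lambda>x. f x * indicator (cball 0 R) x)"
    using assms(1,2) by (intro Cauchy_Schwarz_integral(1)) auto
  also have "(\<lambda>x. f x * indicator (cball 0 R) x) = f"
  proof
    show "f x * indicator (cball 0 R) x = f x" for x
      using assms(4)[of x] R by (cases "x \<in> A") (auto simp: indicator_def)
  qed
  finally show ?thesis .
qed

section \<open>Weak derivatives under mollification\<close>

lemma sobolev_L2: "u \<in> sobolev k S \<Longrightarrow> u \<in> L2_space S"
  by (simp add: sobolev_def)

lemma weak_partials_single:
  assumes "u \<in> sobolev 1 S"
  shows "weak_partials S [i] u \<in> L2_space S" "has_weak_partials S [i] u (weak_partials S [i] u)"
proof -
  have "length [i] \<le> 1" by simp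
  then have "\<exists>g. g \<in> L2_space S \<and> has_weak_partials S [i] u g"
    using assms unfolding sobolev_def by blast
  from someI_ex[OF this]
  show "weak_partials S [i] u \<in> L2_space S" "has_weak_partials S [i] u (weak_partials S [i] u)"
    by (auto simp: weak_partials_def)
qed

text \<open>The factor \<open>\<psi>\<close> vanishes outside \<open>A\<close>, so a representative
  of \<open>u\<close> on \<open>A\<close> alone suffices. With \<open>A\<close> bounded that
  representative is integrable, which \<open>u\<close> on all of \<open>S\<close> need not
  be.\<close>

lemma integral_local_representative:
  fixes u :: "'a::euclidean_space \<Rightarrow> real"
  assumes S: "S \<in> sets borel" and u: "u \<in> L2_space S" and A: "A \<subseteq> S"
    and f: "f \<in> borel_measurable borel" "\<And>x. x \<notin> A \<Longrightarrow> f x = 0" "AE x in lborel. (if x \<in> A then u x else 0) = f x"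
    and \<psi>: "\<psi> \<in> borel_measurable borel" "\<And>x. x \<notin> A \<Longrightarrow> \<psi> x = 0"
  shows "(\<integral>z. u z * \<psi> z \<partial>lebesgue_on S) = (\<integral>z. f z * \<psi> z \<partial>lborel)"
proof (rule integral_lebesgue_on_eq_lborel(1)[OF S])
  have "\<psi> \<in> borel_measurable (lebesgue_on S)"
    using \<psi>(1) by (intro measurable_restrict_space1) (simp add: measurable_completion)
  then show "(\<lambda>z. u z * \<psi> z) \<in> borel_measurable (lebesgue_on S)"
    using u by (auto simp: L2_space_def)
  show "(\<lambda>z. f z * \<psi> z) \<in> borel_measurable borel" using f(1) \<psi>(1) by simp
  show "AE x in lborel. (if x \<in> S then u x * \<psi> x else 0) = f x * \<psi> x"
    using f(3) by eventually_elim (use A \<psi>(2) f(2) in \<open>auto split: if_splits\<close>)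
qed

text \<open>Moves the derivative from the kernel to the function: the reflected translate of
  \<open>\<rho>\<close> at \<open>x\<close> is an admissible test function because its support lies
  in \<open>S\<close>. Two signs cancel, one from integration by parts and one from the
  reflection.\<close>

lemma has_weak_partials_convol:
  fixes u :: "real^'d::finite \<Rightarrow> real"
  assumes S: "open S" and u: "u \<in> L2_space S" and g: "g \<in> L2_space S" and w: "has_weak_partials S [i] u g"
    and A: "A \<subseteq> S" "cball x e \<subseteq> A" and m: "mollifier e \<rho>"
    and f: "f \<in> borel_measurable borel" "\<And>x. x \<notin> A \<Longrightarrow> f x = 0" "AE x in lborel. (if x \<in> A then u x else 0) = f x"
    and f': "f' \<in> borel_measurable borel" "\<And>x. x \<notin> A \<Longrightarrow> f' x = 0" "AE x in lborel. (if x \<in> A then g x else 0) = f' x"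
  shows "(\<integral>z. f z * frechet_derivative \<rho> (at (x - z)) (axis i 1) \<partial>lborel) = convol f' \<rho> x"
proof -
  note [measurable] = mollifier_measurable[OF m]
  have S': "S \<in> sets borel" using S by simp
  define \<phi> where "\<phi> z = \<rho> (x - z)" for z
  have t: "\<phi> \<in> test_functions S"
    unfolding \<phi>_def using mollifier_test_function[OF m] A by blast
  have D: "(\<phi> has_derivative (\<lambda>h. - frechet_derivative \<rho> (at (x - z)) h)) (at z)" for z
  proof -
    have lin: "linear (frechet_derivative \<rho> (at (x - z)))"
      using mollifier_has_derivative[OF m] has_derivative_linear by blast
    have "(\<phi> has_derivative (\<lambda>h. frechet_derivative \<rho> (at (x - z)) (- h))) (at z)"
      unfolding \<phi>_def[abs_def]
      by (rule has_derivative_compose[of "\<lambda>q. x - q" "\<lambda>h. - h", OF _ mollifier_has_derivative[OF m], unfolded o_def])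
         (auto intro!: derivative_eq_intros)
    then show ?thesis by (simp add: linear_neg[OF lin])
  qed
  define \<psi> where "\<psi> z = frechet_derivative \<rho> (at (x - z)) (axis i 1)" for z
  have p: "partials [i] \<phi> z = - \<psi> z" for z
    using frechet_derivative_at[OF D[of z]] unfolding \<psi>_def by (simp add: fun_eq_iff)
  have \<psi>m: "\<psi> \<in> borel_measurable borel"
    unfolding \<psi>_def[abs_def]
    by (rule measurable_compose[OF _ mollifier_derivative_measurable[OF m], of "\<lambda>z. x - z"]) simp
  have \<phi>0: "\<phi> z = 0" if "z \<notin> cball x e" for z
    using that mollifier_eq_0[OF m, of "x - z"] by (auto simp: \<phi>_def dist_norm)
  have \<psi>0: "\<psi> z = 0" if "z \<notin> cball x e" for z
  proof -
    have "(\<phi> has_derivative (\<lambda>h. 0)) (at z)"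
      by (rule has_derivative_transform_within_open[of "\<lambda>x. 0" _ _ _ "- cball x e"])
         (use that \<phi>0 in auto)
    then have "(\<lambda>h. - frechet_derivative \<rho> (at (x - z)) h) = (\<lambda>h. 0)"
      using D by (metis has_derivative_unique)
    then show ?thesis unfolding \<psi>_def by (metis neg_equal_0_iff_equal)
  qed
  have "(\<integral>z. u z * partials [i] \<phi> z \<partial>lebesgue_on S) = - (\<integral>z. g z * \<phi> z \<partial>lebesgue_on S)"
    using w t by (simp add: has_weak_partials_def)
  then have "(\<integral>z. u z * \<psi> z \<partial>lebesgue_on S) = (\<integral>z. g z * \<phi> z \<partial>lebesgue_on S)"
    unfolding p by simp
  also have "(\<integral>z. g z * \<phi> z \<partial>lebesgue_on S) = (\<integral>z. f' z * \<phi> z \<partial>lborel)"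
  proof (rule integral_local_representative[OF S' g A(1) f'])
    show "\<phi> \<in> borel_measurable borel" unfolding \<phi>_def[abs_def] by measurable
    show "\<phi> z = 0" if "z \<notin> A" for z using \<phi>0 A(2) that by blast
  qed
  also have "(\<integral>z. u z * \<psi> z \<partial>lebesgue_on S) = (\<integral>z. f z * \<psi> z \<partial>lborel)"
  proof (rule integral_local_representative[OF S' u A(1) f \<psi>m])
    show "\<psi> z = 0" if "z \<notin> A" for z using \<psi>0 A(2) that by blast
  qed
  finally show ?thesis by (simp add: \<psi>_def \<phi>_def convol_def)
qed

text \<open>Testing with the reflected translate of a mollifier at \<open>x\<close> shows that the
  mollifications of \<open>g1\<close> and \<open>g2\<close> coincide at each \<open>x\<close> of a
  compact subset. As the radius shrinks they converge in \<open>L1\<close>, so the functions agree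
  there almost everywhere; countably many compact sets exhaust \<open>S\<close>.\<close>

lemma has_weak_partials_unique:
  fixes u :: "real^'d::finite \<Rightarrow> real"
  assumes S: "open S" and g1: "g1 \<in> L2_space S" and g2: "g2 \<in> L2_space S"
    and w1: "has_weak_partials S is u g1" and w2: "has_weak_partials S is u g2"
  shows "AE x in lebesgue_on S. g1 x = g2 x"
proof -
  have S': "S \<in> sets borel" using S by simp
  have K: "AE x in lborel. x \<in> K \<longrightarrow> g1 x = g2 x" if K: "compact K" "K \<subseteq> S" for K
  proof -
    obtain e where e: "e > 0" "(\<Union>x\<in>K. cball x e) \<subseteq> S"
      using compact_subset_open_imp_cball_epsilon_subset[OF K(1) S K(2)] by blast
    define A where "A = (\<Union>x\<in>K. cball x e)"
    have cA: "compact A" unfolding A_def using K(1) by (rule compact_minkowski_sum_cball)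
    have A: "A \<subseteq> S" "bounded A" "A \<in> sets borel"
      using e(2) compact_imp_bounded[OF cA] borel_compact[OF cA] by (simp_all add: A_def)
    have KA: "K \<subseteq> A"
    proof
      fix x assume "x \<in> K"
      then show "x \<in> A" unfolding A_def using e(1) by (intro UN_I[of x]) auto
    qed
    have [measurable]: "K \<in> sets borel" using K(1) by (rule borel_compact)
    have "\<exists>f. f \<in> borel_measurable borel \<and> (\<forall>x. x \<notin> A \<longrightarrow> f x = 0) \<and>
        (AE x in lborel. (if x \<in> A then g x else 0) = f x) \<and> integrable lborel f" if "g \<in> L2_space S" for g
    proof -
      have "g \<in> L2_space A"
        using L2_space_subset(1)[OF that _ _ A(1)] S' A(3) by simp
      then obtain f where f: "f \<in> borel_measurable borel" "\<And>x. x \<notin> A \<Longrightarrow> f x = 0"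
          "AE x in lborel. (if x \<in> A then g x else 0) = f x" "integrable lborel (\<lambda>x. (f x)\<^sup>2)"
        by (rule L2_representative[OF A(3)]) blast
      moreover have "integrable lborel f"
        by (rule integrable_of_square_integrable[OF f(1,4) A(2)]) (rule f(2))
      ultimately show ?thesis by blast
    qed
    from this[OF g1] this[OF g2] obtain f1 f2 where
      f1: "f1 \<in> borel_measurable borel" "\<And>x. x \<notin> A \<Longrightarrow> f1 x = 0"
        "AE x in lborel. (if x \<in> A then g1 x else 0) = f1 x" "integrable lborel f1" and
      f2: "f2 \<in> borel_measurable borel" "\<And>x. x \<notin> A \<Longrightarrow> f2 x = 0"
        "AE x in lborel. (if x \<in> A then g2 x else 0) = f2 x" "integrable lborel f2" by blast
    note [measurable] = f1(1) f2(1)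
    have small: "(\<integral>\<^sup>+x. ennreal \<bar>f1 x - f2 x\<bar> * indicator K x \<partial>lborel) \<le> ennreal d" if d: "d > 0" for d
    proof -
      have d2: "d / 2 > 0" using d by simp
      obtain e1 where e1: "e1 > 0" "\<And>e \<rho>. e \<le> e1 \<Longrightarrow> mollifier e \<rho> \<Longrightarrow> L1_dist (convol f1 \<rho>) f1 \<le> ennreal (d / 2)"
        using convol_L1_close[OF f1(4) d2] by metis
      obtain e2 where e2: "e2 > 0" "\<And>e \<rho>. e \<le> e2 \<Longrightarrow> mollifier e \<rho> \<Longrightarrow> L1_dist (convol f2 \<rho>) f2 \<le> ennreal (d / 2)"
        using convol_L1_close[OF f2(4) d2] by metis
      \<comment> \<open>Radius at most \<open>e\<close> keeps the support of the kernel inside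
        \<open>A\<close>; at most \<open>e1\<close> and \<open>e2\<close> makes both convolutions
        close.\<close>
      define e' where "e' = min e (min e1 e2)"
      have e': "e' > 0" "e' \<le> e" "e' \<le> e1" "e' \<le> e2" using e e1 e2 by (auto simp: e'_def)
      obtain \<rho> :: "real^'d \<Rightarrow> real" where m: "mollifier e' \<rho>" using mollifier_exists[OF e'(1)] .
      note [measurable] = mollifier_measurable[OF m] convol_measurable[OF m f1(4)] convol_measurable[OF m f2(4)]
      have eq: "convol f1 \<rho> x = convol f2 \<rho> x" if x: "x \<in> K" for x
      proof -
        have "cball x e \<subseteq> A" unfolding A_def using x by (rule UN_upper)
        moreover have "cball x e' \<subseteq> cball x e" using e'(2) by (simp add: subset_cball)
        ultimately have cb: "cball x e' \<subseteq> A" by (rule order_trans[rotated])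
        have t: "(\<lambda>z. \<rho> (x - z)) \<in> test_functions S"
          using mollifier_test_function[OF m] cb A by blast
        have z: "\<rho> (x - z) = 0" if "z \<notin> A" for z
        proof -
          have "z \<notin> cball x e'" using that cb by blast
          then show ?thesis using mollifier_eq_0[OF m, of "x - z"] by (simp add: dist_norm)
        qed
        have \<rho>m: "(\<lambda>z. \<rho> (x - z)) \<in> borel_measurable borel" by measurable
        have "(- 1) ^ length is * (\<integral>z. g1 z * \<rho> (x - z) \<partial>lebesgue_on S)
            = (- 1) ^ length is * (\<integral>z. g2 z * \<rho> (x - z) \<partial>lebesgue_on S)"
          using bspec[OF w1[unfolded has_weak_partials_def] t] bspec[OF w2[unfolded has_weak_partials_def] t]
          by (rule trans[OF sym])
        then have "(\<integral>z. g1 z * \<rho> (x - z) \<partial>lebesgue_on S) = (\<integral>z. g2 z * \<rho> (x - z) \<partial>lebesgue_on S)"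
          by simp
        moreover have "(\<integral>z. g1 z * \<rho> (x - z) \<partial>lebesgue_on S) = convol f1 \<rho> x"
          unfolding convol_def by (rule integral_local_representative[OF S' g1 A(1) f1(1-3) \<rho>m z])
        moreover have "(\<integral>z. g2 z * \<rho> (x - z) \<partial>lebesgue_on S) = convol f2 \<rho> x"
          unfolding convol_def by (rule integral_local_representative[OF S' g2 A(1) f2(1-3) \<rho>m z])
        ultimately show ?thesis by simp
      qed
      have "(\<integral>\<^sup>+x. ennreal \<bar>f1 x - f2 x\<bar> * indicator K x \<partial>lborel)
          \<le> (\<integral>\<^sup>+x. ennreal \<bar>convol f1 \<rho> x - f1 x\<bar> + ennreal \<bar>convol f2 \<rho> x - f2 x\<bar> \<partial>lborel)"
      proof (rule nn_integral_mono)
        fix x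
        show "ennreal \<bar>f1 x - f2 x\<bar> * indicator K x \<le> ennreal \<bar>convol f1 \<rho> x - f1 x\<bar> + ennreal \<bar>convol f2 \<rho> x - f2 x\<bar>"
          using eq[of x] by (cases "x \<in> K") (auto simp flip: ennreal_plus)
      qed
      also have "\<dots> = L1_dist (convol f1 \<rho>) f1 + L1_dist (convol f2 \<rho>) f2"
        by (rule nn_integral_add) auto
      also have "\<dots> \<le> ennreal (d / 2) + ennreal (d / 2)"
        using e1(2)[OF e'(3) m] e2(2)[OF e'(4) m] by (rule add_mono)
      also have "\<dots> = ennreal d" using d by (simp flip: ennreal_plus)
      finally show ?thesis .
    qed
    have "(\<integral>\<^sup>+x. ennreal \<bar>f1 x - f2 x\<bar> * indicator K x \<partial>lborel) \<le> 0"
    proof (rule ennreal_le_epsilon)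
      fix d :: real assume "0 < d"
      from small[OF this] show "(\<integral>\<^sup>+x. ennreal \<bar>f1 x - f2 x\<bar> * indicator K x \<partial>lborel) \<le> 0 + ennreal d"
        by simp
    qed
    then have "(\<integral>\<^sup>+x. ennreal \<bar>f1 x - f2 x\<bar> * indicator K x \<partial>lborel) = 0" by simp
    then have "AE x in lborel. ennreal \<bar>f1 x - f2 x\<bar> * indicator K x = 0"
      by (subst (asm) nn_integral_0_iff_AE) simp_all
    then show ?thesis
      using f1(3) f2(3)
    proof eventually_elim
      case (elim x)
      show ?case
      proof
        assume "x \<in> K"
        moreover from this have "x \<in> A" using KA by blast
        ultimately show "g1 x = g2 x" using elim by simp
      qed
    qed
  qed
  obtain F where F: "\<And>n::nat. compact (F n)" "\<And>n. F n \<subseteq> S" "(\<Union>n. F n) = S"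
    using open_Union_compact_subsets[OF S] by metis
  have "AE x in lborel. \<forall>n. x \<in> F n \<longrightarrow> g1 x = g2 x"
    unfolding AE_all_countable using K[OF F(1,2)] by blast
  then have "AE x in lebesgue. \<forall>n. x \<in> F n \<longrightarrow> g1 x = g2 x" by (rule AE_completion)
  then have "AE x in lebesgue. x \<in> S \<longrightarrow> g1 x = g2 x"
  proof eventually_elim
    case (elim x)
    then show ?case using F(3) by (metis UN_E)
  qed
  then show ?thesis using S' by (subst AE_restrict_space_iff) auto
qed

section \<open>Scaling, norms of order at most one, and the dual norm\<close>

lemma L2_space_cmult:
  assumes "u \<in> L2_space S"
  shows "(\<lambda>x. a * u x) \<in> L2_space S" and "L2_norm S (\<lambda>x. a * u x) = \<bar>a\<bar> * L2_norm S u"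
proof -
  show "(\<lambda>x. a * u x) \<in> L2_space S"
    using assms by (auto simp: L2_space_def power_mult_distrib)
  have "(\<integral>x. (norm (a * u x))\<^sup>2 \<partial>lebesgue_on S) = \<bar>a\<bar>\<^sup>2 * (\<integral>x. (norm (u x))\<^sup>2 \<partial>lebesgue_on S)"
    by (simp add: abs_mult power_mult_distrib)
  then show "L2_norm S (\<lambda>x. a * u x) = \<bar>a\<bar> * L2_norm S u"
    unfolding L2_norm_def by (simp only: real_sqrt_mult real_sqrt_abs abs_abs)
qed

lemma L2_norm_cong_AE:
  assumes "u \<in> L2_space S" "v \<in> L2_space S" "AE x in lebesgue_on S. u x = v x"
  shows "L2_norm S u = L2_norm S v"
proof -
  have "(\<integral>x. (norm (u x))\<^sup>2 \<partial>lebesgue_on S) = (\<integral>x. (norm (v x))\<^sup>2 \<partial>lebesgue_on S)"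
  proof (rule integral_cong_AE)
    show "AE x in lebesgue_on S. (norm (u x))\<^sup>2 = (norm (v x))\<^sup>2"
      using assms(3) by eventually_elim simp
  qed (use assms(1,2) in \<open>auto simp: L2_space_def\<close>)
  then show ?thesis by (simp add: L2_norm_def)
qed

lemma has_weak_partials_cmult:
  assumes "has_weak_partials S is u g"
  shows "has_weak_partials S is (\<lambda>x. a * u x) (\<lambda>x. a * g x)"
  unfolding has_weak_partials_def
proof
  fix \<phi> assume "\<phi> \<in> test_functions S"
  then have "(\<integral>x. u x * partials is \<phi> x \<partial>lebesgue_on S) = (- 1) ^ length is * (\<integral>x. g x * \<phi> x \<partial>lebesgue_on S)"
    using assms by (simp add: has_weak_partials_def)
  then show "(\<integral>x. a * u x * partials is \<phi> x \<partial>lebesgue_on S)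
      = (- 1) ^ length is * (\<integral>x. a * g x * \<phi> x \<partial>lebesgue_on S)"
    unfolding mult.assoc[of a] integral_mult_right_zero by simp
qed

lemma sobolev_cmult:
  assumes "u \<in> sobolev k S"
  shows "(\<lambda>x. a * u x) \<in> sobolev k S"
proof -
  have "\<exists>g\<in>L2_space S. has_weak_partials S is (\<lambda>x. a * u x) g" if len: "length is \<le> k" for "is"
  proof -
    obtain g where "g \<in> L2_space S" "has_weak_partials S is u g"
      using assms len unfolding sobolev_def by blast
    then show ?thesis
      by (intro bexI[of _ "\<lambda>x. a * g x"] has_weak_partials_cmult L2_space_cmult(1))
  qed
  then show ?thesis
    using L2_space_cmult(1)[OF sobolev_L2[OF assms], of a] by (simp add: sobolev_def)
qed

lemma weak_grad_L2_norm_square: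
  assumes "u \<in> sobolev 1 S"
  shows "integrable (lebesgue_on S) (\<lambda>x. (norm (weak_grad S u x))\<^sup>2)"
    and "(L2_norm S (weak_grad S u))\<^sup>2 = (\<Sum>i\<in>UNIV. (L2_norm S (weak_partials S [i] u))\<^sup>2)"
proof -
  have n: "(norm (weak_grad S u x))\<^sup>2 = (\<Sum>i\<in>UNIV. (weak_partials S [i] u x)\<^sup>2)" for x
    by (simp add: norm_vec_def L2_set_def sum_nonneg weak_grad_def)
  have i: "integrable (lebesgue_on S) (\<lambda>x. (weak_partials S [i] u x)\<^sup>2)" for i
    using weak_partials_single(1)[OF assms] by (simp add: L2_space_def)
  show "integrable (lebesgue_on S) (\<lambda>x. (norm (weak_grad S u x))\<^sup>2)"
    unfolding n by (intro Bochner_Integration.integrable_sum i)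
  show "(L2_norm S (weak_grad S u))\<^sup>2 = (\<Sum>i\<in>UNIV. (L2_norm S (weak_partials S [i] u))\<^sup>2)"
    unfolding L2_norm_square n using i by (subst Bochner_Integration.integral_sum) auto
qed

text \<open>Turns the bound of the extension operator at order zero into one of plain
  \<open>L2\<close> norms.\<close>

lemma sobolev_norm_0: "sobolev_norm 0 S u = L2_norm S u"
  by (simp add: sobolev_norm_def weak_partials_def L2_norm_nonneg)

lemma sobolev_0: "u \<in> L2_space S \<Longrightarrow> u \<in> sobolev 0 S"
  by (auto simp: sobolev_def has_weak_partials_def)

lemma sobolev_norm_1_sum:
  "(sobolev_norm 1 S u)\<^sup>2 = (L2_norm S u)\<^sup>2 + (\<Sum>i\<in>UNIV. (L2_norm S (weak_partials S [i] u))\<^sup>2)"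
proof -
  have "{is :: 'd list. length is \<le> 1} = insert [] (range (\<lambda>i. [i]))"
    by (auto simp: image_iff le_Suc_eq length_Suc_conv)
  then have "(\<Sum>is | length is \<le> 1. (L2_norm S (weak_partials S is u))\<^sup>2)
      = (\<Sum>is\<in>insert [] (range (\<lambda>i. [i])). (L2_norm S (weak_partials S is u))\<^sup>2)"
    by (rule arg_cong)
  also have "\<dots> = (L2_norm S u)\<^sup>2 + (\<Sum>is\<in>range (\<lambda>i. [i]). (L2_norm S (weak_partials S is u))\<^sup>2)"
    by (subst sum.insert) (auto simp: weak_partials_def[of _ "[]"])
  also have "(\<Sum>is\<in>range (\<lambda>i. [i]). (L2_norm S (weak_partials S is u))\<^sup>2) = (\<Sum>i\<in>UNIV. (L2_norm S (weak_partials S [i] u))\<^sup>2)"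
    by (subst sum.reindex) (auto simp: inj_on_def)
  finally show ?thesis
    by (simp add: sobolev_norm_def sum_nonneg)
qed

lemma sobolev_norm_nonneg: "sobolev_norm k S u \<ge> 0"
  by (simp add: sobolev_norm_def sum_nonneg)

text \<open>Homogeneity is not immediate: the representatives \<open>weak_partials S [i] (\<lambda>x. a * u x)\<close> and
  \<open>weak_partials S [i] u\<close> are chosen independently, so uniqueness of weak derivatives is needed.\<close>

lemma sobolev_norm_1_cmult:
  fixes u :: "real^'d::finite \<Rightarrow> real"
  assumes S: "open S" and u: "u \<in> sobolev 1 S"
  shows "sobolev_norm 1 S (\<lambda>x. a * u x) = \<bar>a\<bar> * sobolev_norm 1 S u"
proof -
  have p: "L2_norm S (weak_partials S [i] (\<lambda>x. a * u x)) = \<bar>a\<bar> * L2_norm S (weak_partials S [i] u)" for i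
  proof -
    note w = weak_partials_single[OF u, of i] and w' = weak_partials_single[OF sobolev_cmult[OF u, of a], of i]
    have "AE x in lebesgue_on S. weak_partials S [i] (\<lambda>x. a * u x) x = a * weak_partials S [i] u x"
      by (rule has_weak_partials_unique[OF S w'(1) L2_space_cmult(1)[OF w(1)] w'(2) has_weak_partials_cmult[OF w(2)]])
    from L2_norm_cong_AE[OF w'(1) L2_space_cmult(1)[OF w(1)] this] show ?thesis
      using L2_space_cmult(2)[OF w(1)] by simp
  qed
  have "(sobolev_norm 1 S (\<lambda>x. a * u x))\<^sup>2 = (\<bar>a\<bar> * sobolev_norm 1 S u)\<^sup>2"
    unfolding power_mult_distrib sobolev_norm_1_sum p L2_space_cmult(2)[OF sobolev_L2[OF u]]
    by (simp add: power_mult_distrib sum_distrib_left distrib_left)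
  then show ?thesis
    by (simp add: power2_eq_iff_nonneg sobolev_norm_nonneg)
qed

text \<open>Scaling \<open>v\<close> to norm one puts it into the set over which the supremum is
  taken. The a priori constant \<open>K\<close> makes that supremum bounded, without which its value
  would say nothing, and settles functions of norm zero.\<close>

lemma dual_H1_norm_bound:
  fixes F :: "(real^'d::finite \<Rightarrow> real) \<Rightarrow> real"
  assumes S: "open S" and K: "\<And>v. v \<in> sobolev 1 S \<Longrightarrow> \<bar>F v\<bar> \<le> K * sobolev_norm 1 S v"
    and hom: "\<And>a v. v \<in> sobolev 1 S \<Longrightarrow> F (\<lambda>x. a * v x) = a * F v" and v: "v \<in> sobolev 1 S"
  shows "\<bar>F v\<bar> \<le> dual_H1_norm S F * sobolev_norm 1 S v"
proof (cases "sobolev_norm 1 S v = 0")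
  case True
  then show ?thesis using K[OF v] by simp
next
  case False
  then have n: "sobolev_norm 1 S v > 0" using sobolev_norm_nonneg[of 1 S v] by simp
  define a where "a = inverse (sobolev_norm 1 S v)"
  have a: "a > 0" "a * sobolev_norm 1 S v = 1" using n by (auto simp: a_def)
  have "bdd_above ((\<lambda>v. \<bar>F v\<bar>) ` {v \<in> sobolev 1 S. sobolev_norm 1 S v \<le> 1})"
  proof (rule bdd_aboveI2)
    fix v assume v: "v \<in> {v \<in> sobolev 1 S. sobolev_norm 1 S v \<le> 1}"
    have "\<bar>F v\<bar> \<le> K * sobolev_norm 1 S v" using K v by blast
    also have "\<dots> \<le> \<bar>K\<bar> * 1"
      using v sobolev_norm_nonneg[of 1 S v] by (intro mult_mono) auto
    finally show "\<bar>F v\<bar> \<le> \<bar>K\<bar>" by simp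
  qed
  moreover have "(\<lambda>x. a * v x) \<in> {v \<in> sobolev 1 S. sobolev_norm 1 S v \<le> 1}"
    using sobolev_cmult[OF v] sobolev_norm_1_cmult[OF S v, of a] a by simp
  ultimately have "\<bar>F (\<lambda>x. a * v x)\<bar> \<le> dual_H1_norm S F"
    unfolding dual_H1_norm_def by (rule cSUP_upper[rotated])
  then have "a * \<bar>F v\<bar> \<le> dual_H1_norm S F" using a hom[OF v, of a] by (simp add: abs_mult)
  then show ?thesis using n by (simp add: a_def field_simps)
qed

section \<open>Lipschitz images\<close>

text \<open>Continuity alone does not preserve Lebesgue measurability; it suffices that null sets
  have null images, which the Lipschitz condition ensures.\<close>

lemma sets_lebesgue_lipschitz_image:
  fixes f :: "'a::euclidean_space \<Rightarrow> 'a"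
  assumes S: "S \<in> sets lebesgue" and f: "L-lipschitz_on S f"
  shows "f ` S \<in> sets lebesgue"
proof (rule sets_lebesgue_continuous_image[OF S])
  show "continuous_on S f" using f by (rule lipschitz_on_continuous_on)
  show "S \<subseteq> S" ..
  fix T assume T: "negligible T" "T \<subseteq> S"
  show "negligible (f ` T)"
    by (rule negligible_locally_Lipschitz_image[OF _ T(1)])
       (use T f in \<open>auto intro!: exI[of _ UNIV] exI[of _ L] dest: lipschitz_on_normD simp: subset_iff\<close>)
qed

text \<open>By Vitali's theorem, disjoint balls centred in \<open>S\<close> and contained in an open
  set barely larger than \<open>S\<close> cover \<open>S\<close> up to a null set. The image of the
  part of \<open>S\<close> in a ball of radius \<open>r\<close> lies in a ball of radius
  \<open>L * r\<close>, and the null remainder has a null image.\<close>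

lemma emeasure_lipschitz_image_le:
  fixes f :: "'a::euclidean_space \<Rightarrow> 'a"
  assumes S: "S \<in> sets lebesgue" and f: "L-lipschitz_on S f"
  shows "emeasure lebesgue (f ` S) \<le> ennreal (L ^ DIM('a)) * emeasure lebesgue S"
proof -
  define D where "D = DIM('a)"
  have L: "L \<ge> 0" using f by (rule lipschitz_on_nonneg)
  have fin: "emeasure lebesgue (f ` S) \<le> ennreal (L ^ D) * (emeasure lebesgue S + ennreal e)"
    if e: "e > 0" for e
  proof -
    obtain O' where O': "open O'" "S \<subseteq> O'" "O' - S \<in> lmeasurable"
        "emeasure lebesgue (O' - S) < ennreal e"
      by (rule sets_lebesgue_outer_open[OF S e])
    define K where "K = {(x, r). x \<in> S \<and> 0 < r \<and> ball x r \<subseteq> O'}"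
    have "\<exists>i. i \<in> K \<and> x \<in> ball (fst i) (snd i) \<and> snd i < d" if xd: "x \<in> S" "0 < d" for x d
    proof -
      obtain r where r: "r > 0" "ball x r \<subseteq> O'"
        using openE[OF O'(1), of x] O'(2) xd by blast
      show ?thesis
        by (rule exI[of _ "(x, min r (d / 2))"]) (use r xd in \<open>auto simp: K_def\<close>)
    qed
    then obtain C where C: "countable C" "C \<subseteq> K"
      "pairwise (\<lambda>i j. disjnt (ball (fst i) (snd i)) (ball (fst j) (snd j))) C"
      "negligible (S - (\<Union>i\<in>C. ball (fst i) (snd i)))"
      by (rule Vitali_covering_theorem_balls) blast
    define b where "b i = ball (fst i) (snd i :: real)" for i :: "'a \<times> real"
    \<comment> \<open>The countable family is numbered by naturals; an index that belongs to no ball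
      gets the empty set, so a finite family needs no separate case.\<close>
    define A where "A n = (\<Union>i\<in>{i\<in>C. to_nat_on C i = n}. b i)" for n
    have A_eq: "A n = (if n \<in> to_nat_on C ` C then b (from_nat_into C n) else {})" for n
      using C(1) by (auto simp: A_def)
    have A1: "emeasure lebesgue (f ` (S \<inter> A n)) \<le> ennreal (L ^ D) * emeasure lebesgue (A n)" for n
    proof (cases "n \<in> to_nat_on C ` C")
      case True
      then obtain x r where i: "(x, r) \<in> C" "n = to_nat_on C (x, r)" by auto
      then have An: "A n = ball x r" using C(1) by (auto simp: A_eq b_def)
      have xr: "x \<in> S" "r > 0" using i C(2) by (auto simp: K_def)
      have "f ` (S \<inter> A n) \<subseteq> cball (f x) (L * r)"
      proof (clarsimp simp: An)
        fix y assume "y \<in> S" "dist x y < r"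
        then have "dist (f x) (f y) \<le> L * dist x y" "L * dist x y \<le> L * r"
          using f xr L by (auto intro: lipschitz_onD mult_left_mono)
        then show "dist (f x) (f y) \<le> L * r" by simp
      qed
      then have "emeasure lebesgue (f ` (S \<inter> A n)) \<le> emeasure lebesgue (cball (f x) (L * r))"
        by (intro emeasure_mono) auto
      also have "\<dots> = ennreal (L ^ D) * emeasure lebesgue (ball x r)"
      proof -
        have "emeasure lebesgue (cball (f x) (L * r)) = ennreal (unit_ball_vol (real D) * (L * r) ^ D)"
          using L xr by (simp add: emeasure_cball D_def)
        also have "\<dots> = ennreal (L ^ D * (unit_ball_vol (real D) * r ^ D))"
          by (simp add: power_mult_distrib mult_ac)
        also have "\<dots> = ennreal (L ^ D) * ennreal (unit_ball_vol (real D) * r ^ D)"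
          using L by (intro ennreal_mult') auto
        also have "ennreal (unit_ball_vol (real D) * r ^ D) = emeasure lebesgue (ball x r)"
          using xr by (simp add: emeasure_ball D_def)
        finally show ?thesis .
      qed
      finally show ?thesis by (simp add: An)
    qed (simp add: A_eq)
    have disj: "disjoint_family A"
      unfolding disjoint_family_on_def
    proof (intro ballI impI)
      fix m n :: nat assume "m \<noteq> n"
      then show "A m \<inter> A n = {}"
        using pairwiseD[OF C(3)] unfolding A_def b_def disjnt_def by fastforce
    qed
    have UA: "(\<Union>n. A n) = (\<Union>i\<in>C. b i)" unfolding A_def by auto
    have AL: "A n \<in> sets lebesgue" for n by (auto simp: A_eq b_def)
    have meas: "f ` (S \<inter> A n) \<in> sets lebesgue" for n
      by (rule sets_lebesgue_lipschitz_image[OF _ lipschitz_on_subset[OF f]]) (use S AL in auto)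
    have null: "emeasure lebesgue (f ` (S - (\<Union>n. A n))) = 0"
    proof -
      have "negligible (f ` (S - (\<Union>n. A n)))"
        unfolding UA
        by (rule negligible_locally_Lipschitz_image)
           (use C(4) f in \<open>auto intro!: exI[of _ UNIV] exI[of _ L] dest: lipschitz_on_normD simp: b_def\<close>)
      then show ?thesis using negligible_iff_emeasure0 negligible_imp_sets by blast
    qed
    have meas0: "f ` (S - (\<Union>n. A n)) \<in> sets lebesgue"
      by (rule sets_lebesgue_lipschitz_image[OF _ lipschitz_on_subset[OF f]]) (use S AL in auto)
    have "f ` S \<subseteq> f ` (S - (\<Union>n. A n)) \<union> (\<Union>n. f ` (S \<inter> A n))" by blast
    then have "emeasure lebesgue (f ` S) \<le> emeasure lebesgue (f ` (S - (\<Union>n. A n)) \<union> (\<Union>n. f ` (S \<inter> A n)))"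
      by (rule emeasure_mono) (use meas meas0 in auto)
    also have "\<dots> \<le> emeasure lebesgue (f ` (S - (\<Union>n. A n))) + emeasure lebesgue (\<Union>n. f ` (S \<inter> A n))"
      by (rule emeasure_subadditive) (use meas meas0 in auto)
    also have "\<dots> \<le> (\<Sum>n. emeasure lebesgue (f ` (S \<inter> A n)))"
      unfolding null add_0 by (rule emeasure_subadditive_countably) (use meas in auto)
    also have "\<dots> \<le> (\<Sum>n. ennreal (L ^ D) * emeasure lebesgue (A n))"
      by (intro suminf_le A1) auto
    also have "\<dots> = ennreal (L ^ D) * emeasure lebesgue (\<Union>n. A n)"
      unfolding ennreal_suminf_cmult using suminf_emeasure[of A lebesgue, OF _ disj] AL
      by (metis image_subset_iff)
    also have "\<dots> \<le> ennreal (L ^ D) * emeasure lebesgue O'"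
    proof (intro mult_left_mono emeasure_mono)
      show "(\<Union>n. A n) \<subseteq> O'" using C(2) unfolding UA b_def K_def by fastforce
    qed (use O' in auto)
    also have "emeasure lebesgue O' \<le> emeasure lebesgue S + emeasure lebesgue (O' - S)"
    proof -
      have "O' = S \<union> (O' - S)" using O' by auto
      then show ?thesis
        using emeasure_subadditive[of S lebesgue "O' - S"] S O' by auto
    qed
    also have "\<dots> \<le> emeasure lebesgue S + ennreal e" using O' by (intro add_left_mono) auto
    finally show ?thesis by (simp add: mult_left_mono)
  qed
  show ?thesis
  proof (cases "emeasure lebesgue S = \<infinity> \<and> L ^ D \<noteq> 0")
    case True
    then show ?thesis using L by (simp add: ennreal_mult_top D_def)
  next
    case False
    show ?thesis
    proof (rule ennreal_le_epsilon)
      fix e :: real assume e: "e > 0"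
      \<comment> \<open>The error will be multiplied by \<open>L ^ D\<close>; adding 1 in the
        denominator covers \<open>L = 0\<close>.\<close>
      define d where "d = e / (L ^ D + 1)"
      have d: "d > 0" "L ^ D * d \<le> e" using e L by (auto simp: d_def field_simps add_pos_nonneg)
      have "emeasure lebesgue (f ` S) \<le> ennreal (L ^ D) * (emeasure lebesgue S + ennreal d)"
        using fin d by blast
      also have "\<dots> = ennreal (L ^ D) * emeasure lebesgue S + ennreal (L ^ D * d)"
        using L d by (simp add: distrib_left ennreal_mult)
      also have "\<dots> \<le> ennreal (L ^ D) * emeasure lebesgue S + ennreal e"
        using d by (intro add_left_mono ennreal_leI)
      finally show "emeasure lebesgue (f ` S) \<le> ennreal (L ^ DIM('a)) * emeasure lebesgue S + ennreal e"
        by (simp add: D_def)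
    qed
  qed
qed

text \<open>One-sided change of variables: the preimage of \<open>S\<close> under
  \<open>\<Phi>\<close> is contained in the image of \<open>S \<inter> A'\<close> under the
  Lipschitz map \<open>g\<close>. Hence the image measure of \<open>A\<close> is dominated by
  \<open>L ^ DIM('a)\<close> times Lebesgue measure on \<open>A'\<close>, and so are
  integrals.\<close>

lemma nn_integral_compose_le:
  fixes \<Phi> g :: "'a::euclidean_space \<Rightarrow> 'a" and h :: "'a \<Rightarrow> ennreal"
  assumes A[measurable]: "A \<in> sets borel" and A'[measurable]: "A' \<in> sets borel"
    and cont: "continuous_on A \<Phi>" and sub: "\<Phi> ` A \<subseteq> A'"
    and g: "L-lipschitz_on A' g" and inv: "\<And>x. x \<in> A \<Longrightarrow> g (\<Phi> x) = x"
    and h[measurable]: "h \<in> borel_measurable borel"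
  shows "(\<integral>\<^sup>+x. h (\<Phi> x) * indicator A x \<partial>lborel) \<le> ennreal (L ^ DIM('a)) * (\<integral>\<^sup>+x. h x * indicator A' x \<partial>lborel)"
proof -
  let ?c = "ennreal (L ^ DIM('a))"
  let ?N = "distr (restrict_space lborel A) borel \<Phi>"
  have [measurable]: "\<Phi> \<in> measurable (restrict_space lborel A) borel"
    using borel_measurable_continuous_on_restrict[OF cont] by simp
  have em: "emeasure ?N S \<le> emeasure (density lborel (\<lambda>x. ?c * indicator A' x)) S" for S
  proof (cases "S \<in> sets borel")
    case True
    note [measurable] = this
    have pre: "A \<inter> \<Phi> -` S \<in> sets borel"
      using measurable_sets[of \<Phi> "restrict_space lborel A" borel S]
      by (auto simp: space_restrict_space sets_restrict_space Int_commute image_iff)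
    have sb: "A \<inter> \<Phi> -` S \<subseteq> g ` (S \<inter> A')"
      using inv sub by (force simp: image_iff)
    have lip: "L-lipschitz_on (S \<inter> A') g" by (rule lipschitz_on_subset[OF g]) auto
    have "emeasure ?N S = emeasure lborel (A \<inter> \<Phi> -` S)"
      using pre by (subst emeasure_distr)
        (auto simp: space_restrict_space emeasure_restrict_space Int_commute)
    also have "\<dots> = emeasure lebesgue (A \<inter> \<Phi> -` S)" using pre by simp
    also have "\<dots> \<le> emeasure lebesgue (g ` (S \<inter> A'))"
      by (rule emeasure_mono[OF sb]) (rule sets_lebesgue_lipschitz_image[OF _ lip], auto)
    also have "\<dots> \<le> ?c * emeasure lebesgue (S \<inter> A')"
      by (rule emeasure_lipschitz_image_le[OF _ lip]) auto
    also have "\<dots> = ?c * emeasure lborel (S \<inter> A')" by simp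
    also have "\<dots> = emeasure (density lborel (\<lambda>x. ?c * indicator A' x)) S"
      by (subst emeasure_density)
         (auto simp: mult.assoc nn_integral_cmult indicator_inter_arith[symmetric] Int_commute)
    finally show ?thesis .
  qed (simp add: emeasure_notin_sets)
  have "(\<integral>\<^sup>+x. h (\<Phi> x) * indicator A x \<partial>lborel) = (\<integral>\<^sup>+x. h x \<partial>?N)"
    by (subst nn_integral_distr) (auto simp: nn_integral_restrict_space)
  also have "\<dots> \<le> (\<integral>\<^sup>+x. h x \<partial>density lborel (\<lambda>x. ?c * indicator A' x))"
    by (rule nn_integral_mono_measure) (use em in \<open>auto simp: le_measure\<close>)
  also have "\<dots> = ?c * (\<integral>\<^sup>+x. h x * indicator A' x \<partial>lborel)"
    by (subst nn_integral_density) (auto simp: nn_integral_cmult[symmetric] mult_ac)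
  finally show ?thesis .
qed

section \<open>The flow of the domain\<close>

lemma nonincreasing_of_derivative_within:
  fixes f :: "real \<Rightarrow> real"
  assumes "\<And>x. x \<in> {a..b} \<Longrightarrow> (f has_real_derivative f' x) (at x within {a..b})"
    and "\<And>x. x \<in> {a..b} \<Longrightarrow> f' x \<le> 0" and "s \<in> {a..b}" "t \<in> {a..b}" "s \<le> t"
  shows "f t \<le> f s"
proof (cases "s = t")
  case False
  then have st: "s < t" using assms by simp
  have "\<exists>x\<in>{s<..<t}. f t - f s = f' x * (t - s)"
  proof (rule mvt_simple[OF st])
    fix x assume "s \<le> x" "x \<le> t"
    then show "(f has_derivative (*) (f' x)) (at x within {s..t})"
      using assms(1)[of x] assms(3,4)
      by (auto simp: has_field_derivative_def intro: has_derivative_subset)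
  qed
  then obtain x where "x \<in> {s<..<t}" "f t - f s = f' x * (t - s)" by blast
  then show ?thesis
    using assms(2)[of x] assms(3,4) st mult_nonpos_nonneg[of "f' x" "t - s"] by auto
qed simp

text \<open>The squared distance \<open>e\<close> is differentiable even where the distance
  vanishes, and its derivative is at most \<open>2 * L * e\<close> in absolute value. So
  \<open>e\<close> times \<open>exp (- 2 * L * \<tau>)\<close> is nonincreasing, which settles
  \<open>s\<close> after \<open>t\<close>, and \<open>e\<close> times
  \<open>exp (2 * L * \<tau>)\<close> is nondecreasing, which settles \<open>s\<close> before
  \<open>t\<close>. Allowing both orders makes the flow Lipschitz in both directions.\<close>

lemma norm_diff_gronwall:
  fixes a b a' b' :: "real \<Rightarrow> 'a::real_inner"
  assumes a: "\<And>t. t \<in> {c..d} \<Longrightarrow> (a has_vector_derivative a' t) (at t within {c..d})"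
    and b: "\<And>t. t \<in> {c..d} \<Longrightarrow> (b has_vector_derivative b' t) (at t within {c..d})"
    and L: "\<And>t. t \<in> {c..d} \<Longrightarrow> norm (a' t - b' t) \<le> L * norm (a t - b t)"
    and s: "s \<in> {c..d}" and t: "t \<in> {c..d}"
  shows "norm (a s - b s) \<le> exp (L * \<bar>s - t\<bar>) * norm (a t - b t)"
proof -
  define e where "e \<tau> = (a \<tau> - b \<tau>) \<bullet> (a \<tau> - b \<tau>)" for \<tau>
  define e' where "e' \<tau> = 2 * ((a \<tau> - b \<tau>) \<bullet> (a' \<tau> - b' \<tau>))" for \<tau>
  have e: "(e has_real_derivative e' \<tau>) (at \<tau> within {c..d})" if "\<tau> \<in> {c..d}" for \<tau>
  proof -
    have 1: "((\<lambda>\<tau>. a \<tau> - b \<tau>) has_derivative (\<lambda>h. h *\<^sub>R (a' \<tau> - b' \<tau>))) (at \<tau> within {c..d})"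
      using has_vector_derivative_diff[OF a[OF that] b[OF that]]
      by (simp add: has_vector_derivative_def)
    have "(e has_derivative (\<lambda>h. (a \<tau> - b \<tau>) \<bullet> (h *\<^sub>R (a' \<tau> - b' \<tau>)) + (h *\<^sub>R (a' \<tau> - b' \<tau>)) \<bullet> (a \<tau> - b \<tau>)))
        (at \<tau> within {c..d})"
      unfolding e_def[abs_def] by (rule has_derivative_inner[OF 1 1])
    also have "(\<lambda>h. (a \<tau> - b \<tau>) \<bullet> (h *\<^sub>R (a' \<tau> - b' \<tau>)) + (h *\<^sub>R (a' \<tau> - b' \<tau>)) \<bullet> (a \<tau> - b \<tau>)) = (*) (e' \<tau>)"
      by (auto simp: e'_def fun_eq_iff inner_commute algebra_simps)
    finally show ?thesis by (simp add: has_field_derivative_def)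
  qed
  have e'_le: "\<bar>e' \<tau>\<bar> \<le> 2 * L * e \<tau>" if "\<tau> \<in> {c..d}" for \<tau>
  proof -
    have "\<bar>(a \<tau> - b \<tau>) \<bullet> (a' \<tau> - b' \<tau>)\<bar> \<le> norm (a \<tau> - b \<tau>) * norm (a' \<tau> - b' \<tau>)"
      by (rule Cauchy_Schwarz_ineq2)
    also have "\<dots> \<le> norm (a \<tau> - b \<tau>) * (L * norm (a \<tau> - b \<tau>))"
      by (rule mult_left_mono[OF L[OF that]]) simp
    also have "\<dots> = L * e \<tau>" by (simp add: e_def norm_eq_sqrt_inner)
    finally show ?thesis by (simp add: e'_def abs_mult)
  qed
  \<comment> \<open>Removes the exponential weight at time \<open>s\<close> after multiplication by
    its inverse.\<close>
  have cancel: "x \<le> z * y" if "x * p * q \<le> y * r * q" "p * q = 1" "r * q = z" for x y z p q r :: real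
  proof -
    have "x * (p * q) \<le> y * (r * q)" using that(1) by (simp only: mult.assoc)
    then show ?thesis unfolding that(2,3) by (simp add: mult.commute)
  qed
  have main: "e s \<le> exp (2 * (L * \<bar>s - t\<bar>)) * e t"
  proof (cases "t \<le> s")
    case True
    have "e s * exp (- 2 * L * s) \<le> e t * exp (- 2 * L * t)"
    proof (rule nonincreasing_of_derivative_within[OF _ _ t s True])
      fix \<tau> assume \<tau>: "\<tau> \<in> {c..d}"
      show "((\<lambda>\<tau>. e \<tau> * exp (- 2 * L * \<tau>)) has_real_derivative (e' \<tau> - 2 * L * e \<tau>) * exp (- 2 * L * \<tau>)) (at \<tau> within {c..d})"
        by (rule derivative_eq_intros e[OF \<tau>] refl)+ (simp add: algebra_simps)
      show "(e' \<tau> - 2 * L * e \<tau>) * exp (- 2 * L * \<tau>) \<le> 0"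
        using e'_le[OF \<tau>] by (intro mult_nonpos_nonneg) auto
    qed
    then have "e s * exp (- 2 * L * s) * exp (2 * L * s) \<le> e t * exp (- 2 * L * t) * exp (2 * L * s)"
      by (rule mult_right_mono) simp
    moreover have "exp (- 2 * L * s) * exp (2 * L * s) = 1" by (simp flip: exp_add)
    moreover have "exp (- 2 * L * t) * exp (2 * L * s) = exp (2 * (L * \<bar>s - t\<bar>))"
      unfolding exp_add[symmetric] using True by (intro arg_cong[of _ _ exp]) (simp add: algebra_simps)
    ultimately show ?thesis by (rule cancel)
  next
    case False
    then have st: "s \<le> t" by simp
    have "- (e t * exp (2 * L * t)) \<le> - (e s * exp (2 * L * s))"
    proof (rule nonincreasing_of_derivative_within[OF _ _ s t st])
      fix \<tau> assume \<tau>: "\<tau> \<in> {c..d}"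
      show "((\<lambda>\<tau>. - (e \<tau> * exp (2 * L * \<tau>))) has_real_derivative - ((e' \<tau> + 2 * L * e \<tau>) * exp (2 * L * \<tau>))) (at \<tau> within {c..d})"
        by (rule derivative_eq_intros e[OF \<tau>] refl)+ (simp add: algebra_simps)
      show "- ((e' \<tau> + 2 * L * e \<tau>) * exp (2 * L * \<tau>)) \<le> 0"
      proof -
        have "0 \<le> (e' \<tau> + 2 * L * e \<tau>) * exp (2 * L * \<tau>)"
          using e'_le[OF \<tau>] by (intro mult_nonneg_nonneg) auto
        then show ?thesis by simp
      qed
    qed
    then have "e s * exp (2 * L * s) * exp (- 2 * L * s) \<le> e t * exp (2 * L * t) * exp (- 2 * L * s)"
      by (intro mult_right_mono) auto
    moreover have "exp (2 * L * s) * exp (- 2 * L * s) = 1" by (simp flip: exp_add)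
    moreover have "exp (2 * L * t) * exp (- 2 * L * s) = exp (2 * (L * \<bar>s - t\<bar>))"
      unfolding exp_add[symmetric] using False by (intro arg_cong[of _ _ exp]) (simp add: algebra_simps)
    ultimately show ?thesis by (rule cancel)
  qed
  have "sqrt (e s) \<le> sqrt (exp (2 * (L * \<bar>s - t\<bar>)) * e t)" using main by (rule real_sqrt_le_mono)
  also have "\<dots> = exp (L * \<bar>s - t\<bar>) * sqrt (e t)"
    unfolding exp_double real_sqrt_mult by simp
  finally show ?thesis by (simp add: e_def norm_eq_sqrt_inner)
qed

lemma passively_transportedD:
  assumes "passively_transported T w \<Psi> \<Omega>" "t \<in> {0..T}"
  shows "y \<in> \<Omega> 0 \<Longrightarrow> ((\<lambda>s. \<Psi> s y) has_vector_derivative w t (\<Psi> t y)) (at t within {0..T})"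
    and "\<Omega> t = \<Psi> t ` \<Omega> 0" and "y \<in> \<Omega> 0 \<Longrightarrow> \<Psi> t y \<in> \<Omega> t"
  using assms unfolding passively_transported_def by blast+

text \<open>As \<open>B\<close> may be unbounded, bounds on \<open>w\<close> are sought only on the
  set swept by the domain. Lifting \<open>\<Psi>\<close> to space-time and taking the image of the
  compact closure of \<open>X\<close> gives a compact \<open>Q\<close> that contains every pair of a
  time and a point of the domain at that time.\<close>

lemma transported_domain_constants:
  fixes w \<Psi> :: "real \<Rightarrow> 'a::euclidean_space \<Rightarrow> 'a"
  assumes w: "smooth_up_to_boundary ({0..T} \<times> B) (\<lambda>(t, x). w t x)"
    and \<Psi>: "smooth_up_to_boundary ({0..T} \<times> \<Omega> 0) (\<lambda>(t, y). \<Psi> t y)"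
    and p: "passively_transported T w \<Psi> \<Omega>"
    and sub: "\<And>t. t \<in> {0..T} \<Longrightarrow> \<Omega> t \<subseteq> B" and bdd: "bounded (\<Omega> 0)"
  obtains L W where "L \<ge> 0" "W \<ge> 0"
    "\<And>t. t \<in> {0..T} \<Longrightarrow> L-lipschitz_on (\<Omega> t) (w t)"
    "\<And>t x. t \<in> {0..T} \<Longrightarrow> x \<in> \<Omega> t \<Longrightarrow> norm (w t x) \<le> W"
    "continuous_on ({0..T} \<times> \<Omega> 0) (\<lambda>(t, y). \<Psi> t y)"
proof -
  obtain U g where Ug: "open U \<and> closure ({0..T} \<times> B) \<subseteq> U \<and> smooth_fun_on U g \<and>
      (\<forall>x\<in>{0..T} \<times> B. g x = (case x of (t, x) \<Rightarrow> w t x))"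
    using w[unfolded smooth_up_to_boundary_def] by (elim exE)
  note U = Ug[THEN conjunct1] Ug[THEN conjunct2, THEN conjunct1]
      Ug[THEN conjunct2, THEN conjunct2, THEN conjunct1]
    and gU = Ug[THEN conjunct2, THEN conjunct2, THEN conjunct2]
  have U4: "g (t, x) = w t x" if "t \<in> {0..T}" "x \<in> B" for t x
    using bspec[OF gU, of "(t, x)"] that by simp
  obtain U' G where UG: "open U' \<and> closure ({0..T} \<times> \<Omega> 0) \<subseteq> U' \<and> smooth_fun_on U' G \<and>
      (\<forall>x\<in>{0..T} \<times> \<Omega> 0. G x = (case x of (t, y) \<Rightarrow> \<Psi> t y))"
    using \<Psi>[unfolded smooth_up_to_boundary_def] by (elim exE)
  note U' = UG[THEN conjunct1] UG[THEN conjunct2, THEN conjunct1]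
      UG[THEN conjunct2, THEN conjunct2, THEN conjunct1]
    and GU = UG[THEN conjunct2, THEN conjunct2, THEN conjunct2]
  have U'4: "G (t, x) = \<Psi> t x" if "t \<in> {0..T}" "x \<in> \<Omega> 0" for t x
    using bspec[OF GU, of "(t, x)"] that by simp
  define X where "X = {0..T} \<times> \<Omega> 0"
  define h where "h z = (fst z, G z)" for z :: "real \<times> 'a"
  have G_cont: "continuous_on (closure X) G"
    using U'(2,3) unfolding X_def smooth_fun_on_def by (metis Ck_on.simps(1) continuous_on_subset)
  have h_cont: "continuous_on (closure X) h"
    unfolding h_def by (intro continuous_intros G_cont)
  have cX: "compact (closure X)"
    using bdd unfolding X_def compact_closure by (intro bounded_Times) auto
  define Q where "Q = h ` closure X"
  have cQ: "compact Q" unfolding Q_def by (rule compact_continuous_image[OF h_cont cX])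
  have hX: "h ` X \<subseteq> {0..T} \<times> B"
    using U'4 passively_transportedD(3)[OF p] sub unfolding h_def X_def by fastforce
  \<comment> \<open>\<open>Q\<close> may leave the product of the time interval with
    \<open>B\<close> but not its closure, and the extension \<open>g\<close> of the velocity is
    smooth on a neighbourhood of that closure.\<close>
  have "Q \<subseteq> closure (h ` X)"
    unfolding Q_def by (rule continuous_image_closure_subset[OF h_cont]) simp
  also have "\<dots> \<subseteq> U" using closure_mono[OF hX] U(2) by blast
  finally have QU: "Q \<subseteq> U" .
  have QX: "(t, x) \<in> Q" if xt: "t \<in> {0..T}" "x \<in> \<Omega> t" for t x
  proof -
    obtain y where "y \<in> \<Omega> 0" "x = \<Psi> t y"
      using p xt unfolding passively_transported_def by blast
    then have "(t, y) \<in> X" "h (t, y) = (t, x)"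
      using U'4 xt by (auto simp: X_def h_def)
    then show ?thesis unfolding Q_def using closure_subset by (metis image_eqI subsetD)
  qed
  have gw: "g (t, x) = w t x" if "t \<in> {0..T}" "x \<in> \<Omega> t" for t x
    using U4 sub that by blast
  have C1: "Ck_on 1 U g" using U(3) unfolding smooth_fun_on_def by blast
  obtain L where L: "L > 0" "L-lipschitz_on Q g"
    by (rule C1_lipschitz_on_compact[OF U(1) C1 cQ QU])
  obtain W where W: "W \<ge> 0" "\<And>z. z \<in> Q \<Longrightarrow> norm (g z) \<le> W"
    using continuous_on_compact_bound[OF cQ lipschitz_on_continuous_on[OF L(2)]] by metis
  show ?thesis
  proof (rule that[of L W])
    fix t assume t: "t \<in> {0..T}"
    show "L-lipschitz_on (\<Omega> t) (w t)"
    proof (rule lipschitz_onI)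
      fix x y assume xy: "x \<in> \<Omega> t" "y \<in> \<Omega> t"
      have "dist (g (t, x)) (g (t, y)) \<le> L * dist (t, x) (t, y)"
        using lipschitz_onD[OF L(2)] QX t xy by blast
      then show "dist (w t x) (w t y) \<le> L * dist x y"
        using gw[OF t xy(1)] gw[OF t xy(2)] by (simp add: dist_Pair_Pair)
    qed (use L in simp)
  next
    show "norm (w t x) \<le> W" if "t \<in> {0..T}" "x \<in> \<Omega> t" for t x
      using W(2)[OF QX[OF that]] gw[OF that] by simp
    have "continuous_on X G" using G_cont closure_subset by (rule continuous_on_subset)
    then show "continuous_on ({0..T} \<times> \<Omega> 0) (\<lambda>(t, y). \<Psi> t y)"
      unfolding X_def by (rule continuous_on_eq) (auto simp: U'4)
  qed (use L W in auto)
qed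

lemma flow_lipschitz:
  fixes w \<Psi> :: "real \<Rightarrow> 'a::euclidean_space \<Rightarrow> 'a"
  assumes p: "passively_transported T w \<Psi> \<Omega>"
    and L: "\<And>t. t \<in> {0..T} \<Longrightarrow> L-lipschitz_on (\<Omega> t) (w t)"
    and st: "s \<in> {0..T}" "t \<in> {0..T}" and xy: "x \<in> \<Omega> 0" "y \<in> \<Omega> 0"
  shows "norm (\<Psi> s x - \<Psi> s y) \<le> exp (L * \<bar>s - t\<bar>) * norm (\<Psi> t x - \<Psi> t y)"
proof (rule norm_diff_gronwall[OF _ _ _ st])
  fix \<tau> assume \<tau>: "\<tau> \<in> {0..T}"
  show "((\<lambda>\<tau>. \<Psi> \<tau> x) has_vector_derivative w \<tau> (\<Psi> \<tau> x)) (at \<tau> within {0..T})"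
    "((\<lambda>\<tau>. \<Psi> \<tau> y) has_vector_derivative w \<tau> (\<Psi> \<tau> y)) (at \<tau> within {0..T})"
    using passively_transportedD(1)[OF p \<tau>] xy by blast+
  have "\<Psi> \<tau> x \<in> \<Omega> \<tau>" "\<Psi> \<tau> y \<in> \<Omega> \<tau>"
    using passively_transportedD(3)[OF p \<tau>] xy by blast+
  then show "norm (w \<tau> (\<Psi> \<tau> x) - w \<tau> (\<Psi> \<tau> y)) \<le> L * norm (\<Psi> \<tau> x - \<Psi> \<tau> y)"
    using lipschitz_on_normD[OF L[OF \<tau>]] by blast
qed

section \<open>Sobolev functions along the flow\<close>

text \<open>The constant is the \<open>L1\<close> norm of \<open>f\<close> times the Lipschitz
  constant of the kernel. It degenerates with the kernel and only justifies differentiation under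
  the integral; the final estimate along trajectories does not contain it.\<close>

lemma convol_lipschitz:
  fixes f \<rho> :: "'a::euclidean_space \<Rightarrow> real"
  assumes m: "mollifier e \<rho>" and f: "integrable lborel f"
  obtains C where "C \<ge> 0" "\<And>x y. \<bar>convol f \<rho> x - convol f \<rho> y\<bar> \<le> C * norm (x - y)"
    "\<And>x h. \<bar>\<integral>z. f z * frechet_derivative \<rho> (at (x - z)) h \<partial>lborel\<bar> \<le> C * norm h"
proof -
  obtain M where M: "M \<ge> 0" "\<And>x h. \<bar>frechet_derivative \<rho> (at x) h\<bar> \<le> M * norm h" "M-lipschitz_on UNIV \<rho>"
    by (rule mollifier_derivative_bounded[OF m]) blast
  have [measurable]: "f \<in> borel_measurable borel" using f by auto
  define C where "C = (\<integral>z. \<bar>f z\<bar> \<partial>lborel) * M"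
  have C0: "C \<ge> 0" using M(1) by (simp add: C_def)
  have 1: "\<bar>convol f \<rho> x - convol f \<rho> y\<bar> \<le> C * norm (x - y)" for x y
  proof -
    note i = convol_integrable[OF m f, of x] convol_integrable[OF m f, of y]
    have "convol f \<rho> x - convol f \<rho> y = (\<integral>z. f z * \<rho> (x - z) - f z * \<rho> (y - z) \<partial>lborel)"
      unfolding convol_def using i by simp
    also have "\<bar>\<dots>\<bar> \<le> (\<integral>z. \<bar>f z * \<rho> (x - z) - f z * \<rho> (y - z)\<bar> \<partial>lborel)"
      by (rule integral_abs_bound)
    also have "\<dots> \<le> (\<integral>z. \<bar>f z\<bar> * (M * norm (x - y)) \<partial>lborel)"
    proof (rule integral_mono)
      fix z
      have "\<bar>\<rho> (x - z) - \<rho> (y - z)\<bar> \<le> M * norm (x - y)"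
        using lipschitz_on_normD[OF M(3), of "x - z" "y - z"] by simp
      then show "\<bar>f z * \<rho> (x - z) - f z * \<rho> (y - z)\<bar> \<le> \<bar>f z\<bar> * (M * norm (x - y))"
        by (simp add: abs_mult mult_left_mono flip: right_diff_distrib)
    qed (use i f in auto)
    also have "\<dots> = C * norm (x - y)" by (simp add: C_def)
    finally show ?thesis .
  qed
  have 2: "\<bar>\<integral>z. f z * frechet_derivative \<rho> (at (x - z)) h \<partial>lborel\<bar> \<le> C * norm h" for x h
  proof -
    have "(\<lambda>z. frechet_derivative \<rho> (at (x - z)) h) \<in> borel_measurable borel"
      by (rule measurable_compose[OF _ mollifier_derivative_measurable[OF m], of "\<lambda>z. x - z"]) simp
    then have [measurable]: "(\<lambda>z. f z * frechet_derivative \<rho> (at (x - z)) h) \<in> borel_measurable lborel"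
      by simp
    have b: "\<bar>f z * frechet_derivative \<rho> (at (x - z)) h\<bar> \<le> \<bar>f z\<bar> * (M * norm h)" for z
      using M(2)[of "x - z" h] by (simp add: abs_mult mult_left_mono)
    have ib: "integrable lborel (\<lambda>z. \<bar>f z\<bar> * (M * norm h))" using f by auto
    have "integrable lborel (\<lambda>z. f z * frechet_derivative \<rho> (at (x - z)) h)"
      by (rule Bochner_Integration.integrable_bound[OF ib]) (use order_trans[OF b abs_ge_self] in auto)
    then have "\<bar>\<integral>z. f z * frechet_derivative \<rho> (at (x - z)) h \<partial>lborel\<bar> \<le> (\<integral>z. \<bar>f z\<bar> * (M * norm h) \<partial>lborel)"
      by (intro order_trans[OF integral_abs_bound] integral_mono ib b) auto
    also have "\<dots> = C * norm h" by (simp add: C_def)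
    finally show ?thesis .
  qed
  show ?thesis using that[OF C0 1 2] .
qed

section \<open>Integrals over compact sets and their images under the flow\<close>

lemma integrable_continuous_on_compact:
  fixes h :: "'a::euclidean_space \<Rightarrow> real"
  assumes "compact K" "continuous_on K h"
  shows "integrable (restrict_space lborel K) h"
  using borel_integrable_compact[OF assms] assms(1)
  by (subst integrable_restrict_space) (auto intro: borel_compact)

lemma measurable_continuous_on_compact:
  fixes h :: "'a::euclidean_space \<Rightarrow> 'b::topological_space"
  assumes "continuous_on K h"
  shows "h \<in> measurable (restrict_space lborel K) borel"
  using borel_measurable_continuous_on_restrict[OF assms] by simp

text \<open>The lower bound on distances gives injectivity and makes the inverse Lipschitz with
  constant \<open>M\<close>, so \<open>nn_integral_compose_le\<close> applies. Compactness of
  \<open>K\<close> makes its image a Borel set.\<close>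

lemma nn_integral_pullback_le:
  fixes \<Phi> :: "'a::euclidean_space \<Rightarrow> 'a" and h :: "'a \<Rightarrow> ennreal"
  assumes K: "compact K" and c: "continuous_on K \<Phi>" and M: "M \<ge> 0"
    and ex: "\<And>x y. x \<in> K \<Longrightarrow> y \<in> K \<Longrightarrow> norm (x - y) \<le> M * norm (\<Phi> x - \<Phi> y)"
    and h: "h \<in> borel_measurable borel"
  shows "(\<integral>\<^sup>+x. h (\<Phi> x) \<partial>restrict_space lborel K) \<le> ennreal (M ^ DIM('a)) * (\<integral>\<^sup>+x. h x \<partial>lborel)"
proof -
  have Kb: "K \<in> sets borel" "\<Phi> ` K \<in> sets borel"
    using K compact_continuous_image[OF c K] by (auto intro: borel_compact)
  have inj: "inj_on \<Phi> K"
  proof (rule inj_onI)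
    fix x y assume "x \<in> K" "y \<in> K" "\<Phi> x = \<Phi> y"
    then show "x = y" using ex[of x y] by simp
  qed
  have lip: "M-lipschitz_on (\<Phi> ` K) (inv_into K \<Phi>)"
  proof (rule lipschitz_onI[OF _ M])
    fix x y assume "x \<in> \<Phi> ` K" "y \<in> \<Phi> ` K"
    then show "dist (inv_into K \<Phi> x) (inv_into K \<Phi> y) \<le> M * dist x y"
      using ex[of "inv_into K \<Phi> x" "inv_into K \<Phi> y"]
      by (simp add: dist_norm inv_into_into f_inv_into_f)
  qed
  have "(\<integral>\<^sup>+x. h (\<Phi> x) \<partial>restrict_space lborel K) = (\<integral>\<^sup>+x. h (\<Phi> x) * indicator K x \<partial>lborel)"
    using Kb by (simp add: nn_integral_restrict_space)
  also have "\<dots> \<le> ennreal (M ^ DIM('a)) * (\<integral>\<^sup>+x. h x * indicator (\<Phi> ` K) x \<partial>lborel)"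
    by (rule nn_integral_compose_le[OF Kb c order_refl lip _ h]) (simp add: inj)
  also have "\<dots> \<le> ennreal (M ^ DIM('a)) * (\<integral>\<^sup>+x. h x \<partial>lborel)"
    by (intro mult_left_mono nn_integral_mono) (auto simp: indicator_def)
  finally show ?thesis .
qed

text \<open>Testing \<open>V \<circ> \<gamma> \<tau>\<close> against the fixed function \<open>V \<circ> \<gamma> s - V \<circ> \<gamma> t\<close> and applying the mean value
  theorem in \<open>\<tau>\<close> avoids integrating along the trajectories.\<close>

lemma square_difference_along_flow_smooth:
  fixes \<gamma> v :: "real \<Rightarrow> real^'d::finite \<Rightarrow> real^'d" and V :: "real^'d \<Rightarrow> real" and P :: "'d \<Rightarrow> real^'d \<Rightarrow> real"
  assumes K: "compact K" and st: "s \<in> {a..b}" "t \<in> {a..b}"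
    and der: "\<And>x \<tau>. x \<in> K \<Longrightarrow> \<tau> \<in> {a..b} \<Longrightarrow> ((\<lambda>\<sigma>. \<gamma> \<sigma> x) has_vector_derivative v \<tau> x) (at \<tau> within {a..b})"
    and vb: "\<And>x \<tau>. x \<in> K \<Longrightarrow> \<tau> \<in> {a..b} \<Longrightarrow> norm (v \<tau> x) \<le> W"
    and vc: "\<And>\<tau>. \<tau> \<in> {a..b} \<Longrightarrow> continuous_on K (v \<tau>)"
    and \<gamma>c: "\<And>\<tau>. \<tau> \<in> {a..b} \<Longrightarrow> continuous_on K (\<gamma> \<tau>)"
    and V: "\<And>x \<tau>. x \<in> K \<Longrightarrow> \<tau> \<in> {a..b} \<Longrightarrow> (V has_derivative (\<lambda>h. \<Sum>i\<in>UNIV. h $ i * P i (\<gamma> \<tau> x))) (at (\<gamma> \<tau> x))"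
    and C: "\<And>x y. \<bar>V x - V y\<bar> \<le> C * norm (x - y)" "C \<ge> 0"
    and C': "\<And>x \<tau> h. x \<in> K \<Longrightarrow> \<tau> \<in> {a..b} \<Longrightarrow> \<bar>\<Sum>i\<in>UNIV. h $ i * P i (\<gamma> \<tau> x)\<bar> \<le> C * norm h"
    and P: "\<And>i. continuous_on UNIV (P i)"
    and J: "\<And>\<tau>. \<tau> \<in> {a..b} \<Longrightarrow> (\<integral>x. (\<Sum>i\<in>UNIV. (P i (\<gamma> \<tau> x))\<^sup>2) \<partial>restrict_space lborel K) \<le> J"
  shows "(\<integral>x. (V (\<gamma> s x) - V (\<gamma> t x))\<^sup>2 \<partial>restrict_space lborel K) \<le> \<bar>s - t\<bar>\<^sup>2 * W\<^sup>2 * J"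
proof (cases "K = {} \<or> s = t")
  case True
  have "J \<ge> 0" by (rule order_trans[OF _ J[OF st(1)]]) (auto intro!: integral_nonneg_AE sum_nonneg)
  moreover have "(\<integral>x. (V (\<gamma> s x) - V (\<gamma> t x))\<^sup>2 \<partial>restrict_space lborel K) = 0"
    using True
  proof
    assume "K = {}"
    then show ?thesis by (simp add: integral_restrict_space)
  qed simp
  ultimately show ?thesis by (simp add: power2_eq_square)
next
  case False
  then have K0: "K \<noteq> {}" and neq: "s \<noteq> t" by auto
  define N where "N = restrict_space lborel K"
  have spN: "space N = K" by (simp add: N_def space_restrict_space)
  have intN: "integrable N h" if "continuous_on K h" for h :: "real^'d \<Rightarrow> real"
    unfolding N_def by (rule integrable_continuous_on_compact[OF K that])
  have mN: "h \<in> borel_measurable N" if "continuous_on K h" for h :: "real^'d \<Rightarrow> real"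
    unfolding N_def by (rule measurable_continuous_on_compact[OF that])
  have W: "W \<ge> 0" using K0 vb st(1) norm_ge_zero order_trans by blast
  have V_cont: "continuous_on UNIV V"
    by (rule lipschitz_on_continuous_on[of C]) (rule lipschitz_onI, use C in \<open>auto simp: dist_norm\<close>)
  have V\<gamma>: "continuous_on K (\<lambda>x. V (\<gamma> \<tau> x))" if "\<tau> \<in> {a..b}" for \<tau>
    by (rule continuous_on_compose2[OF V_cont \<gamma>c[OF that]]) simp
  have P\<gamma>: "continuous_on K (\<lambda>x. P i (\<gamma> \<tau> x))" if "\<tau> \<in> {a..b}" for \<tau> i
    by (rule continuous_on_compose2[OF P \<gamma>c[OF that]]) simp
  define q where "q x = V (\<gamma> s x) - V (\<gamma> t x)" for x
  have q: "continuous_on K q" unfolding q_def[abs_def] by (intro continuous_intros V\<gamma> st)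
  \<comment> \<open>By the chain rule \<open>D \<tau>\<close> is the time derivative of
    \<open>V\<close> along the trajectories.\<close>
  define D where "D \<tau> x = (\<Sum>i\<in>UNIV. v \<tau> x $ i * P i (\<gamma> \<tau> x))" for \<tau> x
  have D: "continuous_on K (D \<tau>)" if "\<tau> \<in> {a..b}" for \<tau>
    unfolding D_def[abs_def] by (intro continuous_intros P\<gamma> vc that)
  \<comment> \<open>The increment of \<open>k\<close> from \<open>t\<close> to \<open>s\<close> is
    the integral \<open>I\<close> of the square of \<open>q\<close>, while its derivative is at most
    \<open>W * sqrt J * sqrt I\<close>.\<close>
  define k where "k \<tau> = (\<integral>x. V (\<gamma> \<tau> x) * q x \<partial>N)" for \<tau>
  have \<gamma>L: "norm (\<gamma> \<sigma> x - \<gamma> \<tau> x) \<le> W * norm (\<sigma> - \<tau>)" if "x \<in> K" "\<sigma> \<in> {a..b}" "\<tau> \<in> {a..b}" for x \<sigma> \<tau>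
  proof (rule differentiable_bound[of "{a..b}" "\<lambda>\<sigma>. \<gamma> \<sigma> x" "\<lambda>\<tau> h. h *\<^sub>R v \<tau> x"])
    fix r assume r: "r \<in> {a..b}"
    show "((\<lambda>\<sigma>. \<gamma> \<sigma> x) has_derivative (\<lambda>h. h *\<^sub>R v r x)) (at r within {a..b})"
      using der[OF that(1) r] by (simp add: has_vector_derivative_def)
    show "onorm (\<lambda>h. h *\<^sub>R v r x) \<le> W"
      by (rule onorm_le) (use mult_left_mono[OF vb[OF that(1) r] abs_ge_zero] in \<open>auto simp: mult.commute\<close>)
  qed (use that in auto)
  have kder: "(k has_derivative (\<lambda>h. \<integral>x. h * D \<tau> x * q x \<partial>N)) (at \<tau> within {a..b})" if \<tau>: "\<tau> \<in> {a..b}" for \<tau>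
    unfolding k_def[abs_def]
  proof (rule has_derivative_integral_dominated[where G = "\<lambda>x. C * W * \<bar>q x\<bar>", OF \<tau>])
    show "integrable N (\<lambda>x. V (\<gamma> \<sigma> x) * q x)" if "\<sigma> \<in> {a..b}" for \<sigma>
      by (intro intN continuous_intros V\<gamma> q that)
    show "(\<lambda>x. h * D \<tau> x * q x) \<in> borel_measurable N" for h
      by (intro mN continuous_intros D q \<tau>)
    show "integrable N (\<lambda>x. C * W * \<bar>q x\<bar>)"
      by (intro intN continuous_intros q)
  next
    fix x assume "x \<in> space N"
    then have x: "x \<in> K" by (simp add: spN)
    have "((\<lambda>\<sigma>. V (\<gamma> \<sigma> x)) has_derivative (\<lambda>h. \<Sum>i\<in>UNIV. (h *\<^sub>R v \<tau> x) $ i * P i (\<gamma> \<tau> x))) (at \<tau> within {a..b})"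
      by (rule has_derivative_compose[of "\<lambda>\<sigma>. \<gamma> \<sigma> x" "\<lambda>h. h *\<^sub>R v \<tau> x", OF _ V[OF x \<tau>], unfolded o_def])
         (use der[OF x \<tau>] in \<open>simp add: has_vector_derivative_def\<close>)
    also have "(\<lambda>h. \<Sum>i\<in>UNIV. (h *\<^sub>R v \<tau> x) $ i * P i (\<gamma> \<tau> x)) = (\<lambda>h. h * D \<tau> x)"
      by (simp add: D_def sum_distrib_left mult.assoc)
    finally show "((\<lambda>\<sigma>. V (\<gamma> \<sigma> x) * q x) has_derivative (\<lambda>h. h * D \<tau> x * q x)) (at \<tau> within {a..b})"
      by (rule has_derivative_mult_left)
    show "\<bar>V (\<gamma> \<sigma> x) * q x - V (\<gamma> \<tau> x) * q x\<bar> \<le> C * W * \<bar>q x\<bar> * norm (\<sigma> - \<tau>)" if "\<sigma> \<in> {a..b}" for \<sigma>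
    proof -
      have "\<bar>V (\<gamma> \<sigma> x) - V (\<gamma> \<tau> x)\<bar> \<le> C * (W * norm (\<sigma> - \<tau>))"
        using C(1)[of "\<gamma> \<sigma> x" "\<gamma> \<tau> x"] mult_left_mono[OF \<gamma>L[OF x that \<tau>] C(2)] by linarith
      from mult_right_mono[OF this, of "\<bar>q x\<bar>"] show ?thesis
        unfolding left_diff_distrib[symmetric] abs_mult by (simp add: mult_ac)
    qed
    have "\<bar>D \<tau> x\<bar> \<le> C * W"
      using C'[OF x \<tau>, of "v \<tau> x"] mult_left_mono[OF vb[OF x \<tau>] C(2)] unfolding D_def by linarith
    from mult_right_mono[OF this, of "\<bar>q x\<bar> * \<bar>h\<bar>" for h]
    show "\<bar>h * D \<tau> x * q x\<bar> \<le> C * W * \<bar>q x\<bar> * norm h" for h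
      by (simp add: abs_mult mult_ac)
  qed
  define I where "I = (\<integral>x. (q x)\<^sup>2 \<partial>N)"
  have I0: "I \<ge> 0" by (simp add: I_def)
  have "k s - k t = (\<integral>x. V (\<gamma> s x) * q x - V (\<gamma> t x) * q x \<partial>N)"
    unfolding k_def using st
    by (intro Bochner_Integration.integral_diff[symmetric] intN continuous_intros V\<gamma> q)
  also have "\<dots> = I" unfolding I_def
    by (intro Bochner_Integration.integral_cong) (auto simp: q_def power2_eq_square algebra_simps)
  finally have kI: "k s - k t = I" .
  have k'b: "\<bar>\<integral>x. h * D \<tau> x * q x \<partial>N\<bar> \<le> \<bar>h\<bar> * (W * sqrt J * sqrt I)" if \<tau>: "\<tau> \<in> {a..b}" for \<tau> h
  proof -
    have pw: "(D \<tau> x)\<^sup>2 \<le> W\<^sup>2 * (\<Sum>i\<in>UNIV. (P i (\<gamma> \<tau> x))\<^sup>2)" if "x \<in> K" for x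
    proof -
      have "(D \<tau> x)\<^sup>2 \<le> (\<Sum>i\<in>UNIV. (v \<tau> x $ i)\<^sup>2) * (\<Sum>i\<in>UNIV. (P i (\<gamma> \<tau> x))\<^sup>2)"
        unfolding D_def by (rule Cauchy_Schwarz_ineq_sum)
      also have "(\<Sum>i\<in>UNIV. (v \<tau> x $ i)\<^sup>2) = (norm (v \<tau> x))\<^sup>2"
        by (simp add: norm_vec_def L2_set_def sum_nonneg)
      also have "(norm (v \<tau> x))\<^sup>2 * (\<Sum>i\<in>UNIV. (P i (\<gamma> \<tau> x))\<^sup>2) \<le> W\<^sup>2 * (\<Sum>i\<in>UNIV. (P i (\<gamma> \<tau> x))\<^sup>2)"
        using vb[OF \<open>x \<in> K\<close> \<tau>] by (intro mult_right_mono power_mono sum_nonneg) auto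
      finally show ?thesis .
    qed
    have "(\<integral>x. (D \<tau> x)\<^sup>2 \<partial>N) \<le> (\<integral>x. W\<^sup>2 * (\<Sum>i\<in>UNIV. (P i (\<gamma> \<tau> x))\<^sup>2) \<partial>N)"
    proof (rule integral_mono)
      show "integrable N (\<lambda>x. (D \<tau> x)\<^sup>2)" by (intro intN continuous_intros D \<tau>)
      show "integrable N (\<lambda>x. W\<^sup>2 * (\<Sum>i\<in>UNIV. (P i (\<gamma> \<tau> x))\<^sup>2))"
        by (intro intN continuous_intros P\<gamma> \<tau>)
    qed (use pw spN in simp)
    also have "\<dots> = W\<^sup>2 * (\<integral>x. (\<Sum>i\<in>UNIV. (P i (\<gamma> \<tau> x))\<^sup>2) \<partial>N)" by simp
    also have "\<dots> \<le> W\<^sup>2 * J" using J[OF \<tau>] by (intro mult_left_mono) (auto simp: N_def)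
    finally have DJ: "sqrt (\<integral>x. (D \<tau> x)\<^sup>2 \<partial>N) \<le> W * sqrt J"
      using W real_sqrt_le_mono by (fastforce simp: real_sqrt_mult)
    have "\<bar>\<integral>x. D \<tau> x * q x \<partial>N\<bar> \<le> sqrt (\<integral>x. (D \<tau> x)\<^sup>2 \<partial>N) * sqrt (\<integral>x. (q x)\<^sup>2 \<partial>N)"
      by (rule Cauchy_Schwarz_integral) (auto intro!: intN mN continuous_intros D q \<tau>)
    also have "\<dots> \<le> W * sqrt J * sqrt I"
      unfolding I_def[symmetric] using DJ I0 by (intro mult_right_mono) auto
    finally have "\<bar>h\<bar> * \<bar>\<integral>x. D \<tau> x * q x \<partial>N\<bar> \<le> \<bar>h\<bar> * (W * sqrt J * sqrt I)"
      by (intro mult_left_mono) auto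
    then show ?thesis by (simp add: mult.assoc abs_mult)
  qed
  have I_le: "I \<le> \<bar>s - t\<bar> * (W * sqrt J * sqrt I)"
  proof -
    \<comment> \<open>The mean value theorem needs increasing endpoints; the order of
      \<open>s\<close> and \<open>t\<close> is settled afterwards.\<close>
    have *: "\<bar>k r' - k r\<bar> \<le> \<bar>r' - r\<bar> * (W * sqrt J * sqrt I)" if "r < r'" "{r..r'} \<subseteq> {a..b}" for r r'
    proof -
      have "\<exists>x\<in>{r<..<r'}. k r' - k r = (\<integral>y. (r' - r) * D x y * q y \<partial>N)"
      proof (rule mvt_simple[OF that(1)])
        fix x assume "r \<le> x" "x \<le> r'"
        then have "x \<in> {a..b}" using that(2) by auto
        from has_derivative_subset[OF kder[OF this] that(2)]
        show "(k has_derivative (\<lambda>h. \<integral>y. h * D x y * q y \<partial>N)) (at x within {r..r'})" .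
      qed
      then obtain x where x: "x \<in> {r<..<r'}" "k r' - k r = (\<integral>y. (r' - r) * D x y * q y \<partial>N)" by blast
      then have "x \<in> {a..b}" using that(2) by auto
      from k'b[OF this, of "r' - r"] show ?thesis unfolding x(2) .
    qed
    show ?thesis
    proof (cases "s < t")
      case True
      from *[OF this] st kI show ?thesis using I0 by (auto simp: abs_minus_commute)
    next
      case False
      then have "t < s" using neq by simp
      from *[OF this] st kI show ?thesis using I0 by auto
    qed
  qed
  show ?thesis
  proof (cases "I = 0")
    case True
    have "J \<ge> 0" by (rule order_trans[OF _ J[OF st(1)]]) (auto intro!: integral_nonneg_AE sum_nonneg)
    then show ?thesis using True by (simp add: I_def q_def N_def)
  next
    case False
    then have Ip: "sqrt I > 0" using I0 by simp
    have J0: "J \<ge> 0" by (rule order_trans[OF _ J[OF st(1)]]) (auto intro!: integral_nonneg_AE sum_nonneg)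
    \<comment> \<open>Cancelling one factor \<open>sqrt I\<close> leaves a bound linear in
      \<open>\<bar>s - t\<bar>\<close>, whose square is the claim.\<close>
    have "sqrt I * sqrt I \<le> (\<bar>s - t\<bar> * W * sqrt J) * sqrt I"
      using I_le I0 by (simp add: mult_ac)
    then have "sqrt I \<le> \<bar>s - t\<bar> * W * sqrt J" using Ip by (rule mult_right_le_imp_le)
    then have "(sqrt I)\<^sup>2 \<le> (\<bar>s - t\<bar> * W * sqrt J)\<^sup>2" using Ip by (intro power_mono) auto
    then show ?thesis using I0 J0 by (simp add: power_mult_distrib I_def q_def N_def)
  qed
qed

text \<open>Mollifications of the representative converge almost everywhere in space along a
  subsequence, but convergence is needed along trajectories: since \<open>\<gamma> \<tau>\<close>
  shrinks distances at most by the factor \<open>M\<close>, it pulls null sets back to null sets.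
  Fatou's lemma then preserves the bound in the limit.\<close>

lemma square_difference_along_flow_compact:
  fixes \<gamma> v :: "real \<Rightarrow> real^'d::finite \<Rightarrow> real^'d" and f :: "real^'d \<Rightarrow> real"
  assumes B: "open B" and U: "U \<in> sobolev 1 B"
    and f: "f \<in> borel_measurable borel" "AE x in lborel. (if x \<in> B then U x else 0) = f x"
      "integrable lborel (\<lambda>x. (f x)\<^sup>2)"
    and K: "compact K" and st: "s \<in> {a..b}" "t \<in> {a..b}"
    and der: "\<And>x \<tau>. x \<in> K \<Longrightarrow> \<tau> \<in> {a..b} \<Longrightarrow> ((\<lambda>\<sigma>. \<gamma> \<sigma> x) has_vector_derivative v \<tau> x) (at \<tau> within {a..b})"
    and vb: "\<And>x \<tau>. x \<in> K \<Longrightarrow> \<tau> \<in> {a..b} \<Longrightarrow> norm (v \<tau> x) \<le> W"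
    and vc: "\<And>\<tau>. \<tau> \<in> {a..b} \<Longrightarrow> continuous_on K (v \<tau>)"
    and \<gamma>c: "continuous_on ({a..b} \<times> K) (\<lambda>(\<tau>, x). \<gamma> \<tau> x)"
    and \<gamma>B: "\<And>x \<tau>. x \<in> K \<Longrightarrow> \<tau> \<in> {a..b} \<Longrightarrow> \<gamma> \<tau> x \<in> B"
    and M: "M \<ge> 0" and ex: "\<And>x y \<tau>. x \<in> K \<Longrightarrow> y \<in> K \<Longrightarrow> \<tau> \<in> {a..b} \<Longrightarrow>
      norm (x - y) \<le> M * norm (\<gamma> \<tau> x - \<gamma> \<tau> y)"
  shows "(\<integral>\<^sup>+x. ennreal ((f (\<gamma> s x) - f (\<gamma> t x))\<^sup>2) \<partial>restrict_space lborel K)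
    \<le> ennreal (\<bar>s - t\<bar>\<^sup>2 * W\<^sup>2 * (M ^ CARD('d) * (L2_norm B (weak_grad B U))\<^sup>2))"
proof -
  define N where "N = restrict_space lborel K"
  define J where "J = M ^ CARD('d) * (L2_norm B (weak_grad B U))\<^sup>2"
  have J0: "J \<ge> 0" using M by (simp add: J_def)
  have Bb: "B \<in> sets borel" using B by simp
  have c1: "continuous_on K (\<gamma> \<tau>)" if "\<tau> \<in> {a..b}" for \<tau>
  proof -
    have "continuous_on K (\<lambda>x. (\<tau>, x))"
      by (intro continuous_on_Pair continuous_on_const continuous_on_id)
    from continuous_on_compose2[OF \<gamma>c this] that show ?thesis by (simp add: image_subset_iff)
  qed
  \<comment> \<open>All positions reached from \<open>K\<close> during the time interval.
    Compactness yields one mollification radius \<open>e\<close> that stays inside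
    \<open>B\<close>.\<close>
  define K' where "K' = (\<lambda>(\<tau>, x). \<gamma> \<tau> x) ` ({a..b} \<times> K)"
  have cK': "compact K'" unfolding K'_def
    by (intro compact_continuous_image[OF \<gamma>c] compact_Times K compact_Icc)
  have K'B: "K' \<subseteq> B" using \<gamma>B by (auto simp: K'_def)
  have inK': "\<gamma> \<tau> x \<in> K'" if "x \<in> K" "\<tau> \<in> {a..b}" for \<tau> x
    using that by (force simp: K'_def)
  obtain e where e: "e > 0" "(\<Union>x\<in>K'. cball x e) \<subseteq> B"
    using compact_subset_open_imp_cball_epsilon_subset[OF cK' B K'B] by blast
  define A where "A = (\<Union>x\<in>K'. cball x e)"
  have cA: "compact A" unfolding A_def using cK' by (rule compact_minkowski_sum_cball)
  have A: "A \<subseteq> B" "bounded A" and Ab[measurable]: "A \<in> sets borel"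
    using e(2) compact_imp_bounded[OF cA] borel_compact[OF cA] by (simp_all add: A_def)
  have cbA: "cball y e \<subseteq> A" if "y \<in> K'" for y unfolding A_def using that by (rule UN_upper)
  have K'A: "K' \<subseteq> A" using cbA e(1) by force
  note [measurable] = f(1)
  \<comment> \<open>Cutting off to the bounded set \<open>A\<close> makes the representative
    integrable without changing it within distance \<open>e\<close> of the trajectories.\<close>
  define fA where "fA x = indicator A x * f x" for x
  have fA: "fA \<in> borel_measurable borel" unfolding fA_def[abs_def] by measurable
  note [measurable] = fA
  have fA0: "fA x = 0" if "x \<notin> A" for x using that by (simp add: fA_def)
  have fAae: "AE x in lborel. (if x \<in> A then U x else 0) = fA x"
    using f(2) by eventually_elim (use A(1) in \<open>auto simp: fA_def indicator_def split: if_splits\<close>)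
  have "integrable lborel (\<lambda>x. (fA x)\<^sup>2)"
    by (rule Bochner_Integration.integrable_bound[OF f(3)]) (auto simp: fA_def indicator_def)
  then have fAi: "integrable lborel fA"
    by (rule integrable_of_square_integrable[OF fA _ A(2)]) (rule fA0)
  define rep where "rep i G \<longleftrightarrow> G \<in> borel_measurable borel \<and> (\<forall>x. x \<notin> A \<longrightarrow> G x = 0) \<and>
      (AE x in lborel. (if x \<in> A then weak_partials B [i] U x else 0) = G x) \<and> integrable lborel G \<and>
      (\<integral>\<^sup>+x. ennreal ((G x)\<^sup>2) \<partial>lborel) \<le> ennreal ((L2_norm B (weak_partials B [i] U))\<^sup>2)" for i G
  have "\<exists>G. rep i G" for i
  proof -
    note sub = L2_space_subset[OF weak_partials_single(1)[OF U, of i] _ _ A(1)]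
    have "weak_partials B [i] U \<in> L2_space A" using sub(1) Bb Ab by simp
    then obtain G where G: "G \<in> borel_measurable borel" "\<And>x. x \<notin> A \<Longrightarrow> G x = 0"
        "AE x in lborel. (if x \<in> A then weak_partials B [i] U x else 0) = G x" "integrable lborel (\<lambda>x. (G x)\<^sup>2)"
        "(\<integral>\<^sup>+x. ennreal ((G x)\<^sup>2) \<partial>lborel) = ennreal ((L2_norm A (weak_partials B [i] U))\<^sup>2)"
      by (rule L2_representative[OF Ab]) blast
    have "(L2_norm A (weak_partials B [i] U))\<^sup>2 \<le> (L2_norm B (weak_partials B [i] U))\<^sup>2"
      using sub(2) Bb Ab L2_norm_nonneg by (intro power_mono) auto
    moreover have "integrable lborel G"
      by (rule integrable_of_square_integrable[OF G(1,4) A(2)]) (rule G(2))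
    ultimately show ?thesis using G unfolding rep_def by (intro exI[of _ G]) (auto intro!: ennreal_leI)
  qed
  then obtain G where rep: "\<And>i. rep i (G i)" by metis
  have G: "G i \<in> borel_measurable borel" "x \<notin> A \<Longrightarrow> G i x = 0"
      "AE x in lborel. (if x \<in> A then weak_partials B [i] U x else 0) = G i x" "integrable lborel (G i)"
      "(\<integral>\<^sup>+x. ennreal ((G i x)\<^sup>2) \<partial>lborel) \<le> ennreal ((L2_norm B (weak_partials B [i] U))\<^sup>2)" for i x
    using rep[of i] unfolding rep_def by blast+
  have mN: "h \<in> borel_measurable N" if "continuous_on K h" for h :: "real^'d \<Rightarrow> real"
    unfolding N_def by (rule measurable_continuous_on_compact[OF that])
  have smooth: "(\<integral>\<^sup>+x. ennreal ((convol fA \<rho> (\<gamma> s x) - convol fA \<rho> (\<gamma> t x))\<^sup>2) \<partial>N) \<le> ennreal (\<bar>s - t\<bar>\<^sup>2 * W\<^sup>2 * J)"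
    if m: "mollifier e' \<rho>" and e': "e' \<le> e" for e' \<rho>
  proof -
    define V where "V = convol fA \<rho>"
    define P where "P i = convol (G i) \<rho>" for i
    define V' where "V' x h = (\<integral>z. fA z * frechet_derivative \<rho> (at (x - z)) h \<partial>lborel)" for x h
    have Vder: "(V has_derivative V' x) (at x)" for x
      unfolding V_def V'_def[abs_def] by (rule convol_has_derivative[OF m fAi])
    \<comment> \<open>On \<open>K'\<close> the derivative of the mollified function is the mollified
      weak gradient, because the kernels centred there do not reach beyond \<open>A\<close>.\<close>
    have V'P: "V' y h = (\<Sum>i\<in>UNIV. h $ i * P i y)" if y: "y \<in> K'" for y h
    proof -
      have lin: "linear (V' y)" using Vder has_derivative_linear by blast
      have ax: "V' y (axis i 1) = P i y" for i
        unfolding V'_def P_def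
      proof (rule has_weak_partials_convol[OF B sobolev_L2[OF U] weak_partials_single[OF U] A(1) _ m fA fA0 fAae G(1-3)])
        show "cball y e' \<subseteq> A" using cbA[OF y] subset_cball[OF e', of y] by blast
      qed
      have "V' y h = V' y (\<Sum>i\<in>UNIV. h $ i *\<^sub>R axis i 1)"
        using basis_expansion[of h] by (simp add: scalar_mult_eq_scaleR)
      also have "\<dots> = (\<Sum>i\<in>UNIV. h $ i * V' y (axis i 1))"
        by (simp add: linear_sum[OF lin] linear_cmul[OF lin])
      finally show ?thesis by (simp add: ax)
    qed
    obtain C where C: "C \<ge> 0" "\<And>x y. \<bar>V x - V y\<bar> \<le> C * norm (x - y)" "\<And>x h. \<bar>V' x h\<bar> \<le> C * norm h"
      unfolding V_def V'_def by (rule convol_lipschitz[OF m fAi]) blast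
    have Pc: "continuous_on UNIV (P i)" for i
      unfolding P_def by (rule convol_continuous[OF m G(4)])
    have Pm[measurable]: "P i \<in> borel_measurable borel" for i
      unfolding P_def by (rule convol_measurable[OF m G(4)])
    have P\<gamma>: "continuous_on K (\<lambda>x. P i (\<gamma> \<tau> x))" if "\<tau> \<in> {a..b}" for \<tau> i
      by (rule continuous_on_compose2[OF Pc c1[OF that]]) simp
    have V\<gamma>: "continuous_on K (\<lambda>x. V (\<gamma> \<tau> x))" if "\<tau> \<in> {a..b}" for \<tau>
      unfolding V_def by (rule continuous_on_compose2[OF convol_continuous[OF m fAi] c1[OF that]]) simp
    \<comment> \<open>Pulling back along the flow costs \<open>M ^ CARD('d)\<close>, and
      mollification does not increase \<open>L2\<close> norms.\<close>
    have JJ: "(\<integral>x. (\<Sum>i\<in>UNIV. (P i (\<gamma> \<tau> x))\<^sup>2) \<partial>N) \<le> J" if \<tau>: "\<tau> \<in> {a..b}" for \<tau>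
    proof -
      have i: "integrable N (\<lambda>x. \<Sum>i\<in>UNIV. (P i (\<gamma> \<tau> x))\<^sup>2)"
        unfolding N_def by (intro integrable_continuous_on_compact[OF K] continuous_intros P\<gamma> \<tau>)
      have "ennreal (\<integral>x. (\<Sum>i\<in>UNIV. (P i (\<gamma> \<tau> x))\<^sup>2) \<partial>N) = (\<integral>\<^sup>+x. ennreal (\<Sum>i\<in>UNIV. (P i (\<gamma> \<tau> x))\<^sup>2) \<partial>N)"
        by (rule nn_integral_eq_integral[symmetric, OF i]) (auto intro!: sum_nonneg)
      also have "\<dots> \<le> ennreal (M ^ CARD('d)) * (\<integral>\<^sup>+y. ennreal (\<Sum>i\<in>UNIV. (P i y)\<^sup>2) \<partial>lborel)"
        using nn_integral_pullback_le[OF K c1[OF \<tau>] M ex[OF _ _ \<tau>], of "\<lambda>y. ennreal (\<Sum>i\<in>UNIV. (P i y)\<^sup>2)"]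
        by (simp add: N_def)
      also have "\<dots> \<le> ennreal (M ^ CARD('d)) * ennreal ((L2_norm B (weak_grad B U))\<^sup>2)"
      proof (rule mult_left_mono)
        have "(\<integral>\<^sup>+y. ennreal (\<Sum>i\<in>UNIV. (P i y)\<^sup>2) \<partial>lborel) = (\<Sum>i\<in>UNIV. \<integral>\<^sup>+y. ennreal ((P i y)\<^sup>2) \<partial>lborel)"
          by (subst nn_integral_sum[symmetric]) (auto simp: sum_ennreal)
        also have "\<dots> \<le> (\<Sum>i\<in>UNIV. ennreal ((L2_norm B (weak_partials B [i] U))\<^sup>2))"
          unfolding P_def
          by (intro sum_mono order_trans[OF nn_integral_convol_square_le[OF m G(4)] G(5)])
        also have "\<dots> = ennreal ((L2_norm B (weak_grad B U))\<^sup>2)"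
          unfolding weak_grad_L2_norm_square(2)[OF U] by (rule sum_ennreal) simp
        finally show "(\<integral>\<^sup>+y. ennreal (\<Sum>i\<in>UNIV. (P i y)\<^sup>2) \<partial>lborel) \<le> ennreal ((L2_norm B (weak_grad B U))\<^sup>2)" .
      qed simp
      also have "\<dots> = ennreal J"
        unfolding J_def using M by (simp add: ennreal_mult)
      finally show ?thesis using J0 by simp
    qed
    have main: "(\<integral>x. (V (\<gamma> s x) - V (\<gamma> t x))\<^sup>2 \<partial>N) \<le> \<bar>s - t\<bar>\<^sup>2 * W\<^sup>2 * J"
      unfolding N_def
    proof (rule square_difference_along_flow_smooth[OF K st der vb vc c1 _ C(2,1) _ Pc])
      fix x \<tau> assume x: "x \<in> K" "\<tau> \<in> {a..b}"
      show "(V has_derivative (\<lambda>h. \<Sum>i\<in>UNIV. h $ i * P i (\<gamma> \<tau> x))) (at (\<gamma> \<tau> x))"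
        using Vder[of "\<gamma> \<tau> x"] V'P[OF inK'[OF x]] by (metis (no_types, lifting) ext)
      show "\<bar>\<Sum>i\<in>UNIV. h $ i * P i (\<gamma> \<tau> x)\<bar> \<le> C * norm h" for h
        using C(3)[of "\<gamma> \<tau> x" h] V'P[OF inK'[OF x]] by simp
    qed (use JJ in \<open>auto simp: N_def\<close>)
    have "integrable N (\<lambda>x. (V (\<gamma> s x) - V (\<gamma> t x))\<^sup>2)"
      unfolding N_def by (intro integrable_continuous_on_compact[OF K] continuous_intros V\<gamma> st)
    then have "(\<integral>\<^sup>+x. ennreal ((V (\<gamma> s x) - V (\<gamma> t x))\<^sup>2) \<partial>N) = ennreal (\<integral>x. (V (\<gamma> s x) - V (\<gamma> t x))\<^sup>2 \<partial>N)"
      by (rule nn_integral_eq_integral) simp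
    also have "\<dots> \<le> ennreal (\<bar>s - t\<bar>\<^sup>2 * W\<^sup>2 * J)" by (rule ennreal_leI[OF main])
    finally show ?thesis by (simp add: V_def)
  qed
  have "\<exists>\<rho>. (\<exists>e'\<le>e. mollifier e' \<rho>) \<and> L1_dist (convol fA \<rho>) fA \<le> ennreal (inverse (real (Suc n)))" for n
  proof -
    have pos: "inverse (real (Suc n)) > 0" by simp
    obtain e0 where e0: "e0 > 0" "\<And>e' \<rho>. e' \<le> e0 \<Longrightarrow> mollifier e' \<rho> \<Longrightarrow>
        L1_dist (convol fA \<rho>) fA \<le> ennreal (inverse (real (Suc n)))"
      by (rule convol_L1_close[OF fAi pos]) blast
    have "min e e0 > 0" using e(1) e0(1) by simp
    then obtain \<rho> :: "real^'d \<Rightarrow> real" where \<rho>: "mollifier (min e e0) \<rho>" by (rule mollifier_exists)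
    have "min e e0 \<le> e" "min e e0 \<le> e0" by auto
    then show ?thesis using \<rho> e0(2) by blast
  qed
  then obtain \<rho> where \<rho>: "\<And>n. \<exists>e'\<le>e. mollifier e' (\<rho> n)"
      "\<And>n. L1_dist (convol fA (\<rho> n)) fA \<le> ennreal (inverse (real (Suc n)))" by metis
  have Vm[measurable]: "convol fA (\<rho> n) \<in> borel_measurable borel" for n
    using \<rho>(1)[of n] convol_measurable[OF _ fAi] by blast
  have Vi: "integrable lborel (\<lambda>x. convol fA (\<rho> n) x - fA x)" for n
    by (rule integrableI_bounded) (use le_less_trans[OF \<rho>(2)[of n]] in auto)
  have "(\<lambda>n. \<integral>x. norm (convol fA (\<rho> n) x - fA x) \<partial>lborel) \<longlonglongrightarrow> 0"
  proof (rule tendsto_sandwich[of "\<lambda>n. 0" _ _ "\<lambda>n. inverse (real (Suc n))"])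
    have "(\<integral>x. norm (convol fA (\<rho> n) x - fA x) \<partial>lborel) \<le> inverse (real (Suc n))" for n
    proof -
      have "ennreal (\<integral>x. norm (convol fA (\<rho> n) x - fA x) \<partial>lborel) = (\<integral>\<^sup>+x. ennreal (norm (convol fA (\<rho> n) x - fA x)) \<partial>lborel)"
        by (rule nn_integral_eq_integral[symmetric]) (use Vi in auto)
      also have "\<dots> \<le> ennreal (inverse (real (Suc n)))" using \<rho>(2)[of n] by simp
      finally show ?thesis by simp
    qed
    then show "\<forall>\<^sub>F n in sequentially. (\<integral>x. norm (convol fA (\<rho> n) x - fA x) \<partial>lborel) \<le> inverse (real (Suc n))"
      by simp
    show "(\<lambda>n. inverse (real (Suc n))) \<longlonglongrightarrow> 0" by (rule LIMSEQ_inverse_real_of_nat)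
  qed auto
  from tendsto_L1_AE_subseq[OF Vi this] obtain r :: "nat \<Rightarrow> nat"
    where r: "AE x in lborel. (\<lambda>n. convol fA (\<rho> (r n)) x - fA x) \<longlonglongrightarrow> 0" by blast
  then obtain Z where Z: "Z \<in> null_sets lborel" "\<And>x. x \<notin> Z \<Longrightarrow> (\<lambda>n. convol fA (\<rho> (r n)) x - fA x) \<longlonglongrightarrow> 0"
    by (auto elim!: AE_E3)
  have Zb[measurable]: "Z \<in> sets borel" using Z(1) by auto
  have ae: "AE x in N. \<gamma> \<tau> x \<notin> Z" if \<tau>: "\<tau> \<in> {a..b}" for \<tau>
  proof -
    have [measurable]: "\<gamma> \<tau> \<in> measurable N borel"
      unfolding N_def by (rule measurable_continuous_on_compact[OF c1[OF \<tau>]])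
    have "(\<integral>\<^sup>+x. indicator Z (\<gamma> \<tau> x) \<partial>N) \<le> ennreal (M ^ CARD('d)) * (\<integral>\<^sup>+x. indicator Z x \<partial>lborel)"
      using nn_integral_pullback_le[OF K c1[OF \<tau>] M ex[OF _ _ \<tau>], of "indicator Z"] by (simp add: N_def)
    also have "\<dots> = 0" using Z(1) by (simp add: null_setsD1)
    finally have "(\<integral>\<^sup>+x. indicator Z (\<gamma> \<tau> x) \<partial>N) = 0" by simp
    then have "AE x in N. (indicator Z (\<gamma> \<tau> x) :: ennreal) = 0"
      by (subst (asm) nn_integral_0_iff_AE) auto
    then show ?thesis by eventually_elim (auto simp: indicator_def)
  qed
  have [measurable]: "\<gamma> s \<in> measurable N borel" "\<gamma> t \<in> measurable N borel"
    unfolding N_def by (rule measurable_continuous_on_compact[OF c1[OF st(1)]], rule measurable_continuous_on_compact[OF c1[OF st(2)]])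
  define Q where "Q n x = ennreal ((convol fA (\<rho> (r n)) (\<gamma> s x) - convol fA (\<rho> (r n)) (\<gamma> t x))\<^sup>2)" for n x
  have "(\<integral>\<^sup>+x. ennreal ((f (\<gamma> s x) - f (\<gamma> t x))\<^sup>2) \<partial>N) = (\<integral>\<^sup>+x. ennreal ((fA (\<gamma> s x) - fA (\<gamma> t x))\<^sup>2) \<partial>N)"
  proof (rule nn_integral_cong)
    fix x assume "x \<in> space N"
    then have "x \<in> K" by (simp add: N_def space_restrict_space)
    then have "\<gamma> s x \<in> A" "\<gamma> t x \<in> A" using inK' K'A st by blast+
    then show "ennreal ((f (\<gamma> s x) - f (\<gamma> t x))\<^sup>2) = ennreal ((fA (\<gamma> s x) - fA (\<gamma> t x))\<^sup>2)"
      by (simp add: fA_def)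
  qed
  \<comment> \<open>Along the subsequence the limit exists at almost every point, so it can be
    written as the lower limit to which Fatou's lemma applies.\<close>
  also have "\<dots> = (\<integral>\<^sup>+x. liminf (\<lambda>n. Q n x) \<partial>N)"
  proof (rule nn_integral_cong_AE)
    show "AE x in N. ennreal ((fA (\<gamma> s x) - fA (\<gamma> t x))\<^sup>2) = liminf (\<lambda>n. Q n x)"
      using ae[OF st(1)] ae[OF st(2)]
    proof eventually_elim
      case (elim x)
      have "(\<lambda>n. convol fA (\<rho> (r n)) (\<gamma> s x)) \<longlonglongrightarrow> fA (\<gamma> s x)" "(\<lambda>n. convol fA (\<rho> (r n)) (\<gamma> t x)) \<longlonglongrightarrow> fA (\<gamma> t x)"
        using Z(2)[OF elim(1)] Z(2)[OF elim(2)] by (auto simp: LIM_zero_iff)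
      then have "(\<lambda>n. Q n x) \<longlonglongrightarrow> ennreal ((fA (\<gamma> s x) - fA (\<gamma> t x))\<^sup>2)"
        unfolding Q_def by (intro tendsto_ennrealI tendsto_intros)
      then show ?case by (intro lim_imp_Liminf[symmetric]) auto
    qed
  qed
  also have "\<dots> \<le> liminf (\<lambda>n. \<integral>\<^sup>+x. Q n x \<partial>N)"
    by (rule nn_integral_liminf) (simp add: Q_def)
  also have "\<dots> \<le> ennreal (\<bar>s - t\<bar>\<^sup>2 * W\<^sup>2 * J)"
  proof -
    have "(\<integral>\<^sup>+x. Q n x \<partial>N) \<le> ennreal (\<bar>s - t\<bar>\<^sup>2 * W\<^sup>2 * J)" for n
      using \<rho>(1)[of "r n"] smooth unfolding Q_def by blast
    then show ?thesis
      by (intro Liminf_le) (auto intro!: always_eventually)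
  qed
  finally show ?thesis by (simp add: N_def J_def)
qed

text \<open>The bound on compact subsets does not depend on the subset, so it passes to an
  increasing exhaustion of \<open>S\<close> by monotone convergence. On \<open>S\<close> itself the
  trajectories may approach the boundary of \<open>B\<close>, where a uniform mollification radius
  may fail to exist.\<close>

lemma square_difference_along_flow:
  fixes \<gamma> v :: "real \<Rightarrow> real^'d::finite \<Rightarrow> real^'d" and f :: "real^'d \<Rightarrow> real"
  assumes B: "open B" and U: "U \<in> sobolev 1 B"
    and f: "f \<in> borel_measurable borel" "AE x in lborel. (if x \<in> B then U x else 0) = f x"
      "integrable lborel (\<lambda>x. (f x)\<^sup>2)"
    and S: "open S" and st: "s \<in> {a..b}" "t \<in> {a..b}"
    and der: "\<And>x \<tau>. x \<in> S \<Longrightarrow> \<tau> \<in> {a..b} \<Longrightarrow> ((\<lambda>\<sigma>. \<gamma> \<sigma> x) has_vector_derivative v \<tau> x) (at \<tau> within {a..b})"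
    and vb: "\<And>x \<tau>. x \<in> S \<Longrightarrow> \<tau> \<in> {a..b} \<Longrightarrow> norm (v \<tau> x) \<le> W"
    and vc: "\<And>\<tau>. \<tau> \<in> {a..b} \<Longrightarrow> continuous_on S (v \<tau>)"
    and \<gamma>c: "continuous_on ({a..b} \<times> S) (\<lambda>(\<tau>, x). \<gamma> \<tau> x)"
    and \<gamma>B: "\<And>x \<tau>. x \<in> S \<Longrightarrow> \<tau> \<in> {a..b} \<Longrightarrow> \<gamma> \<tau> x \<in> B"
    and M: "M \<ge> 0" and ex: "\<And>x y \<tau>. x \<in> S \<Longrightarrow> y \<in> S \<Longrightarrow> \<tau> \<in> {a..b} \<Longrightarrow>
      norm (x - y) \<le> M * norm (\<gamma> \<tau> x - \<gamma> \<tau> y)"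
  shows "(\<integral>\<^sup>+x. ennreal ((f (\<gamma> s x) - f (\<gamma> t x))\<^sup>2) \<partial>restrict_space lborel S)
    \<le> ennreal (\<bar>s - t\<bar>\<^sup>2 * W\<^sup>2 * (M ^ CARD('d) * (L2_norm B (weak_grad B U))\<^sup>2))"
    (is "_ \<le> ?R")
proof -
  define h where "h x = ennreal ((f (\<gamma> s x) - f (\<gamma> t x))\<^sup>2)" for x
  note [measurable] = f(1)
  have Sb[measurable]: "S \<in> sets borel" using S by simp
  have "continuous_on S (\<gamma> \<tau>)" if "\<tau> \<in> {a..b}" for \<tau>
  proof -
    have "continuous_on S (\<lambda>x. (\<tau>, x))"
      by (intro continuous_on_Pair continuous_on_const continuous_on_id)
    from continuous_on_compose2[OF \<gamma>c this] that show ?thesis by (simp add: image_subset_iff)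
  qed
  then have [measurable]: "\<gamma> s \<in> measurable (restrict_space lborel S) borel" "\<gamma> t \<in> measurable (restrict_space lborel S) borel"
    using st by (auto intro: measurable_continuous_on_compact)
  have hm: "h \<in> borel_measurable (restrict_space lborel S)" unfolding h_def[abs_def] by measurable
  have hS: "(\<lambda>x. h x * indicator S x) \<in> borel_measurable lborel"
    using hm by (subst (asm) borel_measurable_restrict_space_iff_ennreal) auto
  obtain F where F: "\<And>n::nat. compact (F n)" "\<And>n. F n \<subseteq> S" "\<And>n. F n \<subseteq> interior (F (Suc n))" "(\<Union>n. F n) = S"
    by (rule open_Union_compact_subsets[OF S]) blast
  have Fb[measurable]: "F n \<in> sets borel" for n using F(1) by (rule borel_compact)
  have inc: "incseq F"
    using F(3) interior_subset by (intro incseq_SucI) blast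
  \<comment> \<open>\<open>h\<close> is known to be measurable on \<open>S\<close> only; this
    identity transfers measurability to the restrictions to \<open>F n\<close>.\<close>
  have ind: "h x * indicator S x * indicator (F n) x = h x * indicator (F n) x" for n x
    using F(2)[of n] by (auto simp: indicator_def)
  have "(\<integral>\<^sup>+x. h x \<partial>restrict_space lborel S) = (\<integral>\<^sup>+x. h x * indicator S x \<partial>lborel)"
    by (simp add: nn_integral_restrict_space)
  also have "\<dots> = (\<integral>\<^sup>+x. (SUP n. h x * indicator (F n) x) \<partial>lborel)"
  proof (rule nn_integral_cong)
    fix x
    have "(SUP n. h x * indicator (F n) x) = h x * (SUP n. indicator (F n) x)"
      by (rule SUP_mult_left_ennreal[symmetric])
    also have "(SUP n. indicator (F n) x :: ennreal) = indicator S x"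
    proof (cases "x \<in> S")
      case True
      then obtain n where "x \<in> F n" using F(4) by blast
      then have "(1 :: ennreal) \<le> (SUP n. indicator (F n) x)"
        by (intro SUP_upper2[of n]) auto
      moreover have "(SUP n. indicator (F n) x :: ennreal) \<le> 1"
        by (intro SUP_least) (auto simp: indicator_def)
      ultimately have "(SUP n. indicator (F n) x :: ennreal) = 1" by (intro antisym)
      then show ?thesis using True by simp
    next
      case False
      then have "indicator (F n) x = (0 :: ennreal)" for n using F(2)[of n] by (auto simp: indicator_def)
      then show ?thesis using False by simp
    qed
    finally show "h x * indicator S x = (SUP n. h x * indicator (F n) x)" by simp
  qed
  also have "\<dots> = (SUP n. \<integral>\<^sup>+x. h x * indicator (F n) x \<partial>lborel)"
  proof (rule nn_integral_monotone_convergence_SUP)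
    show "incseq (\<lambda>n x. h x * indicator (F n) x)"
      using inc by (auto simp: incseq_def le_fun_def indicator_def)
    show "(\<lambda>x. h x * indicator (F n) x) \<in> borel_measurable lborel" for n
      unfolding ind[symmetric] using hS by measurable
  qed
  also have "\<dots> \<le> ?R"
  proof (rule SUP_least)
    fix n
    have "(\<integral>\<^sup>+x. h x * indicator (F n) x \<partial>lborel) = (\<integral>\<^sup>+x. h x \<partial>restrict_space lborel (F n))"
      using Fb[of n] by (simp add: nn_integral_restrict_space)
    also have "\<dots> \<le> ?R" unfolding h_def
    proof (rule square_difference_along_flow_compact[OF B U f F(1) st _ _ _ _ _ M, where v = v])
      show "continuous_on ({a..b} \<times> F n) (\<lambda>(\<tau>, x). \<gamma> \<tau> x)"
        by (rule continuous_on_subset[OF \<gamma>c]) (use F(2) in auto)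
      show "continuous_on (F n) (v \<tau>)" if "\<tau> \<in> {a..b}" for \<tau>
        by (rule continuous_on_subset[OF vc[OF that] F(2)])
    qed (use F(2)[of n] der vb \<gamma>B ex in blast)+
    finally show "(\<integral>\<^sup>+x. h x * indicator (F n) x \<partial>lborel) \<le> ?R" .
  qed
  finally show ?thesis by (simp add: h_def)
qed

section \<open>Comparison of norms on moving domains\<close>

lemma nn_integral_representative_subset:
  assumes R: "R \<in> sets borel" "R \<subseteq> B" and B: "B \<in> sets borel" and U: "U \<in> L2_space B"
    and f: "f \<in> borel_measurable borel" "AE x in lborel. (if x \<in> B then U x else 0) = f x"
      "integrable lborel (\<lambda>x. (f x)\<^sup>2)"
  shows "(\<integral>\<^sup>+x. ennreal ((f x)\<^sup>2) * indicator R x \<partial>lborel) = ennreal ((L2_norm R U)\<^sup>2)"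
proof -
  note [measurable] = f(1) R(1)
  have UR: "U \<in> L2_space R"
    by (rule L2_space_subset(1)[OF U _ _ R(2)]) (use R B in auto)
  have m: "(\<lambda>x. (U x)\<^sup>2) \<in> borel_measurable (lebesgue_on R)"
    using UR by (auto simp: L2_space_def)
  have "AE x in lborel. (if x \<in> R then (U x)\<^sup>2 else 0) = (f x)\<^sup>2 * indicator R x"
    using f(2) by eventually_elim (use R(2) in \<open>auto simp: indicator_def\<close>)
  note * = integral_lebesgue_on_eq_lborel[OF R(1) m _ this]
  have i: "integrable lborel (\<lambda>x. (f x)\<^sup>2 * indicator R x)"
    by (rule Bochner_Integration.integrable_bound[OF f(3)]) (auto simp: indicator_def)
  have "(\<integral>\<^sup>+x. ennreal ((f x)\<^sup>2) * indicator R x \<partial>lborel) = (\<integral>\<^sup>+x. ennreal ((f x)\<^sup>2 * indicator R x) \<partial>lborel)"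
    by (intro nn_integral_cong) (auto simp: indicator_def)
  also have "\<dots> = ennreal (\<integral>x. (f x)\<^sup>2 * indicator R x \<partial>lborel)"
    by (rule nn_integral_eq_integral[OF i]) (auto simp: indicator_def)
  also have "(\<integral>x. (f x)\<^sup>2 * indicator R x \<partial>lborel) = (L2_norm R U)\<^sup>2"
    using *(1) by (simp add: L2_norm_square)
  finally show ?thesis .
qed

text \<open>This is 1 - x <= exp(-x) multiplied by \<open>exp x\<close>. It makes the deviation of
  the volume factor from 1 linear in the time difference.\<close>

lemma exp_minus_one_le:
  fixes x :: real
  shows "exp x - 1 \<le> x * exp x"
proof -
  have "(1 - x) * exp x \<le> exp (- x) * exp x"
    using exp_ge_add_one_self[of "- x"] by (intro mult_right_mono) auto
  then show ?thesis by (simp add: algebra_simps flip: exp_add)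
qed

text \<open>Splits \<open>p\<^sup>2 - r\<^sup>2\<close> into
  \<open>(p - r) * p + (p - r) * r\<close> and applies Cauchy-Schwarz to both products. Keeping
  \<open>\<delta>\<close> to the first power next to \<open>a + b\<close> is what later yields
  products of function and gradient norms in place of squared gradients.\<close>

lemma square_integral_difference_le:
  fixes p r :: "'z \<Rightarrow> real"
  assumes [measurable]: "p \<in> borel_measurable M" "r \<in> borel_measurable M"
    and p: "(\<integral>\<^sup>+x. ennreal ((p x)\<^sup>2) \<partial>M) \<le> ennreal (a\<^sup>2)" and r: "(\<integral>\<^sup>+x. ennreal ((r x)\<^sup>2) \<partial>M) = ennreal (b\<^sup>2)"
    and d: "(\<integral>\<^sup>+x. ennreal ((p x - r x)\<^sup>2) \<partial>M) \<le> ennreal (\<delta>\<^sup>2)"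
    and nonneg: "a \<ge> 0" "b \<ge> 0" "\<delta> \<ge> 0"
  shows "(\<integral>\<^sup>+x. ennreal ((p x)\<^sup>2) \<partial>M) \<le> ennreal (b\<^sup>2 + \<delta> * (a + b))"
proof -
  have int: "integrable M (\<lambda>x. (g x)\<^sup>2)" "(\<integral>x. (g x)\<^sup>2 \<partial>M) \<le> c\<^sup>2" "sqrt (\<integral>x. (g x)\<^sup>2 \<partial>M) \<le> c"
    if [measurable]: "g \<in> borel_measurable M" and le: "(\<integral>\<^sup>+x. ennreal ((g x)\<^sup>2) \<partial>M) \<le> ennreal (c\<^sup>2)" and c: "c \<ge> 0" for g c
  proof -
    show i: "integrable M (\<lambda>x. (g x)\<^sup>2)"
      by (rule integrableI_bounded) (use le_less_trans[OF le] in auto)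
    have "ennreal (\<integral>x. (g x)\<^sup>2 \<partial>M) \<le> ennreal (c\<^sup>2)"
      using nn_integral_eq_integral[OF i] le by simp
    then show 1: "(\<integral>x. (g x)\<^sup>2 \<partial>M) \<le> c\<^sup>2" by simp
    show "sqrt (\<integral>x. (g x)\<^sup>2 \<partial>M) \<le> c"
      using real_sqrt_le_mono[OF 1] c by simp
  qed
  note ip = int[OF assms(1) p nonneg(1)] and ir = int[OF assms(2) eq_refl[OF r] nonneg(2)]
    and idf = int[OF borel_measurable_diff[OF assms(1,2)] d nonneg(3)]
  have CS: "\<bar>\<integral>x. (p x - r x) * g x \<partial>M\<bar> \<le> \<delta> * c" "integrable M (\<lambda>x. (p x - r x) * g x)"
    if [measurable]: "g \<in> borel_measurable M" and g: "integrable M (\<lambda>x. (g x)\<^sup>2)" "sqrt (\<integral>x. (g x)\<^sup>2 \<partial>M) \<le> c" for g c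
  proof -
    note cs = Cauchy_Schwarz_integral[OF borel_measurable_diff[OF assms(1,2)] that(1) idf(1) g(1)]
    show "integrable M (\<lambda>x. (p x - r x) * g x)" by (rule cs(1))
    have "sqrt (\<integral>x. (p x - r x)\<^sup>2 \<partial>M) * sqrt (\<integral>x. (g x)\<^sup>2 \<partial>M) \<le> \<delta> * c"
      using idf(3) g(2) nonneg(3) by (intro mult_mono) auto
    with cs(2) show "\<bar>\<integral>x. (p x - r x) * g x \<partial>M\<bar> \<le> \<delta> * c" by linarith
  qed
  note c1 = CS[OF assms(1) ip(1,3)] and c2 = CS[OF assms(2) ir(1,3)]
  have "(\<integral>x. (p x)\<^sup>2 \<partial>M) = (\<integral>x. (r x)\<^sup>2 + ((p x - r x) * p x + (p x - r x) * r x) \<partial>M)"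
    by (intro Bochner_Integration.integral_cong) (auto simp: power2_eq_square algebra_simps)
  also have "\<dots> = (\<integral>x. (r x)\<^sup>2 \<partial>M) + ((\<integral>x. (p x - r x) * p x \<partial>M) + (\<integral>x. (p x - r x) * r x \<partial>M))"
    using c1(2) c2(2) ir(1) by (simp only: Bochner_Integration.integral_add Bochner_Integration.integrable_add)
  also have "\<dots> \<le> b\<^sup>2 + \<delta> * (a + b)"
    using ir(2) c1(1) c2(1) by (simp add: distrib_left)
  finally show ?thesis
    using nn_integral_eq_integral[OF ip(1)] by (simp add: ennreal_leI)
qed

text \<open>The integral over \<open>\<Omega> s\<close> is pulled back to \<open>\<Omega> t\<close>
  at the cost of the volume factor \<open>q\<close>, and there the composition with the flow is
  replaced by the function itself. Both errors are linear in \<open>\<bar>s - t\<bar>\<close>: that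
  of \<open>q - 1\<close> by \<open>exp_minus_one_le\<close>, the other by the estimate along
  trajectories.\<close>

lemma transported_L2_norm_le:
  fixes w \<Psi> :: "real \<Rightarrow> real^'d::finite \<Rightarrow> real^'d"
  assumes B: "open B" and \<Omega>: "\<And>t. t \<in> {0..T} \<Longrightarrow> open (\<Omega> t) \<and> \<Omega> t \<subseteq> B"
    and p: "passively_transported T w \<Psi> \<Omega>" and T: "T > 0"
    and L: "L \<ge> 0" "\<And>t. t \<in> {0..T} \<Longrightarrow> L-lipschitz_on (\<Omega> t) (w t)"
    and W: "W \<ge> 0" "\<And>t x. t \<in> {0..T} \<Longrightarrow> x \<in> \<Omega> t \<Longrightarrow> norm (w t x) \<le> W"
    and \<Psi>c: "continuous_on ({0..T} \<times> \<Omega> 0) (\<lambda>(t, y). \<Psi> t y)"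
  obtains A where "A \<ge> 0" "\<And>s t U. s \<in> {0..T} \<Longrightarrow> t \<in> {0..T} \<Longrightarrow> U \<in> sobolev 1 B \<Longrightarrow>
    (L2_norm (\<Omega> s) U)\<^sup>2 \<le> (L2_norm (\<Omega> t) U)\<^sup>2
      + A * \<bar>s - t\<bar> * ((L2_norm B U)\<^sup>2 + L2_norm B U * L2_norm B (weak_grad B U))"
proof -
  define D where "D = real CARD('d)"
  define Q where "Q = exp (D * L * T)"
  \<comment> \<open>\<open>Q\<close> bounds the volume factor over the whole time interval. The
    first summand comes from \<open>q - 1\<close>, the second from \<open>\<delta>\<close> times the
    norms of the composed and of the original function.\<close>
  define A where "A = D * L * Q + Q * W * sqrt Q * (sqrt Q + 1)"
  have D0: "D \<ge> 0" by (simp add: D_def)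
  have Q1: "Q \<ge> 1" using L(1) T D0 by (simp add: Q_def)
  have A0: "A \<ge> 0" using D0 L(1) W(1) Q1 by (simp add: A_def)
  \<comment> \<open>The flow from time \<open>t\<close> to time \<open>s\<close> passes through the
    initial position, which is unique by the injectivity shown below.\<close>
  define \<Phi> where "\<Phi> s t x = \<Psi> s (inv_into (\<Omega> 0) (\<Psi> t) x)" for s t x
  have T0: "0 \<in> {0..T}" using T by simp
  have Bb: "B \<in> sets borel" and Ob: "\<Omega> t \<in> sets borel" "\<Omega> t \<subseteq> B" if "t \<in> {0..T}" for t
    using B \<Omega>[OF that] by auto
  have inv: "inv_into (\<Omega> 0) (\<Psi> t) x \<in> \<Omega> 0" "\<Psi> t (inv_into (\<Omega> 0) (\<Psi> t) x) = x" if "t \<in> {0..T}" "x \<in> \<Omega> t" for t x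
    using that passively_transportedD(2)[OF p that(1)] by (auto intro: inv_into_into f_inv_into_f)
  have \<Phi>in: "\<Phi> s t x \<in> \<Omega> s" if "s \<in> {0..T}" "t \<in> {0..T}" "x \<in> \<Omega> t" for s t x
    unfolding \<Phi>_def using passively_transportedD(3)[OF p that(1)] inv(1)[OF that(2,3)] by blast
  have \<Phi>lip: "norm (\<Phi> s t x - \<Phi> s t y) \<le> exp (L * \<bar>s - t\<bar>) * norm (x - y)"
    if "s \<in> {0..T}" "t \<in> {0..T}" "x \<in> \<Omega> t" "y \<in> \<Omega> t" for s t x y
    using flow_lipschitz[OF p L(2) that(1,2) inv(1)[OF that(2,3)] inv(1)[OF that(2,4)]]
      inv(2)[OF that(2,3)] inv(2)[OF that(2,4)] by (simp add: \<Phi>_def)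
  have \<Phi>ex: "norm (x - y) \<le> exp (L * \<bar>s - t\<bar>) * norm (\<Phi> s t x - \<Phi> s t y)"
    if "s \<in> {0..T}" "t \<in> {0..T}" "x \<in> \<Omega> t" "y \<in> \<Omega> t" for s t x y
    using flow_lipschitz[OF p L(2) that(2,1) inv(1)[OF that(2,3)] inv(1)[OF that(2,4)]]
      inv(2)[OF that(2,3)] inv(2)[OF that(2,4)] by (simp add: \<Phi>_def abs_minus_commute)
  have inj: "inj_on (\<Psi> t) (\<Omega> 0)" if t: "t \<in> {0..T}" for t
  proof (rule inj_onI)
    fix x y assume xy: "x \<in> \<Omega> 0" "y \<in> \<Omega> 0" "\<Psi> t x = \<Psi> t y"
    have "\<Psi> 0 x = x" "\<Psi> 0 y = y" using p xy unfolding passively_transported_def by blast+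
    then show "x = y" using flow_lipschitz[OF p L(2) T0 t xy(1,2)] xy(3) by simp
  qed
  have \<Phi>inv: "\<Phi> t s (\<Phi> s t x) = x" if "s \<in> {0..T}" "t \<in> {0..T}" "x \<in> \<Omega> t" for s t x
    unfolding \<Phi>_def using inv[OF that(2,3)] inv_into_f_f[OF inj[OF that(1)]] by simp
  have \<Phi>id: "\<Phi> t t x = x" if "t \<in> {0..T}" "x \<in> \<Omega> t" for t x
    unfolding \<Phi>_def by (rule inv(2)[OF that])
  have \<Phi>Lip: "(exp (L * \<bar>s - t\<bar>))-lipschitz_on (\<Omega> t) (\<Phi> s t)" if "s \<in> {0..T}" "t \<in> {0..T}" for s t
    using \<Phi>lip[OF that] by (intro lipschitz_onI) (auto simp: dist_norm)
  have \<Phi>cont: "continuous_on (\<Omega> t) (\<Phi> s t)" if "s \<in> {0..T}" "t \<in> {0..T}" for s t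
    by (rule lipschitz_on_continuous_on[OF \<Phi>Lip[OF that]])
  have \<Phi>c: "continuous_on ({0..T} \<times> \<Omega> t) (\<lambda>(\<tau>, x). \<Phi> \<tau> t x)" if t: "t \<in> {0..T}" for t
  proof -
    \<comment> \<open>The inverse of \<open>\<Psi> t\<close> is \<open>\<Phi> 0 t\<close>, because
      \<open>\<Psi> 0\<close> is the identity on \<open>\<Omega> 0\<close>, and so it inherits the
      Lipschitz bound of the flow maps.\<close>
    have "continuous_on (\<Omega> t) (inv_into (\<Omega> 0) (\<Psi> t))"
    proof -
      have "continuous_on (\<Omega> t) (\<Phi> 0 t)" by (rule \<Phi>cont[OF T0 t])
      moreover have "\<Phi> 0 t x = inv_into (\<Omega> 0) (\<Psi> t) x" if "x \<in> \<Omega> t" for x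
        unfolding \<Phi>_def using p inv(1)[OF t that] unfolding passively_transported_def by blast
      ultimately show ?thesis by (rule continuous_on_eq)
    qed
    then have "continuous_on ({0..T} \<times> \<Omega> t) (\<lambda>z. (fst z, inv_into (\<Omega> 0) (\<Psi> t) (snd z)))"
      by (intro continuous_on_Pair continuous_on_fst continuous_on_id
          continuous_on_compose2[OF _ continuous_on_snd[OF continuous_on_id]]) auto
    from continuous_on_compose2[OF \<Psi>c this] inv(1)[OF t] show ?thesis
      by (auto simp: \<Phi>_def case_prod_beta image_subset_iff)
  qed
  have main: "(L2_norm (\<Omega> s) U)\<^sup>2 \<le> (L2_norm (\<Omega> t) U)\<^sup>2
      + A * \<bar>s - t\<bar> * ((L2_norm B U)\<^sup>2 + L2_norm B U * L2_norm B (weak_grad B U))"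
    if s: "s \<in> {0..T}" and t: "t \<in> {0..T}" and U: "U \<in> sobolev 1 B" for s t U
  proof -
    have U2: "U \<in> L2_space B" by (rule sobolev_L2[OF U])
    obtain f where f: "f \<in> borel_measurable borel" "\<And>x. x \<notin> B \<Longrightarrow> f x = 0"
      "AE x in lborel. (if x \<in> B then U x else 0) = f x" "integrable lborel (\<lambda>x. (f x)\<^sup>2)"
      by (rule L2_representative[OF Bb[OF t] U2]) blast
    note rep = nn_integral_representative_subset[OF _ _ Bb[OF t] U2 f(1,3,4)]
    note [measurable] = f(1) Ob(1)[OF t] Ob(1)[OF s]
    define G where "G = L2_norm B (weak_grad B U)"
    define nB where "nB = L2_norm B U"
    define b where "b = L2_norm (\<Omega> t) U"
    define q where "q = exp (D * L * \<bar>s - t\<bar>)"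
    define \<delta> where "\<delta> = \<bar>s - t\<bar> * W * sqrt Q * G"
    have G0: "G \<ge> 0" and nB0: "nB \<ge> 0" and b0: "b \<ge> 0" by (simp_all add: G_def nB_def b_def L2_norm_nonneg)
    have \<delta>0: "\<delta> \<ge> 0" using G0 W(1) Q1 by (simp add: \<delta>_def)
    have st: "\<bar>s - t\<bar> \<le> T" using s t by auto
    have q1: "q \<ge> 1" using D0 L(1) by (simp add: q_def)
    have qQ: "q \<le> Q" unfolding q_def Q_def using st D0 L(1) by (simp add: mult_left_mono)
    have ex: "exp (L * \<bar>s - t\<bar>) ^ CARD('d) = q"
      by (simp add: q_def D_def exp_of_nat_mult[symmetric] mult.assoc)
    have le_nB: "L2_norm (\<Omega> r) U \<le> nB" if "r \<in> {0..T}" for r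
      unfolding nB_def by (rule L2_space_subset(2)[OF U2 _ _ Ob(2)[OF that]]) (use Ob[OF that] Bb[OF that] in auto)
    define N where "N = restrict_space lborel (\<Omega> t)"
    have [measurable]: "\<Phi> s t \<in> measurable N borel"
      unfolding N_def by (rule measurable_continuous_on_compact[OF \<Phi>cont[OF s t]])
    have fN[measurable]: "f \<in> borel_measurable N" unfolding N_def by (rule measurable_restrict_space1) simp
    have N_int: "(\<integral>\<^sup>+x. g x \<partial>N) = (\<integral>\<^sup>+x. g x * indicator (\<Omega> t) x \<partial>lborel)" for g
      unfolding N_def using Ob(1)[OF t] by (simp add: nn_integral_restrict_space)
    \<comment> \<open>A crude bound on the composed function, needed as \<open>a\<close> in
      \<open>square_integral_difference_le\<close>. The volume factor here is that of the inverse
      map from \<open>\<Omega> s\<close> to \<open>\<Omega> t\<close>.\<close>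
    have up: "(\<integral>\<^sup>+x. ennreal ((f (\<Phi> s t x))\<^sup>2) \<partial>N) \<le> ennreal ((sqrt Q * nB)\<^sup>2)"
    proof -
      have "(\<integral>\<^sup>+x. ennreal ((f (\<Phi> s t x))\<^sup>2) \<partial>N) = (\<integral>\<^sup>+x. ennreal ((f (\<Phi> s t x))\<^sup>2) * indicator (\<Omega> t) x \<partial>lborel)"
        by (rule N_int)
      also have "\<dots> \<le> ennreal (exp (L * \<bar>t - s\<bar>) ^ DIM(real^'d)) * (\<integral>\<^sup>+x. ennreal ((f x)\<^sup>2) * indicator (\<Omega> s) x \<partial>lborel)"
        by (rule nn_integral_compose_le[OF Ob(1)[OF t] Ob(1)[OF s] \<Phi>cont[OF s t] _ \<Phi>Lip[OF t s], of "\<lambda>x. ennreal ((f x)\<^sup>2)"])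
           (use \<Phi>in[OF s t] \<Phi>inv[OF s t] in auto)
      also have "\<dots> = ennreal q * ennreal ((L2_norm (\<Omega> s) U)\<^sup>2)"
        unfolding rep[OF Ob[OF s]] using ex by (simp add: abs_minus_commute)
      also have "\<dots> = ennreal (q * (L2_norm (\<Omega> s) U)\<^sup>2)" using q1 by (simp add: ennreal_mult)
      also have "\<dots> \<le> ennreal ((sqrt Q * nB)\<^sup>2)"
      proof (rule ennreal_leI)
        have "q * (L2_norm (\<Omega> s) U)\<^sup>2 \<le> Q * nB\<^sup>2"
          using qQ Q1 le_nB[OF s] L2_norm_nonneg by (intro mult_mono power_mono) auto
        then show "q * (L2_norm (\<Omega> s) U)\<^sup>2 \<le> (sqrt Q * nB)\<^sup>2" using Q1 by (simp add: power_mult_distrib)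
      qed
      finally show ?thesis .
    qed
    have rt: "(\<integral>\<^sup>+x. ennreal ((f x)\<^sup>2) \<partial>N) = ennreal (b\<^sup>2)"
      unfolding N_int b_def by (rule rep[OF Ob[OF t]])
    have diff: "(\<integral>\<^sup>+x. ennreal ((f (\<Phi> s t x) - f x)\<^sup>2) \<partial>N) \<le> ennreal (\<delta>\<^sup>2)"
    proof -
      have "(\<integral>\<^sup>+x. ennreal ((f (\<Phi> s t x) - f x)\<^sup>2) \<partial>N) = (\<integral>\<^sup>+x. ennreal ((f (\<Phi> s t x) - f (\<Phi> t t x))\<^sup>2) \<partial>N)"
        by (intro nn_integral_cong) (simp add: N_def space_restrict_space \<Phi>id[OF t])
      also have "\<dots> \<le> ennreal (\<bar>s - t\<bar>\<^sup>2 * W\<^sup>2 * (exp (L * T) ^ CARD('d) * (L2_norm B (weak_grad B U))\<^sup>2))"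
        unfolding N_def
      proof (rule square_difference_along_flow[OF B U f(1,3,4) _ s t _ _ _ \<Phi>c[OF t]])
        show "open (\<Omega> t)" using \<Omega>[OF t] by blast
        fix x \<tau> assume \<tau>: "\<tau> \<in> {0..T}" and x: "x \<in> \<Omega> t"
        show "((\<lambda>\<sigma>. \<Phi> \<sigma> t x) has_vector_derivative w \<tau> (\<Phi> \<tau> t x)) (at \<tau> within {0..T})"
          unfolding \<Phi>_def by (rule passively_transportedD(1)[OF p \<tau> inv(1)[OF t x]])
        show "norm (w \<tau> (\<Phi> \<tau> t x)) \<le> W" by (rule W(2)[OF \<tau> \<Phi>in[OF \<tau> t x]])
        show "\<Phi> \<tau> t x \<in> B" using \<Phi>in[OF \<tau> t x] Ob(2)[OF \<tau>] by blast
        fix y assume y: "y \<in> \<Omega> t"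
        have "exp (L * \<bar>\<tau> - t\<bar>) \<le> exp (L * T)" using \<tau> t L(1) by (auto intro!: mult_left_mono)
        then have "exp (L * \<bar>\<tau> - t\<bar>) * norm (\<Phi> \<tau> t x - \<Phi> \<tau> t y) \<le> exp (L * T) * norm (\<Phi> \<tau> t x - \<Phi> \<tau> t y)"
          by (intro mult_right_mono) auto
        with \<Phi>ex[OF \<tau> t x y] show "norm (x - y) \<le> exp (L * T) * norm (\<Phi> \<tau> t x - \<Phi> \<tau> t y)"
          by linarith
      next
        fix \<tau> assume \<tau>: "\<tau> \<in> {0..T}"
        show "continuous_on (\<Omega> t) (\<lambda>x. w \<tau> (\<Phi> \<tau> t x))"
          by (rule continuous_on_compose2[OF lipschitz_on_continuous_on[OF L(2)[OF \<tau>]] \<Phi>cont[OF \<tau> t]])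
             (use \<Phi>in[OF \<tau> t] in auto)
      qed simp
      also have "\<bar>s - t\<bar>\<^sup>2 * W\<^sup>2 * (exp (L * T) ^ CARD('d) * (L2_norm B (weak_grad B U))\<^sup>2) = \<delta>\<^sup>2"
        using Q1 by (simp add: \<delta>_def G_def Q_def D_def power_mult_distrib exp_of_nat_mult[symmetric] mult.assoc)
      finally show ?thesis .
    qed
    have "ennreal ((L2_norm (\<Omega> s) U)\<^sup>2) = (\<integral>\<^sup>+x. ennreal ((f x)\<^sup>2) * indicator (\<Omega> s) x \<partial>lborel)"
      by (rule rep[OF Ob[OF s], symmetric])
    \<comment> \<open>On \<open>\<Omega> s\<close> the two flow maps cancel. The indicator of
      \<open>\<Omega> t\<close> is inserted because the composition is known to be Borel only on
      that set.\<close>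
    also have "\<dots> = (\<integral>\<^sup>+x. (ennreal ((f (\<Phi> s t (\<Phi> t s x)))\<^sup>2) * indicator (\<Omega> t) (\<Phi> t s x)) * indicator (\<Omega> s) x \<partial>lborel)"
      by (intro nn_integral_cong) (use \<Phi>in[OF t s] \<Phi>inv[OF t s] in \<open>auto simp: indicator_def\<close>)
    also have "\<dots> \<le> ennreal (exp (L * \<bar>s - t\<bar>) ^ DIM(real^'d)) *
        (\<integral>\<^sup>+x. (ennreal ((f (\<Phi> s t x))\<^sup>2) * indicator (\<Omega> t) x) * indicator (\<Omega> t) x \<partial>lborel)"
    proof (rule nn_integral_compose_le[OF Ob(1)[OF s] Ob(1)[OF t] \<Phi>cont[OF t s] _ \<Phi>Lip[OF s t], of "\<lambda>x. ennreal ((f (\<Phi> s t x))\<^sup>2) * indicator (\<Omega> t) x"])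
      have "(\<lambda>x. ennreal ((f (\<Phi> s t x))\<^sup>2)) \<in> borel_measurable N" by measurable
      then show "(\<lambda>x. ennreal ((f (\<Phi> s t x))\<^sup>2) * indicator (\<Omega> t) x) \<in> borel_measurable borel"
        unfolding N_def by (subst (asm) borel_measurable_restrict_space_iff_ennreal) auto
    qed (use \<Phi>in[OF t s] \<Phi>inv[OF t s] in auto)
    also have "\<dots> = ennreal q * (\<integral>\<^sup>+x. ennreal ((f (\<Phi> s t x))\<^sup>2) \<partial>N)"
      unfolding N_int using ex by (simp add: mult.assoc indicator_inter_arith[symmetric])
    also have "\<dots> \<le> ennreal q * ennreal (b\<^sup>2 + \<delta> * (sqrt Q * nB + b))"
      using Q1 nB0 by (intro mult_left_mono square_integral_difference_le[OF _ fN up rt diff _ b0 \<delta>0]) auto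
    also have "\<dots> = ennreal (q * (b\<^sup>2 + \<delta> * (sqrt Q * nB + b)))"
      using q1 by (simp add: ennreal_mult')
    finally have "(L2_norm (\<Omega> s) U)\<^sup>2 \<le> q * (b\<^sup>2 + \<delta> * (sqrt Q * nB + b))"
      using q1 b0 \<delta>0 nB0 Q1 by (subst (asm) ennreal_le_iff) auto
    also have "\<dots> = b\<^sup>2 + (q - 1) * b\<^sup>2 + q * (\<delta> * (sqrt Q * nB + b))" by (simp add: algebra_simps)
    also have "\<dots> \<le> b\<^sup>2 + (D * L * \<bar>s - t\<bar> * Q) * nB\<^sup>2 + Q * (\<delta> * (sqrt Q * nB + nB))"
    proof (intro add_mono order_refl)
      have "q - 1 \<le> D * L * \<bar>s - t\<bar> * q" unfolding q_def by (rule exp_minus_one_le)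
      also have "\<dots> \<le> D * L * \<bar>s - t\<bar> * Q" using qQ D0 L(1) by (intro mult_left_mono) auto
      finally show "(q - 1) * b\<^sup>2 \<le> (D * L * \<bar>s - t\<bar> * Q) * nB\<^sup>2"
        using le_nB[OF t] b0 Q1 D0 L(1) unfolding b_def by (intro mult_mono power_mono) auto
      show "q * (\<delta> * (sqrt Q * nB + b)) \<le> Q * (\<delta> * (sqrt Q * nB + nB))"
        using le_nB[OF t] qQ q1 \<delta>0 Q1 nB0 b0 unfolding b_def by (intro mult_mono mult_left_mono add_mono) auto
    qed
    also have "\<dots> = b\<^sup>2 + \<bar>s - t\<bar> * ((D * L * Q) * nB\<^sup>2 + (Q * W * sqrt Q * (sqrt Q + 1)) * (nB * G))"
      by (simp add: \<delta>_def algebra_simps)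
    also have "\<dots> \<le> b\<^sup>2 + \<bar>s - t\<bar> * (A * nB\<^sup>2 + A * (nB * G))"
      using D0 L(1) Q1 W(1) nB0 G0 unfolding A_def
      by (intro add_mono order_refl mult_left_mono mult_right_mono) auto
    also have "\<dots> = b\<^sup>2 + A * \<bar>s - t\<bar> * (nB\<^sup>2 + nB * G)" by (simp add: algebra_simps)
    finally show ?thesis by (simp add: b_def nB_def G_def)
  qed
  show ?thesis by (rule that[OF A0 main])
qed

section \<open>The energy estimate\<close>

text \<open>The implicit factor \<open>1 - x\<close> is inverted by \<open>exp (2 * x)\<close> as
  long as \<open>x\<close> is at most 1/2; multiplying each step by this number closes the
  induction, and the accumulated sums of \<open>g\<close> and \<open>h\<close> only gain from
  it.\<close>

lemma discrete_gronwall: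
  fixes a g h :: "nat \<Rightarrow> real"
  assumes c: "0 \<le> x" "x \<le> 1 / 2"
    and nonneg: "\<And>n. 0 \<le> a n" "\<And>n. 0 \<le> g n" "\<And>n. 0 \<le> h n"
    and step: "\<And>n. n < N \<Longrightarrow> (1 - x) * a (Suc n) + g (Suc n) \<le> a n + h (Suc n)"
    and n: "n \<le> N"
  shows "a n + (\<Sum>k=1..n. g k) \<le> exp (2 * x * real n) * (a 0 + (\<Sum>k=1..n. h k))"
  using n
proof (induction n)
  case 0
  then show ?case by simp
next
  case (Suc n)
  define e where "e = exp (2 * x)"
  have e1: "e \<ge> 1" using c by (simp add: e_def)
  \<comment> \<open>The right-hand side equals \<open>1 + x * (1 - 2 * x)\<close>.\<close>
  have "1 \<le> (1 + 2 * x) * (1 - x)"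
    using mult_left_mono[OF c(2,1)] by (simp add: algebra_simps)
  also have "\<dots> \<le> e * (1 - x)"
    unfolding e_def using c by (intro mult_right_mono exp_ge_add_one_self) auto
  finally have ex: "1 \<le> e * (1 - x)" .
  have en: "exp (2 * x * real (Suc n)) = e * exp (2 * x * real n)"
    by (simp add: e_def algebra_simps flip: exp_add)
  define G where "G = (\<Sum>k=1..n. g k)"
  define H where "H = (\<Sum>k=1..n. h k)"
  have G0: "G \<ge> 0" unfolding G_def by (intro sum_nonneg nonneg)
  have "a (Suc n) + g (Suc n) \<le> e * ((1 - x) * a (Suc n) + g (Suc n))"
    using mult_right_mono[OF ex nonneg(1)[of "Suc n"]] mult_right_mono[OF e1 nonneg(2)[of "Suc n"]]
    by (simp add: algebra_simps)
  also have "\<dots> \<le> e * (a n + h (Suc n))"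
    using step[of n] Suc.prems e1 by (intro mult_left_mono) auto
  finally have "a (Suc n) + g (Suc n) + G \<le> e * (a n + h (Suc n)) + e * G"
    using mult_right_mono[OF e1 G0] by simp
  also have "\<dots> = e * (a n + G) + e * h (Suc n)" by (simp add: algebra_simps)
  also have "\<dots> \<le> e * (exp (2 * x * real n) * (a 0 + H)) + e * (exp (2 * x * real n) * h (Suc n))"
  proof (intro add_mono mult_left_mono)
    show "a n + G \<le> exp (2 * x * real n) * (a 0 + H)"
      using Suc unfolding G_def H_def by simp
    show "h (Suc n) \<le> exp (2 * x * real n) * h (Suc n)"
      using mult_right_mono[of 1 "exp (2 * x * real n)", OF _ nonneg(3)[of "Suc n"]] c by simp
  qed (use e1 in auto)
  also have "\<dots> = exp (2 * x * real (Suc n)) * (a 0 + H + h (Suc n))"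
    unfolding en by (simp add: algebra_simps)
  finally show ?case by (simp add: G_def H_def add_ac)
qed

text \<open>Cauchy-Schwarz bounds the transport term by \<open>W\<close> times the product of
  function and gradient norms. The product is kept as it is, so that Young's inequality can be
  applied once to all such terms together.\<close>

lemma bilin_form_lower_bound:
  fixes u :: "real^'d::finite \<Rightarrow> real"
  assumes S: "open S" and u: "u \<in> sobolev 1 S"
    and b: "continuous_on S b" "\<And>x. x \<in> S \<Longrightarrow> norm (b x) \<le> W" "W \<ge> 0"
  shows "\<nu> * (L2_norm S (weak_grad S u))\<^sup>2 - W * L2_norm S u * L2_norm S (weak_grad S u) \<le> bilin_form \<nu> S b u u"
proof -
  define z where "z x = b x \<bullet> weak_grad S u x" for x
  define g where "g = L2_norm S (weak_grad S u)"
  have i: "integrable (lebesgue_on S) (\<lambda>x. (norm (weak_grad S u x))\<^sup>2)"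
    by (rule weak_grad_L2_norm_square(1)[OF u])
  have zb: "(z x)\<^sup>2 \<le> W\<^sup>2 * (norm (weak_grad S u x))\<^sup>2" if "x \<in> S" for x
  proof -
    have "\<bar>z x\<bar> \<le> norm (b x) * norm (weak_grad S u x)" unfolding z_def by (rule Cauchy_Schwarz_ineq2)
    also have "\<dots> \<le> W * norm (weak_grad S u x)" using b(2)[OF that] by (intro mult_right_mono) auto
    finally have "\<bar>z x\<bar>\<^sup>2 \<le> (W * norm (weak_grad S u x))\<^sup>2" by (intro power_mono) auto
    then show ?thesis by (simp add: power_mult_distrib)
  qed
  have zm: "z \<in> borel_measurable (lebesgue_on S)"
  proof -
    have "b \<in> borel_measurable (lebesgue_on S)"
      using S by (intro continuous_imp_measurable_on_sets_lebesgue[OF b(1)]) simp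
    then have "(\<lambda>x. b x $ i) \<in> borel_measurable (lebesgue_on S)" for i
      using borel_measurable_continuous_onI[of "\<lambda>y :: real^'d. y $ i"] by (auto intro: measurable_compose continuous_intros)
    moreover have "weak_partials S [i] u \<in> borel_measurable (lebesgue_on S)" for i
      using weak_partials_single(1)[OF u] by (simp add: L2_space_def)
    ultimately have "(\<lambda>x. \<Sum>i\<in>UNIV. b x $ i * weak_partials S [i] u x) \<in> borel_measurable (lebesgue_on S)"
      by (intro borel_measurable_sum borel_measurable_times)
    then show ?thesis by (simp add: z_def[abs_def] inner_vec_def weak_grad_def)
  qed
  have iW: "integrable (lebesgue_on S) (\<lambda>x. W\<^sup>2 * (norm (weak_grad S u x))\<^sup>2)" using i by simp
  have zi: "integrable (lebesgue_on S) (\<lambda>x. (z x)\<^sup>2)"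
  proof (rule Bochner_Integration.integrable_bound[OF iW])
    show "(\<lambda>x. (z x)\<^sup>2) \<in> borel_measurable (lebesgue_on S)" using zm by measurable
    show "AE x in lebesgue_on S. norm ((z x)\<^sup>2) \<le> norm (W\<^sup>2 * (norm (weak_grad S u x))\<^sup>2)"
      by (rule AE_I2) (use zb in simp)
  qed
  have zL: "z \<in> L2_space S" using zm zi by (simp add: L2_space_def)
  have "(L2_norm S z)\<^sup>2 \<le> (W * g)\<^sup>2"
  proof -
    have "(L2_norm S z)\<^sup>2 = (\<integral>x. (z x)\<^sup>2 \<partial>lebesgue_on S)" by (simp add: L2_norm_square)
    also have "\<dots> \<le> (\<integral>x. W\<^sup>2 * (norm (weak_grad S u x))\<^sup>2 \<partial>lebesgue_on S)"
      by (rule integral_mono[OF zi iW]) (use zb in simp)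
    also have "\<dots> = (W * g)\<^sup>2" by (simp add: g_def L2_norm_square power_mult_distrib)
    finally show ?thesis .
  qed
  then have zn: "L2_norm S z \<le> W * g"
    by (rule power2_le_imp_le) (simp add: g_def b(3) L2_norm_nonneg)
  note cs = L2_Cauchy_Schwarz[OF sobolev_L2[OF u] zL]
  have "\<bar>\<integral>x. u x * z x \<partial>lebesgue_on S\<bar> \<le> L2_norm S u * (W * g)"
    using cs(2) mult_left_mono[OF zn L2_norm_nonneg] by (rule order_trans)
  moreover have "bilin_form \<nu> S b u u = \<nu> * g\<^sup>2 - (\<integral>x. u x * z x \<partial>lebesgue_on S)"
  proof -
    have "bilin_form \<nu> S b u u = (\<integral>x. \<nu> * (norm (weak_grad S u x))\<^sup>2 - u x * z x \<partial>lebesgue_on S)"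
      by (simp add: bilin_form_def z_def power2_norm_eq_inner)
    also have "\<dots> = (\<integral>x. \<nu> * (norm (weak_grad S u x))\<^sup>2 \<partial>lebesgue_on S) - (\<integral>x. u x * z x \<partial>lebesgue_on S)"
      using i cs(1) by (intro Bochner_Integration.integral_diff) auto
    finally show ?thesis by (simp add: g_def L2_norm_square)
  qed
  ultimately show ?thesis by (simp add: g_def mult_ac)
qed

text \<open>The scheme identity is doubled so that the pairing of old and new solution is bounded by
  \<open>p\<^sup>2 + r\<^sup>2\<close>, whose part \<open>r\<^sup>2\<close> uses up one of the two
  \<open>a\<^sup>2\<close>. Here \<open>p\<close> stands for the norm of the old solution,
  \<open>r\<close> for that of the extended new one on the previous domain, and \<open>H\<close> for
  the dual norm of the source.\<close>

lemma energy_step_arithmetic: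
  fixes a g p H I F dt \<nu> W A c R :: real
  assumes pos: "dt > 0" "\<nu> > 0"
    and scheme: "1 / dt * (a\<^sup>2 - I) + bil = F"
    and bil: "\<nu> * g\<^sup>2 - W * a * g \<le> bil"
    and F: "\<bar>F\<bar> \<le> H * sqrt (a\<^sup>2 + g\<^sup>2)"
    and I: "\<bar>I\<bar> \<le> p * r"
    and r: "r\<^sup>2 \<le> a\<^sup>2 + dt * (A * a\<^sup>2 + A' * (a * g))"
    and c: "c = A + \<nu> / 2 + (A' + 2 * W)\<^sup>2 / (4 * \<nu>)"
  shows "(1 - c * dt) * a\<^sup>2 + dt * (\<nu> / 2 * g\<^sup>2) \<le> p\<^sup>2 + dt * (2 / \<nu> * H\<^sup>2)"
proof -
  define R where "R = A' + 2 * W"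
  have "a\<^sup>2 - I = dt * (F - bil)" using scheme pos by (simp add: field_simps)
  also have "\<dots> \<le> dt * (H * sqrt (a\<^sup>2 + g\<^sup>2) - (\<nu> * g\<^sup>2 - W * a * g))"
    using F bil pos by (intro mult_left_mono) auto
  finally have 1: "a\<^sup>2 \<le> I + dt * (H * sqrt (a\<^sup>2 + g\<^sup>2) - (\<nu> * g\<^sup>2 - W * a * g))" by simp
  have "2 * (p * r) \<le> p\<^sup>2 + r\<^sup>2" using sum_squares_bound[of p r] by simp
  then have 2: "2 * I \<le> p\<^sup>2 + a\<^sup>2 + dt * (A * a\<^sup>2 + A' * (a * g))" using I r by linarith
  \<comment> \<open>The weight in Young's inequality is chosen so that the gradient costs
    \<open>\<nu> / 2\<close>; the same weight on \<open>a\<^sup>2\<close> is the second summand of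
    \<open>c\<close>.\<close>
  have 3: "2 * (H * sqrt (a\<^sup>2 + g\<^sup>2)) \<le> 2 / \<nu> * H\<^sup>2 + \<nu> / 2 * (a\<^sup>2 + g\<^sup>2)"
  proof -
    define y where "y = sqrt (a\<^sup>2 + g\<^sup>2)"
    have y: "y\<^sup>2 = a\<^sup>2 + g\<^sup>2" by (simp add: y_def)
    have "0 \<le> (2 * H - \<nu> * y)\<^sup>2 / (2 * \<nu>)" using pos by simp
    also have "\<dots> = 2 / \<nu> * H\<^sup>2 + \<nu> / 2 * y\<^sup>2 - 2 * (H * y)"
      using pos by (simp add: field_simps power2_eq_square)
    finally show ?thesis unfolding y by (simp add: y_def)
  qed
  \<comment> \<open>The transport term and the domain change enter through one product, which costs
    \<open>\<nu> * g\<^sup>2\<close> and gives the last summand of \<open>c\<close>.\<close>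
  have 4: "R * (a * g) \<le> \<nu> * g\<^sup>2 + R\<^sup>2 / (4 * \<nu>) * a\<^sup>2"
  proof -
    have "0 \<le> (2 * \<nu> * g - R * a)\<^sup>2 / (4 * \<nu>)" using pos by simp
    also have "\<dots> = \<nu> * g\<^sup>2 + R\<^sup>2 / (4 * \<nu>) * a\<^sup>2 - R * (a * g)"
      using pos by (simp add: field_simps power2_eq_square)
    finally show ?thesis by simp
  qed
  have "a\<^sup>2 \<le> p\<^sup>2 + dt * (A * a\<^sup>2 + A' * (a * g) + 2 * (H * sqrt (a\<^sup>2 + g\<^sup>2)) - 2 * \<nu> * g\<^sup>2 + 2 * W * (a * g))"
    using 1 2 by (simp add: algebra_simps)
  also have "\<dots> = p\<^sup>2 + dt * (A * a\<^sup>2 + 2 * (H * sqrt (a\<^sup>2 + g\<^sup>2)) - 2 * \<nu> * g\<^sup>2 + R * (a * g))"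
    by (simp add: R_def algebra_simps)
  also have "\<dots> \<le> p\<^sup>2 + dt * (A * a\<^sup>2 + (2 / \<nu> * H\<^sup>2 + \<nu> / 2 * (a\<^sup>2 + g\<^sup>2)) - 2 * \<nu> * g\<^sup>2
      + (\<nu> * g\<^sup>2 + R\<^sup>2 / (4 * \<nu>) * a\<^sup>2))"
    using 3 4 pos by (intro add_left_mono mult_left_mono) auto
  also have "\<dots> = p\<^sup>2 + dt * (2 / \<nu> * H\<^sup>2 + c * a\<^sup>2 - \<nu> / 2 * g\<^sup>2)"
    unfolding c R_def[symmetric] by (simp add: algebra_simps)
  finally show ?thesis by (simp add: algebra_simps)
qed

lemma load_functional_bound:
  fixes v :: "real^'d::finite \<Rightarrow> real"
  assumes s: "source_term T \<Omega> f" and t: "t \<in> {0..T}" and S: "open (\<Omega> t)" and v: "v \<in> sobolev 1 (\<Omega> t)"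
  shows "\<bar>load_functional (\<Omega> t) (f t) v\<bar> \<le> dual_H1_norm (\<Omega> t) (load_functional (\<Omega> t) (f t)) * sobolev_norm 1 (\<Omega> t) v"
proof -
  obtain K where K: "\<forall>v\<in>sobolev 1 (\<Omega> t). \<bar>load_functional (\<Omega> t) (f t) v\<bar> \<le> K * sobolev_norm 1 (\<Omega> t) v"
    using s t unfolding source_term_def by blast
  show ?thesis
  proof (rule dual_H1_norm_bound[OF S _ _ v])
    show "\<bar>load_functional (\<Omega> t) (f t) v\<bar> \<le> K * sobolev_norm 1 (\<Omega> t) v" if "v \<in> sobolev 1 (\<Omega> t)" for v
      using K that by blast
    show "load_functional (\<Omega> t) (f t) (\<lambda>x. a * v x) = a * load_functional (\<Omega> t) (f t) v" for a v
      unfolding load_functional_def by (simp add: mult.left_commute[of _ a])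
  qed
qed

theorem lemma2:
  fixes T \<nu> :: real
    and B :: "(real^'d::finite) set"
    and w \<Psi> :: "real \<Rightarrow> real^'d \<Rightarrow> real^'d"
    and \<Omega> :: "real \<Rightarrow> (real^'d) set"
    and E :: "real \<Rightarrow> (real^'d \<Rightarrow> real) \<Rightarrow> (real^'d \<Rightarrow> real)"
  assumes "CARD('d) \<in> {2, 3}" and "T > 0" and "\<nu> > 0"
    and "domain_set B"
    and "smooth_up_to_boundary ({0..T} \<times> B) (\<lambda>(t, x). w t x)"
    and "\<And>t. t \<in> {0..T} \<Longrightarrow> domain_set (\<Omega> t) \<and> bounded (\<Omega> t) \<and> \<Omega> t \<subseteq> B"
    and "lipschitz_boundary (\<Omega> 0)" and "piecewise_smooth_boundary (\<Omega> 0)"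
    and "smooth_up_to_boundary ({0..T} \<times> \<Omega> 0) (\<lambda>(t, y). \<Psi> t y)"
    and "passively_transported T w \<Psi> \<Omega>"
    and "extension_operator T B \<Omega> E"
  shows "\<exists>c>0. \<exists>\<Delta>t\<^sub>0>0. \<forall>f N u.
    source_term T \<Omega> f \<and> N > 0 \<and> T / real N \<le> \<Delta>t\<^sub>0 \<and> scheme_solution T \<nu> w \<Omega> E f N u \<longrightarrow>
      (L2_norm (\<Omega> T) (u N))\<^sup>2
        + T / real N * (\<Sum>n=1..N. \<nu> / 2 *
            (L2_norm (\<Omega> (grid_time T N n)) (weak_grad (\<Omega> (grid_time T N n)) (u n)))\<^sup>2)
      \<le> exp (c * T) *
          ((L2_norm (\<Omega> 0) (u 0))\<^sup>2
            + T / real N * (\<Sum>n=1..N. 2 / \<nu> *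
                (dual_H1_norm (\<Omega> (grid_time T N n))
                   (load_functional (\<Omega> (grid_time T N n)) (f (grid_time T N n))))\<^sup>2))"
proof -
  have dom: "open (\<Omega> t)" "bounded (\<Omega> t)" "\<Omega> t \<subseteq> B" if "t \<in> {0..T}" for t
    using assms(6)[OF that] by (auto simp: domain_set_def)
  have dom': "open (\<Omega> t) \<and> \<Omega> t \<subseteq> B" if "t \<in> {0..T}" for t
    using dom[OF that] by blast
  have B: "open B" using assms(4) by (simp add: domain_set_def)
  have T: "T > 0" and \<nu>: "\<nu> > 0" by (rule assms)+
  have T0: "0 \<in> {0..T}" using T by simp
  obtain L W where LW: "L \<ge> 0" "W \<ge> 0"
    and Lip: "\<And>t. t \<in> {0..T} \<Longrightarrow> L-lipschitz_on (\<Omega> t) (w t)"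
    and Wb: "\<And>t x. t \<in> {0..T} \<Longrightarrow> x \<in> \<Omega> t \<Longrightarrow> norm (w t x) \<le> W"
    and \<Psi>c: "continuous_on ({0..T} \<times> \<Omega> 0) (\<lambda>(t, y). \<Psi> t y)"
    by (rule transported_domain_constants[OF assms(5,9,10) dom(3) dom(2)[OF T0]], assumption, rule that)
  obtain A where A: "A \<ge> 0" "\<And>s t U. s \<in> {0..T} \<Longrightarrow> t \<in> {0..T} \<Longrightarrow> U \<in> sobolev 1 B \<Longrightarrow>
    (L2_norm (\<Omega> s) U)\<^sup>2 \<le> (L2_norm (\<Omega> t) U)\<^sup>2
      + A * \<bar>s - t\<bar> * ((L2_norm B U)\<^sup>2 + L2_norm B U * L2_norm B (weak_grad B U))"
    by (rule transported_L2_norm_le[OF B dom' assms(10) T LW(1) Lip LW(2) Wb \<Psi>c], assumption+, rule that)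
  note ext = assms(11)[unfolded extension_operator_def]
  obtain C0 where C0: "\<forall>t\<in>{0..T}. \<forall>u\<in>sobolev 0 (\<Omega> t).
      E t u \<in> sobolev 0 B \<and> sobolev_norm 0 B (E t u) \<le> C0 * sobolev_norm 0 (\<Omega> t) u"
    using ext by blast
  have ext1: "\<exists>C. \<forall>t\<in>{0..T}. \<forall>u\<in>sobolev 1 (\<Omega> t). E t u \<in> sobolev 1 B \<and> sobolev_norm 1 B (E t u) \<le> C * sobolev_norm 1 (\<Omega> t) u"
    using ext by blast
  obtain C1 where C1: "\<forall>t\<in>{0..T}. \<forall>u\<in>sobolev 1 (\<Omega> t).
      L2_norm B (weak_grad B (E t u)) \<le> C1 * L2_norm (\<Omega> t) (weak_grad (\<Omega> t) u)"
    using ext by blast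
  have E_sob: "E t u \<in> sobolev 1 B" if "t \<in> {0..T}" "u \<in> sobolev 1 (\<Omega> t)" for t u
    using ext1 that by blast
  \<comment> \<open>The constants of the extension operator carry no sign, hence
    \<open>\<bar>C0\<bar>\<close>, and \<open>\<bar>C1\<bar>\<close> for the gradient.\<close>
  have E_L2: "L2_norm B (E t u) \<le> \<bar>C0\<bar> * L2_norm (\<Omega> t) u" if "t \<in> {0..T}" "u \<in> sobolev 1 (\<Omega> t)" for t u
  proof -
    have "L2_norm B (E t u) \<le> C0 * L2_norm (\<Omega> t) u"
      using C0 that sobolev_0[OF sobolev_L2[OF that(2)]] unfolding sobolev_norm_0 by blast
    also have "\<dots> \<le> \<bar>C0\<bar> * L2_norm (\<Omega> t) u" by (intro mult_right_mono L2_norm_nonneg) simp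
    finally show ?thesis .
  qed
  have E_grad: "L2_norm B (weak_grad B (E t u)) \<le> \<bar>C1\<bar> * L2_norm (\<Omega> t) (weak_grad (\<Omega> t) u)"
    if "t \<in> {0..T}" "u \<in> sobolev 1 (\<Omega> t)" for t u
  proof -
    have "L2_norm B (weak_grad B (E t u)) \<le> C1 * L2_norm (\<Omega> t) (weak_grad (\<Omega> t) u)"
      using C1 that by blast
    also have "\<dots> \<le> \<bar>C1\<bar> * L2_norm (\<Omega> t) (weak_grad (\<Omega> t) u)" by (intro mult_right_mono L2_norm_nonneg) simp
    finally show ?thesis .
  qed
  have E_ae: "AE x in lebesgue_on (\<Omega> t). E t u x = u x" if "t \<in> {0..T}" "u \<in> L2_space (\<Omega> t)" for t u
    using ext that by blast
  \<comment> \<open>The extension bounds replace the norms over \<open>B\<close> by norms over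
    \<open>\<Omega> t\<close>: the squared norm picks up \<open>\<bar>C0\<bar>\<^sup>2\<close>, the
    product \<open>\<bar>C0\<bar> * \<bar>C1\<bar>\<close>.\<close>
  have E_norm: "(L2_norm (\<Omega> s) (E t u))\<^sup>2 \<le> (L2_norm (\<Omega> t) u)\<^sup>2
      + \<bar>s - t\<bar> * ((A * \<bar>C0\<bar>\<^sup>2) * (L2_norm (\<Omega> t) u)\<^sup>2 + (A * \<bar>C0\<bar> * \<bar>C1\<bar>) * (L2_norm (\<Omega> t) u * L2_norm (\<Omega> t) (weak_grad (\<Omega> t) u)))"
    if s: "s \<in> {0..T}" and t: "t \<in> {0..T}" and u: "u \<in> sobolev 1 (\<Omega> t)" for s t u
  proof -
    define a where "a = L2_norm (\<Omega> t) u"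
    define g where "g = L2_norm (\<Omega> t) (weak_grad (\<Omega> t) u)"
    have ag: "a \<ge> 0" "g \<ge> 0" by (simp_all add: a_def g_def L2_norm_nonneg)
    have E2: "E t u \<in> L2_space (\<Omega> t)"
      by (rule L2_space_subset(1)[OF sobolev_L2[OF E_sob[OF t u]] _ _ dom(3)[OF t]]) (use B dom(1)[OF t] in auto)
    \<comment> \<open>The extension equals \<open>u\<close> almost everywhere on
      \<open>\<Omega> t\<close>, so the leading term keeps the coefficient 1, without which the
      steps could not be iterated.\<close>
    have eq: "L2_norm (\<Omega> t) (E t u) = a"
      unfolding a_def by (rule L2_norm_cong_AE[OF E2 sobolev_L2[OF u] E_ae[OF t sobolev_L2[OF u]]])
    have "(L2_norm (\<Omega> s) (E t u))\<^sup>2 \<le> a\<^sup>2 + A * \<bar>s - t\<bar> *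
        ((L2_norm B (E t u))\<^sup>2 + L2_norm B (E t u) * L2_norm B (weak_grad B (E t u)))"
      using A(2)[OF s t E_sob[OF t u]] unfolding eq .
    also have "\<dots> \<le> a\<^sup>2 + A * \<bar>s - t\<bar> * ((\<bar>C0\<bar> * a)\<^sup>2 + (\<bar>C0\<bar> * a) * (\<bar>C1\<bar> * g))"
      using E_L2[OF t u] E_grad[OF t u] A(1) ag unfolding a_def[symmetric] g_def[symmetric]
      by (intro add_left_mono mult_left_mono add_mono power_mono mult_mono) (auto intro: L2_norm_nonneg)
    also have "\<dots> = a\<^sup>2 + \<bar>s - t\<bar> * ((A * \<bar>C0\<bar>\<^sup>2) * a\<^sup>2 + (A * \<bar>C0\<bar> * \<bar>C1\<bar>) * (a * g))"
      by (simp only: power_mult_distrib distrib_left mult_ac)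
    finally show ?thesis by (simp only: a_def g_def)
  qed
  \<comment> \<open>The constant of \<open>energy_step_arithmetic\<close> for these coefficients; it
    involves neither \<open>f\<close> nor \<open>N\<close> nor \<open>u\<close>.\<close>
  define c where "c = A * \<bar>C0\<bar>\<^sup>2 + \<nu> / 2 + (A * \<bar>C0\<bar> * \<bar>C1\<bar> + 2 * W)\<^sup>2 / (4 * \<nu>)"
  have c: "c > 0"
    unfolding c_def using A(1) \<nu> by (intro add_pos_nonneg add_nonneg_pos) auto
  have main: "(L2_norm (\<Omega> T) (u N))\<^sup>2
        + T / real N * (\<Sum>n=1..N. \<nu> / 2 *
            (L2_norm (\<Omega> (grid_time T N n)) (weak_grad (\<Omega> (grid_time T N n)) (u n)))\<^sup>2)
      \<le> exp (2 * c * T) *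
          ((L2_norm (\<Omega> 0) (u 0))\<^sup>2
            + T / real N * (\<Sum>n=1..N. 2 / \<nu> *
                (dual_H1_norm (\<Omega> (grid_time T N n))
                   (load_functional (\<Omega> (grid_time T N n)) (f (grid_time T N n))))\<^sup>2))"
    if src: "source_term T \<Omega> f" and N: "N > 0" and small: "T / real N \<le> 1 / (2 * c)"
      and sol: "scheme_solution T \<nu> w \<Omega> E f N u" for f N u
  proof -
    define dt where "dt = T / real N"
    define t where "t = grid_time T N"
    have dt: "dt > 0" using T N by (simp add: dt_def)
    have t_in: "t n \<in> {0..T}" if "n \<le> N" for n
      using that T N by (simp add: t_def grid_time_def field_simps)
    have t_diff: "\<bar>t n - t (Suc n)\<bar> = dt" for n
    proof -
      have "t n - t (Suc n) = - dt"
        by (simp add: t_def grid_time_def dt_def algebra_simps add_divide_distrib)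
      then show ?thesis using dt by simp
    qed
    define a where "a n = L2_norm (\<Omega> (t n)) (u n)" for n
    define g where "g n = L2_norm (\<Omega> (t n)) (weak_grad (\<Omega> (t n)) (u n))" for n
    define H where "H n = dual_H1_norm (\<Omega> (t n)) (load_functional (\<Omega> (t n)) (f (t n)))" for n
    have sols: "\<forall>n\<in>{0..N}. u n \<in> sobolev 1 (\<Omega> (t n))"
      "\<forall>n\<in>{1..N}. \<forall>v\<in>sobolev 1 (\<Omega> (t n)).
           1 / dt * ((\<integral>x. u n x * v x \<partial>lebesgue_on (\<Omega> (t n)))
                     - (\<integral>x. u (n - 1) x * E (t n) v x \<partial>lebesgue_on (\<Omega> (t (n - 1)))))
             + bilin_form \<nu> (\<Omega> (t n)) (w (t n)) (u n) v
           = load_functional (\<Omega> (t n)) (f (t n)) v"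
      using sol unfolding scheme_solution_def Let_def t_def dt_def by blast+
    have us: "u n \<in> sobolev 1 (\<Omega> (t n))" if "n \<le> N" for n using sols(1) that by simp
    have step: "(1 - c * dt) * (a (Suc n))\<^sup>2 + dt * (\<nu> / 2 * (g (Suc n))\<^sup>2) \<le> (a n)\<^sup>2 + dt * (2 / \<nu> * (H (Suc n))\<^sup>2)"
      if n: "n < N" for n
    proof -
      let ?v = "u (Suc n)" and ?S = "\<Omega> (t (Suc n))"
      let ?U = "E (t (Suc n)) ?v"
      have n1: "n \<le> N" "Suc n \<le> N" using n by auto
      note s = t_in[OF n1(1)] and t = t_in[OF n1(2)] and us1 = us[OF n1(1)] and us2 = us[OF n1(2)]
      \<comment> \<open>The test function is the new solution itself, and its extension meets the
        old solution on the previous domain.\<close>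
      note sc = sols(2)[rule_format, of "Suc n" "u (Suc n)"]
      show ?thesis
      proof (rule energy_step_arithmetic[OF dt \<nu> _ _ _ _ _ c_def])
        show "1 / dt * ((a (Suc n))\<^sup>2 - (\<integral>x. u n x * ?U x \<partial>lebesgue_on (\<Omega> (t n))))
          + bilin_form \<nu> ?S (w (t (Suc n))) ?v ?v
          = load_functional ?S (f (t (Suc n))) ?v"
        proof -
          have "(a (Suc n))\<^sup>2 = (\<integral>x. ?v x * ?v x \<partial>lebesgue_on ?S)"
            unfolding a_def L2_norm_square by (simp add: power2_eq_square)
          then show ?thesis using sc us2 n1(2) by simp
        qed
        show "\<nu> * (g (Suc n))\<^sup>2 - W * a (Suc n) * g (Suc n)
          \<le> bilin_form \<nu> ?S (w (t (Suc n))) ?v ?v"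
          unfolding g_def a_def
          by (rule bilin_form_lower_bound[OF dom(1)[OF t] us2 lipschitz_on_continuous_on[OF Lip[OF t]] Wb[OF t] LW(2)])
        have "sobolev_norm 1 ?S ?v = sqrt ((a (Suc n))\<^sup>2 + (g (Suc n))\<^sup>2)"
          using sobolev_norm_1_sum[of ?S "u (Suc n)"] weak_grad_L2_norm_square(2)[OF us2]
            sobolev_norm_nonneg[of 1 ?S "u (Suc n)"]
          by (simp add: a_def g_def real_sqrt_unique)
        then show "\<bar>load_functional ?S (f (t (Suc n))) ?v\<bar>
          \<le> H (Suc n) * sqrt ((a (Suc n))\<^sup>2 + (g (Suc n))\<^sup>2)"
          using load_functional_bound[OF src t dom(1)[OF t] us2] by (simp add: H_def)
        have "?U \<in> L2_space (\<Omega> (t n))"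
          by (rule L2_space_subset(1)[OF sobolev_L2[OF E_sob[OF t us2]] _ _ dom(3)[OF s]])
             (use B dom(1)[OF s] in auto)
        then show "\<bar>\<integral>x. u n x * ?U x \<partial>lebesgue_on (\<Omega> (t n))\<bar>
          \<le> a n * L2_norm (\<Omega> (t n)) ?U"
          unfolding a_def by (rule L2_Cauchy_Schwarz(2)[OF sobolev_L2[OF us1]])
        show "(L2_norm (\<Omega> (t n)) ?U)\<^sup>2 \<le> (a (Suc n))\<^sup>2
          + dt * (A * \<bar>C0\<bar>\<^sup>2 * (a (Suc n))\<^sup>2 + A * \<bar>C0\<bar> * \<bar>C1\<bar> * (a (Suc n) * g (Suc n)))"
          using E_norm[OF s t us2] unfolding t_diff a_def g_def .
      qed
    qed
    have "(a N)\<^sup>2 + (\<Sum>n=1..N. dt * (\<nu> / 2 * (g n)\<^sup>2))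
      \<le> exp (2 * (c * dt) * real N) * ((a 0)\<^sup>2 + (\<Sum>n=1..N. dt * (2 / \<nu> * (H n)\<^sup>2)))"
    \<comment> \<open>The loss per step is \<open>c * dt\<close>, so \<open>N\<close> steps produce
      the exponent \<open>2 * c * T\<close>.\<close>
    proof (rule discrete_gronwall[where x = "c * dt" and N = N and a = "\<lambda>n. (a n)\<^sup>2"
          and g = "\<lambda>n. dt * (\<nu> / 2 * (g n)\<^sup>2)" and h = "\<lambda>n. dt * (2 / \<nu> * (H n)\<^sup>2)"])
      show "c * dt \<le> 1 / 2" using small c unfolding dt_def[symmetric] by (simp add: field_simps)
    qed (use c dt \<nu> step in auto)
    moreover have "t 0 = 0" "t N = T" using N by (simp_all add: t_def grid_time_def)
    moreover have "2 * (c * dt) * real N = 2 * c * T" using N by (simp add: dt_def)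
    ultimately show ?thesis
      by (simp add: a_def g_def H_def t_def dt_def sum_distrib_left)
  qed
  show ?thesis
    \<comment> \<open>The factor 2 is that of \<open>discrete_gronwall\<close>, and the bound on the
      time step keeps \<open>c * dt\<close> at most 1/2.\<close>
    by (rule exI[of _ "2 * c"], intro conjI exI[of _ "1 / (2 * c)"] allI impI) (use c main in auto)
qed

end
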